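(* Let $G_0,G_1$ be groups of exponent $3$ and let $P=G_0*_{\mathcal V_3}G_1$. (1) The following natural maps, induced by the canonical embeddings $G_i\to P$ $(i=0,1)$, are isomorphisms: $$\eta_1:\mathrm{gr}_1(G_0)\oplus\mathrm{gr}_1(G_1)\to\mathrm{gr}_1(P),$$ $$\eta_2:\mathrm{gr}_2(G_0)\oplus(\mathrm{gr}_1(G_0)\otimes\mathrm{gr}_1(G_1))\oplus\mathrm{gr}_2(G_1)\to\mathrm{gr}_2(P),$$ $$\eta_3:\mathrm{gr}_3(G_0)\oplus(\mathrm{gr}_2(G_0)\otimes\mathrm{gr}_1(G_1))\oplus(\mathrm{gr}_1(G_0)\otimes\mathrm{gr}_2(G_1))\oplus\mathrm{gr}_3(G_1)\to\mathrm{gr}_3(P).$$ Here, on the summands $\mathrm{gr}_i(G_0)$ and $\mathrm{gr}_i(G_1)$, $\eta_i$ is the map induced by the canonical embedding, and on the tensor summands $\mathrm{gr}_i(G_0)\otimes\mathrm{gr}_j(G_1)$ (with $i,j\geq1$, $i+j\leq3$) $\eta_{i+j}$ is given by $a\otimes b\mapsto[\eta_i(a),\eta_j(b)]\in\mathrm{gr}_{i+j}(P)$. (2) Identify the domain of $\eta_i$ with its image in $\mathrm{gr}_i(P)$. Put $\mathcal B_{i,j}=\mathrm{gr}_i(G_0)\otimes\mathrm{gr}_j(G_1)$ for $i,j\geq1$ with $i+j\leq3$, $\mathcal B_{i,0}=\mathrm{gr}_i(G_0)$, $\mathcal B_{0,j}=\mathrm{gr}_j(G_1)$ (for $i,j\ge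 1$), and $\mathcal B_{i,j}=0$ for $i+j\geq4$. Then $$[\mathcal B_{i,j},\mathcal B_{k,l}]\subset\mathcal B_{i+k,j+l}.$$
   Context: A group of exponent $3$ means a group satisfying $x^3=1$; $\mathcal V_3$ is the variety of such groups. $G_0*_{\mathcal V_3}G_1=(G_0*G_1)/\langle\langle (G_0*G_1)^3\rangle\rangle$ is the coproduct in $\mathcal V_3$, the quotient of the free product by the normal closure of all cubes; the canonical maps $G_i\to G_0*_{\mathcal V_3}G_1$ are injective. $[a,b]=aba^{-1}b^{-1}$. The lower central series is $\gamma_1(G)=G$, $\gamma_{n+1}(G)=[\gamma_n(G),G]$; groups of exponent $3$ satisfy $\gamma_4(G)=1$. For $G$ of exponent $3$, $\mathrm{gr}_n(G)=\gamma_n(G)/\gamma_{n+1}(G)$, an $\mathbb F_3$-vector space, and $\mathrm{gr}(G)=\bigoplus_{n\geq1}\mathrm{gr}_n(G)$ is a graded Lie algebra over $\mathbb F_3$ with bracket $[a\gamma_{n+1}(G),b\gamma_{m+1}(G)]=[a,b]\gamma_{n+m+1}(G)$ for $a\in\gamma_n(G)$, $b\in\gamma_m(G)$. A homomorphism $f:G\to H$ induces $\mathrm{gr}_i(f):\mathrm{gr}_i(G)\to\mathrm{gr}_i(H)$, $a\gamma_{i+1}(G)\mapsto f(a)\gamma_{i+1}(H)$. Tensor products are over $\mathbb F_3$. *)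

theory Defs
  imports "HOL-Algebra.Generated_Groups" "HOL-Algebra.Module" "HOL-Number_Theory.Residues"
begin

section \<open>Modules\<close>

text \<open>
  The record type of modules extends that of rings; the fields \<open>mult\<close> and \<open>one\<close> play no role
  in a module and are left \<open>undefined\<close> throughout.
\<close>

definition lin_span :: "('r, 'k) ring_scheme \<Rightarrow> ('r, 'm, 'l) module_scheme \<Rightarrow> 'm set \<Rightarrow> 'm set"
  where "lin_span R M S = \<Inter> {H. submodule H R M \<and> S \<subseteq> H}"

definition lin_iso ::
    "('r, 'k) ring_scheme \<Rightarrow> ('r, 'm, 'l) module_scheme \<Rightarrow> ('r, 'n, 'o) module_scheme \<Rightarrow> ('m \<Rightarrow> 'n) set"
  where "lin_iso R M N =
    {h. bij_betw h (carrier M) (carrier N) \<and>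
        (\<forall>x\<in>carrier M. \<forall>y\<in>carrier M. h (x \<oplus>\<^bsub>M\<^esub> y) = h x \<oplus>\<^bsub>N\<^esub> h y) \<and>
        (\<forall>r\<in>carrier R. \<forall>x\<in>carrier M. h (r \<odot>\<^bsub>M\<^esub> x) = r \<odot>\<^bsub>N\<^esub> h x)}"

definition dsum :: "('r, 'm) module \<Rightarrow> ('r, 'n) module \<Rightarrow> ('r, 'm \<times> 'n) module"  (infixr \<open>\<oplus>\<^sub>m\<close> 65)
  where "M \<oplus>\<^sub>m N =
    \<lparr>carrier = carrier M \<times> carrier N, monoid.mult = undefined, one = undefined,
     ring.zero = (\<zero>\<^bsub>M\<^esub>, \<zero>\<^bsub>N\<^esub>),
     add = (\<lambda>(x, y) (x', y'). (x \<oplus>\<^bsub>M\<^esub> x', y \<oplus>\<^bsub>N\<^esub> y')),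
     smult = (\<lambda>r (x, y). (r \<odot>\<^bsub>M\<^esub> x, r \<odot>\<^bsub>N\<^esub> y))\<rparr>"

definition quot_module :: "('r, 'm) module \<Rightarrow> 'm set \<Rightarrow> ('r, 'm set) module"
  where "quot_module M H =
    \<lparr>carrier = a_rcosets\<^bsub>M\<^esub> H, monoid.mult = undefined, one = undefined,
     ring.zero = H,
     add = set_add M,
     smult = (\<lambda>r X. \<Union>x\<in>X. H +>\<^bsub>M\<^esub> (r \<odot>\<^bsub>M\<^esub> x))\<rparr>"

definition free_module :: "('r, 'k) ring_scheme \<Rightarrow> 's set \<Rightarrow> ('r, 's \<Rightarrow> 'r) module"
  where "free_module R S =
    \<lparr>carrier = {c. range c \<subseteq> carrier R \<and> finite {s. c s \<noteq> \<zero>\<^bsub>R\<^esub>} \<and> {s. c s \<noteq> \<zero>\<^bsub>R\<^esub>} \<subseteq> S},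
     monoid.mult = undefined, one = undefined,
     ring.zero = (\<lambda>s. \<zero>\<^bsub>R\<^esub>),
     add = (\<lambda>c d s. c s \<oplus>\<^bsub>R\<^esub> d s),
     smult = (\<lambda>r c s. r \<otimes>\<^bsub>R\<^esub> c s)\<rparr>"

definition free_gen :: "('r, 'k) ring_scheme \<Rightarrow> 's \<Rightarrow> 's \<Rightarrow> 'r"
  where "free_gen R s = (\<lambda>t. if t = s then \<one>\<^bsub>R\<^esub> else \<zero>\<^bsub>R\<^esub>)"

definition tensor_rels ::
    "('r, 'k) ring_scheme \<Rightarrow> ('r, 'm) module \<Rightarrow> ('r, 'n) module \<Rightarrow> ('m \<times> 'n \<Rightarrow> 'r) set"
  where "tensor_rels R M N =
    (let F = free_module R (carrier M \<times> carrier N); e = (\<lambda>x y. free_gen R (x, y)) in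
       {e (x \<oplus>\<^bsub>M\<^esub> x') y \<ominus>\<^bsub>F\<^esub> (e x y \<oplus>\<^bsub>F\<^esub> e x' y) | x x' y.
          x \<in> carrier M \<and> x' \<in> carrier M \<and> y \<in> carrier N} \<union>
       {e x (y \<oplus>\<^bsub>N\<^esub> y') \<ominus>\<^bsub>F\<^esub> (e x y \<oplus>\<^bsub>F\<^esub> e x y') | x y y'.
          x \<in> carrier M \<and> y \<in> carrier N \<and> y' \<in> carrier N} \<union>
       {e (r \<odot>\<^bsub>M\<^esub> x) y \<ominus>\<^bsub>F\<^esub> r \<odot>\<^bsub>F\<^esub> e x y | r x y.
          r \<in> carrier R \<and> x \<in> carrier M \<and> y \<in> carrier N} \<union>
       {e x (r \<odot>\<^bsub>N\<^esub> y) \<ominus>\<^bsub>F\<^esub> r \<odot>\<^bsub>F\<^esub> e x y | r x y.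
          r \<in> carrier R \<and> x \<in> carrier M \<and> y \<in> carrier N})"

definition tensor ::
    "('r, 'k) ring_scheme \<Rightarrow> ('r, 'm) module \<Rightarrow> ('r, 'n) module \<Rightarrow> ('r, ('m \<times> 'n \<Rightarrow> 'r) set) module"
  where "tensor R M N =
    (let F = free_module R (carrier M \<times> carrier N)
     in quot_module F (lin_span R F (tensor_rels R M N)))"

text \<open>
  The linear map \<open>M \<otimes> N \<rightarrow> L\<close> with \<open>x \<otimes> y \<mapsto> f x y\<close>, for bilinear \<open>f\<close>: the linear extension of
  \<open>f\<close> to the free module is constant on the coset \<open>X\<close>, and the value is the element of the image
  of \<open>X\<close>. As in the library's treatment of maps out of \<open>G Mod H\<close>, \<open>the_elem\<close> extracts it.
\<close>
definition tensor_lift ::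
    "('r, 'k) ring_scheme \<Rightarrow> ('r, 'l) module \<Rightarrow> ('m \<Rightarrow> 'n \<Rightarrow> 'l) \<Rightarrow> ('m \<times> 'n \<Rightarrow> 'r) set \<Rightarrow> 'l"
  where "tensor_lift R L f X =
    the_elem ((\<lambda>c. \<Oplus>\<^bsub>L\<^esub>p\<in>{p. c p \<noteq> \<zero>\<^bsub>R\<^esub>}. c p \<odot>\<^bsub>L\<^esub> f (fst p) (snd p)) ` X)"


section \<open>The coproduct in the variety of groups of exponent 3\<close>

definition exponent3_group :: "('a, 'c) monoid_scheme \<Rightarrow> bool"
  where "exponent3_group G \<longleftrightarrow> group G \<and> (\<forall>x\<in>carrier G. x [^]\<^bsub>G\<^esub> (3::nat) = \<one>\<^bsub>G\<^esub>)"

definition normal_closure :: "('a, 'c) monoid_scheme \<Rightarrow> 'a set \<Rightarrow> 'a set"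
  where "normal_closure G S = \<Inter> {N. N \<lhd> G \<and> S \<subseteq> N}"

text \<open>
  The free product is the monoid of words over the disjoint union of the two carriers, modulo
  the least congruence identifying a product formed inside a factor with the two-letter word, and
  the identities of the factors with the empty word.
\<close>
inductive free_prod_eq ::
    "('a, 'c) monoid_scheme \<Rightarrow> ('b, 'd) monoid_scheme \<Rightarrow> ('a + 'b) list \<Rightarrow> ('a + 'b) list \<Rightarrow> bool"
  for G H where
    refl: "w \<in> lists (carrier G <+> carrier H) \<Longrightarrow> free_prod_eq G H w w"
  | sym: "free_prod_eq G H v w \<Longrightarrow> free_prod_eq G H w v"
  | trans: "free_prod_eq G H u v \<Longrightarrow> free_prod_eq G H v w \<Longrightarrow> free_prod_eq G H u w"
  | append: "free_prod_eq G H u u' \<Longrightarrow> free_prod_eq G H v v' \<Longrightarrow> free_prod_eq G H (u @ v) (u' @ v')"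
  | one_left: "free_prod_eq G H [Inl \<one>\<^bsub>G\<^esub>] []"
  | one_right: "free_prod_eq G H [Inr \<one>\<^bsub>H\<^esub>] []"
  | mult_left: "x \<in> carrier G \<Longrightarrow> y \<in> carrier G \<Longrightarrow>
      free_prod_eq G H [Inl x, Inl y] [Inl (x \<otimes>\<^bsub>G\<^esub> y)]"
  | mult_right: "x \<in> carrier H \<Longrightarrow> y \<in> carrier H \<Longrightarrow>
      free_prod_eq G H [Inr x, Inr y] [Inr (x \<otimes>\<^bsub>H\<^esub> y)]"

definition free_prod_class ::
    "('a, 'c) monoid_scheme \<Rightarrow> ('b, 'd) monoid_scheme \<Rightarrow> ('a + 'b) list \<Rightarrow> ('a + 'b) list set"
  where "free_prod_class G H w = {v. free_prod_eq G H w v}"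

definition free_prod ::
    "('a, 'c) monoid_scheme \<Rightarrow> ('b, 'd) monoid_scheme \<Rightarrow> ('a + 'b) list set monoid"
  where "free_prod G H =
    \<lparr>carrier = free_prod_class G H ` lists (carrier G <+> carrier H),
     monoid.mult = (\<lambda>A B. \<Union>u\<in>A. \<Union>v\<in>B. free_prod_class G H (u @ v)),
     one = free_prod_class G H []\<rparr>"

definition cubes_closure ::
    "('a, 'c) monoid_scheme \<Rightarrow> ('b, 'd) monoid_scheme \<Rightarrow> ('a + 'b) list set set"
  where "cubes_closure G H =
    normal_closure (free_prod G H)
      ((\<lambda>x. x [^]\<^bsub>free_prod G H\<^esub> (3::nat)) ` carrier (free_prod G H))"

definition coprod3 ::
    "('a, 'c) monoid_scheme \<Rightarrow> ('b, 'd) monoid_scheme \<Rightarrow> ('a + 'b) list set set monoid"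
  where "coprod3 G H = free_prod G H Mod cubes_closure G H"

definition coprod3_inl ::
    "('a, 'c) monoid_scheme \<Rightarrow> ('b, 'd) monoid_scheme \<Rightarrow> 'a \<Rightarrow> ('a + 'b) list set set"
  where "coprod3_inl G H x = cubes_closure G H #>\<^bsub>free_prod G H\<^esub> free_prod_class G H [Inl x]"

definition coprod3_inr ::
    "('a, 'c) monoid_scheme \<Rightarrow> ('b, 'd) monoid_scheme \<Rightarrow> 'b \<Rightarrow> ('a + 'b) list set set"
  where "coprod3_inr G H y = cubes_closure G H #>\<^bsub>free_prod G H\<^esub> free_prod_class G H [Inr y]"


section \<open>Lower central series and the associated graded Lie algebra\<close>

definition comm :: "('a, 'c) monoid_scheme \<Rightarrow> 'a \<Rightarrow> 'a \<Rightarrow> 'a"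
  where "comm G a b = a \<otimes>\<^bsub>G\<^esub> b \<otimes>\<^bsub>G\<^esub> inv\<^bsub>G\<^esub> a \<otimes>\<^bsub>G\<^esub> inv\<^bsub>G\<^esub> b"

text \<open>The series is indexed from 1; the value at 0 is never used.\<close>
fun lcs :: "('a, 'c) monoid_scheme \<Rightarrow> nat \<Rightarrow> 'a set"
  where
    "lcs G 0 = carrier G"
  | "lcs G (Suc 0) = carrier G"
  | "lcs G (Suc (Suc n)) = generate G {comm G a b | a b. a \<in> lcs G (Suc n) \<and> b \<in> carrier G}"

text \<open>The field with three elements, with carrier \<open>{0, 1, 2}\<close>.\<close>
abbreviation F3 :: "int ring"
  where "F3 \<equiv> residue_ring 3"

text \<open>
  The multiplicatively written group \<open>lcs G n / lcs G (n + 1)\<close> as an additively written vector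
  space over \<open>F3\<close>; scalar multiplication is exponentiation.
\<close>
definition gr :: "('a, 'c) monoid_scheme \<Rightarrow> nat \<Rightarrow> (int, 'a set) module"
  where "gr G n =
    (let Q = (G\<lparr>carrier := lcs G n\<rparr>) Mod (lcs G (n + 1)) in
     \<lparr>carrier = carrier Q, monoid.mult = undefined, one = undefined,
      ring.zero = \<one>\<^bsub>Q\<^esub>,
      add = monoid.mult Q,
      smult = (\<lambda>k X. X [^]\<^bsub>Q\<^esub> (k::int))\<rparr>)"

definition gr_map ::
    "('b, 'd) monoid_scheme \<Rightarrow> ('a \<Rightarrow> 'b) \<Rightarrow> nat \<Rightarrow> 'a set \<Rightarrow> 'b set"
  where "gr_map H f n X = the_elem ((\<lambda>a. lcs H (n + 1) #>\<^bsub>H\<^esub> f a) ` X)"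

definition gr_bracket :: "('a, 'c) monoid_scheme \<Rightarrow> nat \<Rightarrow> nat \<Rightarrow> 'a set \<Rightarrow> 'a set \<Rightarrow> 'a set"
  where "gr_bracket G n m X Y =
    the_elem ((\<lambda>(a, b). lcs G (n + m + 1) #>\<^bsub>G\<^esub> comm G a b) ` (X \<times> Y))"

text \<open>The bracket of two subspaces of \<open>gr G n\<close> and \<open>gr G m\<close> is the subspace spanned by all brackets.\<close>
definition gr_bracket_span ::
    "('a, 'c) monoid_scheme \<Rightarrow> nat \<Rightarrow> nat \<Rightarrow> 'a set set \<Rightarrow> 'a set set \<Rightarrow> 'a set set"
  where "gr_bracket_span G n m U V =
    lin_span F3 (gr G (n + m)) {gr_bracket G n m X Y | X Y. X \<in> U \<and> Y \<in> V}"


section \<open>The natural maps\<close>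

abbreviation gr_tensor ::
    "('a, 'c) monoid_scheme \<Rightarrow> ('b, 'd) monoid_scheme \<Rightarrow> nat \<Rightarrow> nat \<Rightarrow>
      (int, ('a set \<times> 'b set \<Rightarrow> int) set) module"
  where "gr_tensor G H i j \<equiv> tensor F3 (gr G i) (gr H j)"

definition eta_left ::
    "('a, 'c) monoid_scheme \<Rightarrow> ('b, 'd) monoid_scheme \<Rightarrow> nat \<Rightarrow> 'a set \<Rightarrow> ('a + 'b) list set set set"
  where "eta_left G H i = gr_map (coprod3 G H) (coprod3_inl G H) i"

definition eta_right ::
    "('a, 'c) monoid_scheme \<Rightarrow> ('b, 'd) monoid_scheme \<Rightarrow> nat \<Rightarrow> 'b set \<Rightarrow> ('a + 'b) list set set set"
  where "eta_right G H j = gr_map (coprod3 G H) (coprod3_inr G H) j"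

definition eta_mixed ::
    "('a, 'c) monoid_scheme \<Rightarrow> ('b, 'd) monoid_scheme \<Rightarrow> nat \<Rightarrow> nat \<Rightarrow>
      ('a set \<times> 'b set \<Rightarrow> int) set \<Rightarrow> ('a + 'b) list set set set"
  where "eta_mixed G H i j =
    tensor_lift F3 (gr (coprod3 G H) (i + j))
      (\<lambda>a b. gr_bracket (coprod3 G H) i j (eta_left G H i a) (eta_right G H j b))"

definition eta1 ::
    "('a, 'c) monoid_scheme \<Rightarrow> ('b, 'd) monoid_scheme \<Rightarrow>
      'a set \<times> 'b set \<Rightarrow> ('a + 'b) list set set set"
  where "eta1 G H = (\<lambda>(a, b). eta_left G H 1 a \<oplus>\<^bsub>gr (coprod3 G H) 1\<^esub> eta_right G H 1 b)"

definition eta2 ::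
    "('a, 'c) monoid_scheme \<Rightarrow> ('b, 'd) monoid_scheme \<Rightarrow>
      'a set \<times> ('a set \<times> 'b set \<Rightarrow> int) set \<times> 'b set \<Rightarrow> ('a + 'b) list set set set"
  where "eta2 G H = (\<lambda>(a, t, b).
    eta_left G H 2 a \<oplus>\<^bsub>gr (coprod3 G H) 2\<^esub> eta_mixed G H 1 1 t
      \<oplus>\<^bsub>gr (coprod3 G H) 2\<^esub> eta_right G H 2 b)"

definition eta3 ::
    "('a, 'c) monoid_scheme \<Rightarrow> ('b, 'd) monoid_scheme \<Rightarrow>
      'a set \<times> ('a set \<times> 'b set \<Rightarrow> int) set \<times> ('a set \<times> 'b set \<Rightarrow> int) set \<times> 'b set \<Rightarrow>
      ('a + 'b) list set set set"
  where "eta3 G H = (\<lambda>(a, s, t, b).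
    eta_left G H 3 a \<oplus>\<^bsub>gr (coprod3 G H) 3\<^esub> eta_mixed G H 2 1 s
      \<oplus>\<^bsub>gr (coprod3 G H) 3\<^esub> eta_mixed G H 1 2 t
      \<oplus>\<^bsub>gr (coprod3 G H) 3\<^esub> eta_right G H 3 b)"

text \<open>
  The image in \<open>gr (coprod3 G H) (i + j)\<close> of the summand of bidegree \<open>(i, j)\<close>, where \<open>i\<close> and \<open>j\<close>
  are not both 0 (the case \<open>(0, 0)\<close> is never used). In total degree at least 4 it is the zero
  subspace; this includes \<open>i = 0\<close> and \<open>j = 0\<close>, where the summand \<open>gr H j\<close> or \<open>gr G i\<close> is zero.
\<close>
definition bideg ::
    "('a, 'c) monoid_scheme \<Rightarrow> ('b, 'd) monoid_scheme \<Rightarrow> nat \<Rightarrow> nat \<Rightarrow> ('a + 'b) list set set set set"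
  where "bideg G H i j =
    (if i + j \<ge> 4 then {\<zero>\<^bsub>gr (coprod3 G H) (i + j)\<^esub>}
     else if j = 0 then eta_left G H i ` carrier (gr G i)
     else if i = 0 then eta_right G H j ` carrier (gr H j)
     else eta_mixed G H i j ` carrier (gr_tensor G H i j))"

end

theory Submission
  imports Defs "HOL-Library.Numeral_Type"
begin

text \<open>
  In a group of exponent 3 the conjugates of an element commute. Hence \<open>[x, [y, z]]\<close> is alternating,
  the lower central series stops after three steps, and the bracket relations of part (2) hold
  already for group commutators. Since \<open>gr\<close> is generated in degree 1, part (2) gives surjectivity in
  part (1).

  For injectivity, the retractions of the coproduct onto its factors \<open>G\<close> and \<open>H\<close> split off the two
  outer summands. The tensor summands are detected by homomorphisms into explicit groups of
  exponent 3. Two linear functionals on the abelianizations give a homomorphism into the Heisenberg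
  group, which detects \<open>gr\<^sub>1 G \<otimes> gr\<^sub>1 H\<close>. For \<open>gr\<^sub>2 G \<otimes> gr\<^sub>1 H\<close>, the group \<open>G\<close> acts by
  translation on the functions \<open>m\<close> with \<open>m(x) + m(xg) + m(xg\<^sup>2) = 0\<close>; the semidirect product has
  exponent 3, and the Baer correspondence for the class 2 quotient of \<open>G\<close> provides enough such
  functions. Elements of \<open>H\<close> are sent to scalar multiples of one of them.
\<close>

section \<open>Groups of exponent 3\<close>

text \<open>A nonzero functional on \<open>gr G 2\<close> cannot come from a homomorphism of
  \<open>G\<close> to the field, because homomorphisms to abelian groups kill commutators. The
  semidirect product demands less: the cube of \<open>(m, g)\<close> has function part m + gm + g^2
  m, so \<open>m\<close> only has to sum to zero along the triples x, xg, xg^2. For the Baer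
  addition such a triple has sum zero, so every function additive for it qualifies; and on the
  commutator subgroup this addition is the group multiplication, so restrictions of such functions
  give functionals on \<open>gr G 2\<close>. In degree 3 the two tensor summands have to be kept
  apart. Sending \<open>H\<close> into the abelian function part by way of \<open>gr H 1\<close>
  kills \<open>lcs H 2\<close>, so the resulting functional sees only the summand
  \<open>gr G 2\<close> tensor \<open>gr H 1\<close>; its mirror image arises by exchanging the
  factors. Detection goes without bases: an element of a tensor product that is annihilated by all
  products of functionals from two separating families is zero, by elimination on a sum of pure
  tensors. The coproduct enters through its generation by the two factors and through its maps into
  groups of exponent 3.\<close>

context group
begin

lemma inv_mult_cancel_left [simp]:
  assumes "x \<in> carrier G" "y \<in> carrier G"
  shows "inv x \<otimes> (x \<otimes> y) = y" "x \<otimes> (inv x \<otimes> y) = y"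
  using assms by (simp_all flip: m_assoc)

lemma comm_closed [simp, intro]:
  "a \<in> carrier G \<Longrightarrow> b \<in> carrier G \<Longrightarrow> comm G a b \<in> carrier G"
  by (simp add: comm_def)

lemma inv_commutator: "a \<in> carrier G \<Longrightarrow> b \<in> carrier G \<Longrightarrow> inv (comm G a b) = comm G b a"
  by (simp add: comm_def inv_mult_group m_assoc)

lemma comm_eq_one_iff:
  assumes "a \<in> carrier G" "b \<in> carrier G"
  shows "comm G a b = \<one> \<longleftrightarrow> a \<otimes> b = b \<otimes> a"
proof -
  have "comm G a b = (a \<otimes> b) \<otimes> inv (b \<otimes> a)"
    using assms by (simp add: comm_def inv_mult_group m_assoc)
  then show ?thesis
    using assms by (simp add: inv_solve_right')
qed

lemma comm_mult_left:
  assumes "a \<in> carrier G" "b \<in> carrier G" "c \<in> carrier G"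
  shows "comm G (a \<otimes> b) c = a \<otimes> comm G b c \<otimes> inv a \<otimes> comm G a c"
  using assms by (simp add: comm_def inv_mult_group m_assoc)

lemma comm_mult_right:
  assumes "a \<in> carrier G" "b \<in> carrier G" "c \<in> carrier G"
  shows "comm G a (b \<otimes> c) = comm G a b \<otimes> (b \<otimes> comm G a c \<otimes> inv b)"
  using assms by (simp add: comm_def inv_mult_group m_assoc)

lemma commute_inv:
  assumes "a \<in> carrier G" "b \<in> carrier G" "a \<otimes> b = b \<otimes> a"
  shows "a \<otimes> inv b = inv b \<otimes> a"
proof -
  have "a \<otimes> inv b = inv b \<otimes> (b \<otimes> a) \<otimes> inv b"
    using assms(1,2) by (simp add: m_assoc)
  also have "\<dots> = inv b \<otimes> (a \<otimes> b) \<otimes> inv b"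
    by (simp only: assms(3))
  also have "\<dots> = inv b \<otimes> a"
    using assms(1,2) by (simp add: m_assoc)
  finally show ?thesis .
qed

lemma commute_generate:
  assumes "z \<in> carrier G" "C \<subseteq> carrier G" "\<And>c. c \<in> C \<Longrightarrow> z \<otimes> c = c \<otimes> z" "x \<in> generate G C"
  shows "z \<otimes> x = x \<otimes> z"
  using assms(4)
proof (induction rule: generate.induct)
  case (inv h)
  then show ?case using assms(1,2) commute_inv[OF _ _ assms(3)] by auto
next
  case (eng h1 h2)
  have "h1 \<in> carrier G" "h2 \<in> carrier G"
    using eng assms(2) generate_in_carrier by auto
  then show ?case using eng.IH assms(1) by (metis m_assoc)
qed (use assms(1,3) in simp_all)

lemma generate_commute:
  assumes "C \<subseteq> carrier G" "\<And>a b. a \<in> C \<Longrightarrow> b \<in> C \<Longrightarrow> a \<otimes> b = b \<otimes> a"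
    and x: "x \<in> generate G C" and y: "y \<in> generate G C"
  shows "x \<otimes> y = y \<otimes> x"
proof -
  have "x \<otimes> c = c \<otimes> x" if "c \<in> C" for c
    using commute_generate[OF _ assms(1) assms(2)[OF that] x] that assms(1) by (simp add: subset_iff)
  then show ?thesis
    using commute_generate[OF _ assms(1) _ y] generate_in_carrier[OF assms(1) x] by blast
qed

text \<open>The normal closure of a single element, given by generators, so that commutation only
  has to be checked on conjugates of \<open>x\<close>.\<close>

definition ncl :: "'a \<Rightarrow> 'a set"
  where "ncl x = generate G {y \<otimes> x \<otimes> inv y | y. y \<in> carrier G}"

lemma ncl_normal:
  assumes "x \<in> carrier G"
  shows "ncl x \<lhd> G"
  unfolding ncl_def
proof (rule normal_generateI)
  show "{y \<otimes> x \<otimes> inv y |y. y \<in> carrier G} \<subseteq> carrier G"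
    using assms by auto
  fix h g
  assume "h \<in> {y \<otimes> x \<otimes> inv y |y. y \<in> carrier G}" and g: "g \<in> carrier G"
  then obtain y where "y \<in> carrier G" "h = y \<otimes> x \<otimes> inv y" by auto
  then have "g \<otimes> h \<otimes> inv g = (g \<otimes> y) \<otimes> x \<otimes> inv (g \<otimes> y)" "g \<otimes> y \<in> carrier G"
    using g assms by (simp_all add: inv_mult_group m_assoc)
  then show "g \<otimes> h \<otimes> inv g \<in> {y \<otimes> x \<otimes> inv y |y. y \<in> carrier G}" by blast
qed

lemma ncl_self: "x \<in> carrier G \<Longrightarrow> x \<in> ncl x"
  unfolding ncl_def by (rule generate.incl) (auto intro!: exI[of _ \<one>])

lemma comm_in_normal:
  assumes "N \<lhd> G" "a \<in> N" "b \<in> carrier G"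
  shows "comm G a b \<in> N" "comm G b a \<in> N"
proof -
  interpret N: normal N G by fact
  have a: "a \<in> carrier G" using assms by auto
  have "comm G a b = a \<otimes> (b \<otimes> inv a \<otimes> inv b)" "comm G b a = (b \<otimes> a \<otimes> inv b) \<otimes> inv a"
    using assms a by (simp_all add: comm_def m_assoc)
  then show "comm G a b \<in> N" "comm G b a \<in> N"
    using assms N.inv_op_closed2 by auto
qed

lemma comm_in_ncl:
  assumes "a \<in> carrier G" "b \<in> carrier G"
  shows "comm G a b \<in> ncl a" "comm G a b \<in> ncl b"
  using assms comm_in_normal[OF ncl_normal ncl_self] by simp_all

lemma comm_ncl:
  assumes "x \<in> carrier G" "a \<in> ncl x" "b \<in> carrier G"
  shows "comm G a b \<in> ncl x" "comm G b a \<in> ncl x"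
  using assms comm_in_normal[OF ncl_normal] by simp_all

end

section \<open>Commutator calculus in exponent 3\<close>

locale exponent3 = group +
  assumes cube: "x \<in> carrier G \<Longrightarrow> x \<otimes> x \<otimes> x = \<one>"
begin

lemma mult_self: "x \<in> carrier G \<Longrightarrow> x \<otimes> x = inv x"
  using cube[of x] inv_equality[of "x \<otimes> x" x] by simp

text \<open>Since y^3 = 1, (x y)^3 is the product of x and its two conjugates \<open>x1\<close>,
  \<open>x2\<close>, and replacing y by its inverse exchanges these two. Hence x x1 x2 = 1 = x x2
  x1. Rotating the second equation cyclically gives x1 x x2 = 1, and cancelling \<open>x2\<close>
  against the first leaves the claim.\<close>

lemma conj_commute_self:
  assumes x: "x \<in> carrier G" and y: "y \<in> carrier G"
  shows "x \<otimes> (y \<otimes> x \<otimes> inv y) = (y \<otimes> x \<otimes> inv y) \<otimes> x"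
proof -
  define x1 where "x1 = y \<otimes> x \<otimes> inv y"
  define x2 where "x2 = inv y \<otimes> x \<otimes> y"
  have c: "x1 \<in> carrier G" "x2 \<in> carrier G"
    using x y by (auto simp: x1_def x2_def)
  have iy: "inv y = y \<otimes> y" using mult_self y by simp
  have y3: "y \<otimes> (y \<otimes> (y \<otimes> z)) = z" if "z \<in> carrier G" for z
    using y that cube[of y] by (simp flip: m_assoc)
  have "x \<otimes> x1 \<otimes> x2 = (x \<otimes> y) \<otimes> (x \<otimes> y) \<otimes> (x \<otimes> y)"
    using x y by (simp add: x1_def x2_def m_assoc iy y3)
  then have 1: "x \<otimes> x1 \<otimes> x2 = \<one>" using cube x y by simp
  have "x \<otimes> x2 \<otimes> x1 = (x \<otimes> inv y) \<otimes> (x \<otimes> inv y) \<otimes> (x \<otimes> inv y)"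
    using x y by (simp add: x1_def x2_def m_assoc iy y3)
  then have 2: "x \<otimes> x2 \<otimes> x1 = \<one>" using cube x y by simp
  have "x1 = inv (x \<otimes> x2)" using 2 c x by (metis inv_equality inv_inv m_closed)
  then have "x1 \<otimes> x \<otimes> x2 = \<one>" using c x by (simp add: m_assoc)
  with 1 have "x1 \<otimes> x \<otimes> x2 = x \<otimes> x1 \<otimes> x2" by simp
  then have "x1 \<otimes> x = x \<otimes> x1" using c x by simp
  then show ?thesis by (simp add: x1_def)
qed

lemma ncl_commute:
  assumes x: "x \<in> carrier G" and "a \<in> ncl x" "b \<in> ncl x"
  shows "a \<otimes> b = b \<otimes> a"
proof (rule generate_commute)
  show "a \<in> generate G {y \<otimes> x \<otimes> inv y | y. y \<in> carrier G}"
    "b \<in> generate G {y \<otimes> x \<otimes> inv y | y. y \<in> carrier G}"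
    using assms by (auto simp: ncl_def)
  fix a b
  assume "a \<in> {y \<otimes> x \<otimes> inv y | y. y \<in> carrier G}" "b \<in> {y \<otimes> x \<otimes> inv y | y. y \<in> carrier G}"
  then obtain y z where y: "y \<in> carrier G" "a = y \<otimes> x \<otimes> inv y"
    and z: "z \<in> carrier G" "b = z \<otimes> x \<otimes> inv z" by auto
  \<comment> \<open>Conjugating both elements by \<open>inv y\<close> turns the pair into
    \<open>x\<close> and its conjugate by \<open>?w\<close>.\<close>
  let ?w = "inv y \<otimes> z"
  have "a \<otimes> b = y \<otimes> (x \<otimes> (?w \<otimes> x \<otimes> inv ?w)) \<otimes> inv y"
    "b \<otimes> a = y \<otimes> ((?w \<otimes> x \<otimes> inv ?w) \<otimes> x) \<otimes> inv y"
    using x y z by (simp_all add: inv_mult_group m_assoc)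
  then show "a \<otimes> b = b \<otimes> a"
    using conj_commute_self[of x ?w] x y z by simp
qed (use x in auto)

text \<open>In z u^-1 z^-1 u the last factor commutes with the conjugate before it, as both lie in
  the abelian subgroup \<open>ncl u\<close>; exchanging them leaves [u, z].\<close>

lemma comm_inv_right:
  assumes "z \<in> carrier G" "u \<in> carrier G"
  shows "comm G z (inv u) = inv (comm G z u)"
proof -
  interpret N: normal "ncl u" G using ncl_normal assms by simp
  have "u \<otimes> (z \<otimes> inv u \<otimes> inv z) = (z \<otimes> inv u \<otimes> inv z) \<otimes> u"
    using assms by (intro ncl_commute[of u]) (auto intro!: N.inv_op_closed2 ncl_self)
  then show ?thesis
    using assms by (simp add: comm_def inv_mult_group m_assoc)
qed

text \<open>The linearised Engel identity: it comes from \<open>[x, yz]\<close> commuting with \<open>yz\<close>.\<close>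
lemma triple_comm_rotate:
  assumes x: "x \<in> carrier G" and y: "y \<in> carrier G" and z: "z \<in> carrier G"
  shows "comm G z (comm G x y) = comm G y (comm G z x)"
proof -
  define u where "u = comm G x y"
  define w where "w = comm G x z"
  define t where "t = comm G y w"
  define s where "s = comm G z u"
  note d = u_def w_def t_def s_def
  have c: "u \<in> carrier G" "w \<in> carrier G" "t \<in> carrier G" "s \<in> carrier G"
    using x y z by (auto simp: d)
  have N: "u \<in> ncl x" "u \<in> ncl y" "w \<in> ncl x" "w \<in> ncl z"
    using x y z by (auto simp: d comm_in_ncl)
  then have N': "t \<in> ncl x" "t \<in> ncl y" "t \<in> ncl z" "s \<in> ncl x" "s \<in> ncl y"
    using c x y z unfolding d(3,4) by (simp_all add: comm_in_ncl comm_ncl)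
  \<comment> \<open>In each pair both elements lie in the normal closure of one of \<open>x\<close>,
    \<open>y\<close>, \<open>z\<close>, which is abelian.\<close>
  have com: "y \<otimes> u = u \<otimes> y" "z \<otimes> w = w \<otimes> z" "y \<otimes> t = t \<otimes> y" "z \<otimes> t = t \<otimes> z"
    "y \<otimes> s = s \<otimes> y" "t \<otimes> w = w \<otimes> t"
    using x y z N N' ncl_self ncl_commute by blast+
  \<comment> \<open>The two exchanges that are not free: they cost the triple commutators
    \<open>s\<close> and \<open>t\<close>.\<close>
  have zu: "z \<otimes> u = s \<otimes> u \<otimes> z" and yw: "y \<otimes> w = t \<otimes> w \<otimes> y"
    using c x y z by (simp_all add: s_def t_def comm_def m_assoc)
  have "t \<otimes> w = y \<otimes> w \<otimes> inv y"
    using c y by (simp add: t_def comm_def m_assoc)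
  then have "comm G x (y \<otimes> z) = u \<otimes> (t \<otimes> w)"
    using x y z by (simp only: comm_mult_right u_def w_def)
  then have "u \<otimes> (t \<otimes> w) \<in> ncl (y \<otimes> z)"
    using comm_in_ncl x y z by (metis m_closed)
  then have "(y \<otimes> z) \<otimes> (u \<otimes> (t \<otimes> w)) = (u \<otimes> (t \<otimes> w)) \<otimes> (y \<otimes> z)"
    using ncl_commute ncl_self y z by (metis m_closed)
  \<comment> \<open>Here u t w is [x, yz]. Moving \<open>y\<close> and \<open>z\<close> to the right
    end of the product and cancelling them turns the commutation with yz into s u t t w = u t w,
    hence t s = 1.\<close>
  then have "(u \<otimes> (t \<otimes> w)) \<otimes> (y \<otimes> z) = (y \<otimes> z) \<otimes> (u \<otimes> (t \<otimes> w))"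
    ..
  also have "(y \<otimes> z) \<otimes> (u \<otimes> (t \<otimes> w)) = y \<otimes> (z \<otimes> u) \<otimes> (t \<otimes> w)"
    using c y z by (simp add: m_assoc)
  also have "\<dots> = (y \<otimes> s) \<otimes> u \<otimes> (z \<otimes> t) \<otimes> w"
    using c y z by (simp add: zu m_assoc)
  also have "\<dots> = (s \<otimes> y) \<otimes> u \<otimes> (t \<otimes> z) \<otimes> w"
    unfolding com(5) com(4) ..
  also have "\<dots> = s \<otimes> (y \<otimes> u) \<otimes> t \<otimes> (z \<otimes> w)"
    using c y z by (simp add: m_assoc)
  also have "\<dots> = s \<otimes> (u \<otimes> y) \<otimes> t \<otimes> (w \<otimes> z)"
    unfolding com(1) com(2) ..
  also have "\<dots> = s \<otimes> u \<otimes> (y \<otimes> t) \<otimes> w \<otimes> z"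
    using c y z by (simp add: m_assoc)
  also have "\<dots> = s \<otimes> u \<otimes> (t \<otimes> y) \<otimes> w \<otimes> z"
    unfolding com(3) ..
  also have "\<dots> = s \<otimes> u \<otimes> t \<otimes> (y \<otimes> w) \<otimes> z"
    using c y z by (simp add: m_assoc)
  also have "\<dots> = (s \<otimes> u \<otimes> t \<otimes> t \<otimes> w) \<otimes> (y \<otimes> z)"
    unfolding yw using c y z by (simp add: m_assoc)
  finally have "s \<otimes> u \<otimes> t \<otimes> t \<otimes> w = u \<otimes> (t \<otimes> w)"
    using c y z by simp
  then have "s \<otimes> (u \<otimes> t) \<otimes> (t \<otimes> w) = u \<otimes> (t \<otimes> w)"
    using c by (simp add: m_assoc)
  moreover have "s \<otimes> (u \<otimes> t) = (u \<otimes> t) \<otimes> s"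
    using N N' x ncl_commute[of x] ncl_normal[of x] by (meson normal_imp_subgroup subgroup.m_closed)
  ultimately have "u \<otimes> (t \<otimes> s \<otimes> (t \<otimes> w)) = u \<otimes> (t \<otimes> w)"
    using c by (simp add: m_assoc)
  then have "t \<otimes> s = \<one>"
    using c by (simp add: r_cancel_one')
  then have "s = inv t"
    using c by (metis inv_equality inv_inv)
  then show ?thesis
    using x y z c by (simp add: d comm_inv_right flip: inv_commutator[of x z])
qed

lemma triple_comm_swap_inner:
  assumes "x \<in> carrier G" "y \<in> carrier G" "z \<in> carrier G"
  shows "comm G z (comm G y x) = inv (comm G z (comm G x y))"
  using assms by (simp add: comm_inv_right flip: inv_commutator[of x y])

text \<open>A cyclic rotation followed by an inner swap. With the two preceding lemmas this makes
  the triple commutator alternating in its three arguments.\<close>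

lemma triple_comm_swap_outer:
  assumes "x \<in> carrier G" "y \<in> carrier G" "z \<in> carrier G"
  shows "comm G x (comm G z y) = inv (comm G z (comm G x y))"
  using assms triple_comm_rotate triple_comm_swap_inner by (metis comm_closed)

text \<open>Two rotations, with [z, w] treated as a single letter.\<close>

lemma comm_comm_comm:
  assumes x: "x \<in> carrier G" and y: "y \<in> carrier G" and z: "z \<in> carrier G" and w: "w \<in> carrier G"
  shows "comm G (comm G z w) (comm G x y) = comm G x (comm G y (comm G z w))"
  using triple_comm_rotate[of x y "comm G z w"] triple_comm_rotate[of "comm G z w" x y] assms by simp

text \<open>The pair z, w can be exchanged with the pair x, y in two ways. By alternation inside
  nested triple commutators the two sign changes cancel; by \<open>comm_comm_comm\<close>, which
  reads the expression as a commutator of two commutators, there is one sign change. So the element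
  is its own inverse, and its cube is trivial.\<close>

lemma fourfold_comm:
  assumes x: "x \<in> carrier G" and y: "y \<in> carrier G" and z: "z \<in> carrier G" and w: "w \<in> carrier G"
  shows "comm G x (comm G y (comm G z w)) = \<one>"
proof -
  let ?R = "\<lambda>a b c d. comm G a (comm G b (comm G c d))"
  have c: "?R x y z w \<in> carrier G" using assms by simp
  have "?R x y z w = ?R x z w y"
    using triple_comm_rotate[of w y z] assms by simp
  also have "\<dots> = inv (?R z x w y)"
    using triple_comm_swap_outer[of x "comm G w y" z] assms by simp
  also have "?R z x w y = ?R z w y x"
    using triple_comm_rotate[of y x w] assms by simp
  also have "?R z w y x = inv (?R z w x y)"
    using assms by (simp add: comm_inv_right triple_comm_swap_inner[of x y w])
  also have "?R z w x y = inv (?R x y z w)"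
    using assms by (metis comm_closed comm_comm_comm inv_commutator)
  finally have "?R x y z w = inv (?R x y z w)" using c by simp
  then have "?R x y z w \<otimes> ?R x y z w = \<one>" using c by (metis r_inv)
  then show ?thesis using cube[OF c] c by simp
qed

end

lemma exponent3_group_imp: "exponent3_group G \<Longrightarrow> exponent3 G"
  unfolding exponent3_group_def exponent3_def exponent3_axioms_def
  by (auto simp: numeral_3_eq_3 group.is_monoid monoid.nat_pow_Suc group.is_monoid[THEN monoid.nat_pow_0])

section \<open>The lower central series\<close>

context group
begin

text \<open>At \<open>n = 0\<close> the recursion of \<open>lcs\<close> repeats the whole group
  instead of taking commutators, whence the bound on \<open>n\<close>.\<close>

lemma lcs_Suc: "n \<ge> 1 \<Longrightarrow> lcs G (Suc n) = generate G {comm G a b | a b. a \<in> lcs G n \<and> b \<in> carrier G}"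
  by (cases n) auto

lemma lcs_normal: "lcs G n \<lhd> G"
proof (induction n)
  case (Suc n)
  show ?case
  proof (cases n)
    case (Suc m)
    interpret N: normal "lcs G n" G by fact
    show ?thesis
      unfolding \<open>n = Suc m\<close> lcs.simps unfolding \<open>n = Suc m\<close>[symmetric]
    proof (rule normal_generateI)
      show "{comm G a b |a b. a \<in> lcs G n \<and> b \<in> carrier G} \<subseteq> carrier G" by auto
      fix h g
      assume "h \<in> {comm G a b |a b. a \<in> lcs G n \<and> b \<in> carrier G}" and g: "g \<in> carrier G"
      then obtain a b where ab: "a \<in> lcs G n" "b \<in> carrier G" "h = comm G a b" by auto
      have "g \<otimes> h \<otimes> inv g = comm G (g \<otimes> a \<otimes> inv g) (g \<otimes> b \<otimes> inv g)"
        using ab g by (simp add: comm_def inv_mult_group m_assoc)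
      moreover have "g \<otimes> a \<otimes> inv g \<in> lcs G n" "g \<otimes> b \<otimes> inv g \<in> carrier G"
        using ab g N.inv_op_closed2 by auto
      ultimately show "g \<otimes> h \<otimes> inv g \<in> {comm G a b |a b. a \<in> lcs G n \<and> b \<in> carrier G}" by blast
    qed
  qed (simp add: normal_self)
qed (simp add: normal_self)

lemma lcs_subgroup: "subgroup (lcs G n) G"
  using normal_imp_subgroup[OF lcs_normal] .

lemma lcs_carrier: "x \<in> lcs G n \<Longrightarrow> x \<in> carrier G"
  by (rule subgroup.mem_carrier[OF lcs_subgroup])

lemma lcs_one [simp, intro]: "\<one> \<in> lcs G n"
  by (rule subgroup.one_closed[OF lcs_subgroup])

lemma lcs_mult [intro]: "x \<in> lcs G n \<Longrightarrow> y \<in> lcs G n \<Longrightarrow> x \<otimes> y \<in> lcs G n"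
  by (rule subgroup.m_closed[OF lcs_subgroup])

lemma lcs_inv [intro]: "x \<in> lcs G n \<Longrightarrow> inv x \<in> lcs G n"
  by (rule subgroup.m_inv_closed[OF lcs_subgroup])

lemma lcs_Suc_subset: "lcs G (Suc n) \<subseteq> lcs G n"
proof (cases n)
  case (Suc m)
  have "{comm G a b |a b. a \<in> lcs G n \<and> b \<in> carrier G} \<subseteq> lcs G n"
    using comm_in_normal(1)[OF lcs_normal] by auto
  then show ?thesis
    using Suc lcs_Suc[of n] generate_subgroup_incl[OF _ lcs_subgroup] by simp
qed simp

lemma comm_in_lcs_Suc:
  assumes "n \<ge> 1" "a \<in> lcs G n" "b \<in> carrier G"
  shows "comm G a b \<in> lcs G (Suc n)" "comm G b a \<in> lcs G (Suc n)"
proof -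
  show 1: "comm G a b \<in> lcs G (Suc n)"
    unfolding lcs_Suc[OF assms(1)] by (rule generate.incl) (use assms in blast)
  then have "inv (comm G a b) \<in> lcs G (Suc n)"
    by (rule lcs_inv)
  then show "comm G b a \<in> lcs G (Suc n)"
    using assms lcs_carrier inv_commutator by simp
qed

end

context exponent3
begin

text \<open>A commutator of two generating commutators is a fourfold commutator, hence trivial, so
  the generators commute.\<close>

lemma lcs_2_commute:
  assumes "x \<in> lcs G 2" "y \<in> lcs G 2"
  shows "x \<otimes> y = y \<otimes> x"
proof (rule generate_commute)
  show "x \<in> generate G {comm G a b |a b. a \<in> lcs G 1 \<and> b \<in> carrier G}"
    "y \<in> generate G {comm G a b |a b. a \<in> lcs G 1 \<and> b \<in> carrier G}"
    using assms by (simp_all add: numeral_2_eq_2)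
  fix a b
  assume "a \<in> {comm G a b |a b. a \<in> lcs G 1 \<and> b \<in> carrier G}" "b \<in> {comm G a b |a b. a \<in> lcs G 1 \<and> b \<in> carrier G}"
  then obtain x y z w where *: "x \<in> carrier G" "y \<in> carrier G" "z \<in> carrier G" "w \<in> carrier G"
    "a = comm G x y" "b = comm G z w" by auto
  then have "comm G a b = \<one>"
    by (simp add: comm_comm_comm fourfold_comm)
  then show "a \<otimes> b = b \<otimes> a"
    using * comm_eq_one_iff by simp
qed auto

text \<open>For a generator [a, b] in which \<open>a\<close> is itself a commutator this is
  \<open>fourfold_comm\<close>; the general \<open>a\<close> in \<open>lcs G 2\<close> is a product
  of commutators and is reached by induction.\<close>

lemma lcs_3_central:
  assumes "x \<in> lcs G 3" "z \<in> carrier G"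
  shows "x \<otimes> z = z \<otimes> x"
proof -
  have gen: "z \<otimes> comm G a b = comm G a b \<otimes> z" if "a \<in> lcs G 2" "b \<in> carrier G" for a b
  proof -
    have "a \<in> generate G {comm G a b |a b. a \<in> carrier G \<and> b \<in> carrier G}"
      using that by (simp add: numeral_2_eq_2)
    moreover have base: "z \<otimes> comm G h b = comm G h b \<otimes> z"
      if h: "h \<in> {comm G a b |a b. a \<in> carrier G \<and> b \<in> carrier G}" for h
    proof -
      obtain x y where xy: "x \<in> carrier G" "y \<in> carrier G" "h = comm G x y" using h by auto
      have "comm G h b = inv (comm G b (comm G x y))"
        using xy \<open>b \<in> carrier G\<close> by (simp add: inv_commutator)
      then have "comm G z (comm G h b) = \<one>"
        using xy assms(2) \<open>b \<in> carrier G\<close> fourfold_comm by (simp add: comm_inv_right)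
      then show ?thesis
        using xy assms(2) \<open>b \<in> carrier G\<close> comm_eq_one_iff by simp
    qed
    ultimately show ?thesis
    proof (induction rule: generate.induct)
      case one
      then show ?case using assms that by (simp add: comm_def)
    next
      case (inv h)
      then have "inv h \<in> {comm G a b |a b. a \<in> carrier G \<and> b \<in> carrier G}"
        using inv_commutator by force
      then show ?case using base by blast
    next
      case (eng h1 h2)
      have h: "h1 \<in> lcs G 2" "h2 \<in> lcs G 2"
        using eng.hyps by (simp_all add: numeral_2_eq_2)
      then have c: "h1 \<in> carrier G" "h2 \<in> carrier G" using lcs_carrier by auto
      \<comment> \<open>As \<open>lcs G 2\<close> is abelian, the conjugation by \<open>h1\<close>
        in the expansion of [h1 h2, b] disappears, and a plain product of two commutators
        remains.\<close>
      have "comm G h2 b \<in> lcs G 2"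
        using comm_in_normal(1)[OF lcs_normal h(2)] that by simp
      then have "h1 \<otimes> comm G h2 b = comm G h2 b \<otimes> h1"
        using h lcs_2_commute by blast
      then have "comm G (h1 \<otimes> h2) b = comm G h2 b \<otimes> comm G h1 b"
        using c that by (simp add: comm_mult_left m_assoc)
      then show ?case
        using eng.IH[OF base] eng.IH(2)[OF base] c that assms(2) by (metis comm_closed m_assoc)
    qed
  qed
  let ?C = "{comm G a b |a b. a \<in> lcs G 2 \<and> b \<in> carrier G}"
  have x: "x \<in> generate G ?C"
    using assms lcs_Suc[of 2] by simp
  have "?C \<subseteq> carrier G"
    using lcs_carrier by auto
  moreover have "z \<otimes> c = c \<otimes> z" if "c \<in> ?C" for c
    using gen that by blast
  ultimately have "z \<otimes> x = x \<otimes> z"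
    using x by (rule commute_generate[OF assms(2)])
  then show ?thesis ..
qed

lemma lcs_trivial: "n \<ge> 4 \<Longrightarrow> lcs G n = {\<one>}"
proof (induction n rule: nat_induct_at_least)
  case base
  have "lcs G 4 = generate G {comm G a b |a b. a \<in> lcs G 3 \<and> b \<in> carrier G}"
    using lcs_Suc[of 3] by simp
  also have "{comm G a b |a b. a \<in> lcs G 3 \<and> b \<in> carrier G} = {\<one>}"
  proof -
    have "comm G a b = \<one>" if "a \<in> lcs G 3" "b \<in> carrier G" for a b
      using that lcs_3_central lcs_carrier comm_eq_one_iff by blast
    moreover have "\<one> \<in> lcs G 3" "\<one> \<in> carrier G"
      by auto
    ultimately show ?thesis by force
  qed
  finally show ?case using generate_one by simp
next
  case (Suc n)
  have one: "comm G \<one> b = \<one>" if "b \<in> carrier G" for b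
    using that by (simp add: comm_def)
  have "{comm G a b |a b. a \<in> lcs G n \<and> b \<in> carrier G} = {\<one>}"
  proof
    show "{comm G a b |a b. a \<in> lcs G n \<and> b \<in> carrier G} \<subseteq> {\<one>}"
      using one by (auto simp: Suc.IH)
    show "{\<one>} \<subseteq> {comm G a b |a b. a \<in> lcs G n \<and> b \<in> carrier G}"
      using one[OF one_closed] lcs_one one_closed by force
  qed
  then show ?case using Suc.hyps lcs_Suc[of n] generate_one by simp
qed

text \<open>Few cases arise because the series is so short: an argument of degree 1 is the
  definition of the next term, two arguments of degree 2 commute, and otherwise one argument lies in
  the central subgroup \<open>lcs G 3\<close>.\<close>

lemma comm_lcs:
  assumes "n \<ge> 1" "m \<ge> 1" "a \<in> lcs G n" "b \<in> lcs G m"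
  shows "comm G a b \<in> lcs G (n + m)"
proof -
  have c: "a \<in> carrier G" "b \<in> carrier G" using assms lcs_carrier by auto
  consider "n = 1" | "m = 1" | "n = 2" "m = 2" | "n \<ge> 3" "m \<ge> 2" | "n \<ge> 2" "m \<ge> 3"
    using assms by linarith
  then show ?thesis
  proof cases
    case 1
    then show ?thesis using comm_in_lcs_Suc(2)[OF assms(2) assms(4)] c by simp
  next
    case 2
    then show ?thesis using comm_in_lcs_Suc(1)[OF assms(1) assms(3)] c by simp
  next
    case 3
    then have "comm G a b = \<one>" using assms c lcs_2_commute comm_eq_one_iff by simp
    then show ?thesis by simp
  next
    case 4
    have "lcs G n \<subseteq> lcs G 3"
      using 4(1) by (induction n rule: nat_induct_at_least) (use lcs_Suc_subset in auto)
    then have "comm G a b = \<one>" using assms(3) c lcs_3_central[of a b] comm_eq_one_iff by auto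
    then show ?thesis by simp
  next
    case 5
    have "lcs G m \<subseteq> lcs G 3"
      using 5(2) by (induction m rule: nat_induct_at_least) (use lcs_Suc_subset in auto)
    then have "comm G a b = \<one>" using assms(4) c lcs_3_central[of b a] comm_eq_one_iff by auto
    then show ?thesis by simp
  qed
qed

end

lemma (in group_hom) hom_comm:
  assumes "a \<in> carrier G" "b \<in> carrier G"
  shows "h (comm G a b) = comm H (h a) (h b)"
  using assms by (simp add: comm_def)

lemma (in group_hom) hom_lcs:
  assumes "x \<in> lcs G n"
  shows "h x \<in> lcs H n"
  using assms
proof (induction n arbitrary: x)
  case (Suc n)
  show ?case
  proof (cases "n = 0")
    case False
    then have n: "n \<ge> 1" by simp
    have "x \<in> generate G {comm G a b | a b. a \<in> lcs G n \<and> b \<in> carrier G}"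
      using Suc.prems G.lcs_Suc[OF n] by simp
    then show ?thesis
    proof (induction rule: generate.induct)
      case one
      then show ?case by simp
    next
      case (incl h')
      then obtain a b where "a \<in> lcs G n" "b \<in> carrier G" "h' = comm G a b" by auto
      then show ?case using H.comm_in_lcs_Suc(1)[OF n] Suc.IH hom_comm G.lcs_carrier by auto
    next
      case (inv h')
      then obtain a b where "a \<in> lcs G n" "b \<in> carrier G" "inv h' = comm G b a" "h' = comm G a b"
        using G.inv_commutator G.lcs_carrier by auto
      then show ?case using H.comm_in_lcs_Suc(2)[OF n] Suc.IH hom_comm G.lcs_carrier by auto
    next
      case (eng h1 h2)
      have "h1 \<in> carrier G" "h2 \<in> carrier G"
        using eng.hyps G.lcs_Suc[OF n] G.lcs_carrier[of _ "Suc n"] by auto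
      then show ?case using eng.IH by (simp add: H.lcs_mult)
    qed
  qed (use Suc in simp)
qed simp

section \<open>The associated graded vector spaces\<close>

lemma F3_simps [simp]:
  "carrier F3 = {0, 1, 2}" "x \<oplus>\<^bsub>F3\<^esub> y = (x + y) mod 3" "x \<otimes>\<^bsub>F3\<^esub> y = (x * y) mod 3"
  "\<zero>\<^bsub>F3\<^esub> = 0" "\<one>\<^bsub>F3\<^esub> = 1"
  by (auto simp: residue_ring_def)

abbreviation ahom :: "('r, 'm) module \<Rightarrow> ('r, 'n) module \<Rightarrow> ('m \<Rightarrow> 'n) set"
  where "ahom M N \<equiv> hom (add_monoid M) (add_monoid N)"

text \<open>The scalars 0, 1, 2 act as prescribed multiples. Consequently every subgroup is a
  subspace (\<open>submoduleI3\<close>) and every additive map is linear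
  (\<open>f3space_hom_smult\<close>), so that linear algebra reduces to statements about additive
  groups.\<close>

locale f3space = abelian_group M for M :: "(int, 'm) module" (structure) +
  assumes triple: "x \<in> carrier M \<Longrightarrow> x \<oplus> x \<oplus> x = \<zero>"
    and smult_0 [simp]: "x \<in> carrier M \<Longrightarrow> 0 \<odot> x = \<zero>"
    and smult_1 [simp]: "x \<in> carrier M \<Longrightarrow> 1 \<odot> x = x"
    and smult_2 [simp]: "x \<in> carrier M \<Longrightarrow> 2 \<odot> x = x \<oplus> x"
begin

lemma smult_closed: "r \<in> carrier F3 \<Longrightarrow> x \<in> carrier M \<Longrightarrow> r \<odot> x \<in> carrier M"
  by auto

lemma triple': "x \<in> carrier M \<Longrightarrow> x \<oplus> (x \<oplus> x) = \<zero>"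
  using triple by (simp add: a_assoc)

lemma smult_l_distr:
  assumes "a \<in> carrier F3" "b \<in> carrier F3" "x \<in> carrier M"
  shows "((a + b) mod 3) \<odot> x = a \<odot> x \<oplus> b \<odot> x"
proof -
  have "x \<oplus> (x \<oplus> (x \<oplus> x)) = x"
    using assms(3) by (simp add: triple')
  then show ?thesis
    using assms by (auto simp: triple' a_assoc)
qed

lemma submoduleI3:
  assumes "subgroup H (add_monoid M)"
  shows "submodule H F3 M"
proof -
  interpret H: subgroup H "add_monoid M" by fact
  show ?thesis
  proof
    fix a x assume "a \<in> carrier F3" "x \<in> H"
    moreover from \<open>x \<in> H\<close> have "x \<in> carrier M" using H.subset by auto
    ultimately show "a \<odot> x \<in> H"
      using H.m_closed[of x x] H.one_closed by auto
  qed
qed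

lemma lin_span_subset:
  assumes "subgroup H (add_monoid M)" "S \<subseteq> H"
  shows "lin_span F3 M S \<subseteq> H"
  using assms submoduleI3 unfolding lin_span_def by blast

lemma lin_span_subgroup:
  assumes "S \<subseteq> carrier M"
  shows "subgroup (lin_span F3 M S) (add_monoid M)"
proof -
  have "submodule (carrier M) F3 M"
    using submoduleI3 add.subgroup_self by simp
  moreover have "lin_span F3 M S = \<Inter> {H. submodule H F3 M \<and> S \<subseteq> H}"
    by (simp add: lin_span_def)
  ultimately show ?thesis
    using assms by (auto simp: submodule_def intro!: add.subgroups_Inter)
qed

end

lemma f3space_group_hom:
  assumes "f3space M" "f3space N" "h \<in> ahom M N"
  shows "group_hom (add_monoid M) (add_monoid N) h"
  using assms by (simp add: f3space_def abelian_group.a_group group_hom_def group_hom_axioms_def)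

lemma f3space_hom_smult:
  assumes "f3space M" "f3space N" "h \<in> ahom M N"
    and r: "r \<in> carrier F3" and x: "x \<in> carrier M"
  shows "h (r \<odot>\<^bsub>M\<^esub> x) = r \<odot>\<^bsub>N\<^esub> h x"
proof -
  interpret M: f3space M by fact
  interpret N: f3space N by fact
  interpret h: group_hom "add_monoid M" "add_monoid N" h
    by (rule f3space_group_hom[OF assms(1-3)])
  have "h x \<in> carrier N" "h \<zero>\<^bsub>M\<^esub> = \<zero>\<^bsub>N\<^esub>" "h (x \<oplus>\<^bsub>M\<^esub> x) = h x \<oplus>\<^bsub>N\<^esub> h x"
    using h.hom_closed[of x] h.hom_one h.hom_mult[of x x] x by simp_all
  then show ?thesis
    using r x by auto
qed

lemma lin_isoI:
  assumes "f3space M" "f3space N" "h \<in> ahom M N"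
    and ker: "\<And>x. x \<in> carrier M \<Longrightarrow> h x = \<zero>\<^bsub>N\<^esub> \<Longrightarrow> x = \<zero>\<^bsub>M\<^esub>"
    and surj: "\<And>y. y \<in> carrier N \<Longrightarrow> y \<in> h ` carrier M"
  shows "h \<in> lin_iso F3 M N"
proof -
  interpret M: f3space M by fact
  interpret N: f3space N by fact
  interpret h: group_hom "add_monoid M" "add_monoid N" h
    by (rule f3space_group_hom[OF assms(1-3)])
  have "kernel (add_monoid M) (add_monoid N) h = {\<zero>\<^bsub>M\<^esub>}"
    using ker h.hom_one by (auto simp: kernel_def)
  then have "inj_on h (carrier M)"
    using h.inj_iff_trivial_ker by simp
  moreover have "h ` carrier M = carrier N"
    using surj h.hom_closed by auto
  ultimately show ?thesis
    using h.hom_mult f3space_hom_smult[OF assms(1-3)]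
    unfolding lin_iso_def bij_betw_def by (simp del: F3_simps)
qed

lemma f3space_dsum:
  fixes M :: "(int, 'm) module" and N :: "(int, 'n) module"
  assumes "f3space M" "f3space N"
  shows "f3space (M \<oplus>\<^sub>m N)"
proof -
  interpret M: f3space M by fact
  interpret N: f3space N by fact
  have "abelian_group (M \<oplus>\<^sub>m N)"
  proof (rule abelian_groupI)
    fix x assume "x \<in> carrier (M \<oplus>\<^sub>m N)"
    then have "(\<ominus>\<^bsub>M\<^esub> fst x, \<ominus>\<^bsub>N\<^esub> snd x) \<in> carrier (M \<oplus>\<^sub>m N)"
      "(\<ominus>\<^bsub>M\<^esub> fst x, \<ominus>\<^bsub>N\<^esub> snd x) \<oplus>\<^bsub>M \<oplus>\<^sub>m N\<^esub> x = \<zero>\<^bsub>M \<oplus>\<^sub>m N\<^esub>"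
      by (auto simp: dsum_def M.l_neg N.l_neg)
    then show "\<exists>y\<in>carrier (M \<oplus>\<^sub>m N). y \<oplus>\<^bsub>M \<oplus>\<^sub>m N\<^esub> x = \<zero>\<^bsub>M \<oplus>\<^sub>m N\<^esub>" ..
  qed (auto simp: dsum_def M.a_assoc N.a_assoc M.a_comm N.a_comm M.a_lcomm N.a_lcomm)
  then show ?thesis
    by (auto simp: f3space_def f3space_axioms_def dsum_def M.triple N.triple)
qed

text \<open>Also meaningful for \<open>x\<close> outside \<open>lcs G n\<close>, where the coset is
  no element of \<open>gr G n\<close>. With \<open>n = 2\<close> it thereby serves as the projection
  of all of \<open>G\<close> onto \<open>G Mod lcs G 3\<close>.\<close>

definition gcls :: "('a, 'c) monoid_scheme \<Rightarrow> nat \<Rightarrow> 'a \<Rightarrow> 'a set"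
  where "gcls G n x = lcs G (n + 1) #>\<^bsub>G\<^esub> x"

context exponent3
begin

lemma carrier_gr: "carrier (gr G n) = gcls G n ` lcs G n"
  by (auto simp: gr_def Let_def FactGroup_def RCOSETS_def gcls_def r_coset_def)

lemma gcls_add:
  assumes "x \<in> carrier G" "y \<in> carrier G"
  shows "gcls G n x \<oplus>\<^bsub>gr G n\<^esub> gcls G n y = gcls G n (x \<otimes> y)"
proof -
  interpret N: normal "lcs G (n + 1)" G by (rule lcs_normal)
  have "gcls G n x \<oplus>\<^bsub>gr G n\<^esub> gcls G n y = gcls G n x <#> gcls G n y"
    by (simp add: gr_def Let_def FactGroup_def set_mult_def)
  then show ?thesis
    using N.rcos_sum assms by (simp add: gcls_def)
qed

lemma gcls_eq_iff:
  assumes "x \<in> carrier G" "y \<in> carrier G"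
  shows "gcls G n x = gcls G n y \<longleftrightarrow> x \<otimes> inv y \<in> lcs G (n + 1)"
proof
  assume "gcls G n x = gcls G n y"
  then have "x \<in> lcs G (n + 1) #> y"
    using rcos_self[OF assms(1) lcs_subgroup] by (auto simp: gcls_def)
  then obtain h where "h \<in> lcs G (n + 1)" "x = h \<otimes> y" by (auto simp: r_coset_def)
  then show "x \<otimes> inv y \<in> lcs G (n + 1)"
    using assms lcs_carrier[of h] by (simp add: m_assoc)
next
  assume "x \<otimes> inv y \<in> lcs G (n + 1)"
  then have "x \<in> lcs G (n + 1) #> y"
    using assms unfolding r_coset_def by (auto intro!: bexI[of _ "x \<otimes> inv y"] simp: m_assoc)
  then show "gcls G n x = gcls G n y"
    using repr_independence[OF _ assms(2) lcs_subgroup] by (simp add: gcls_def)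
qed

lemma gr_zero: "\<zero>\<^bsub>gr G n\<^esub> = gcls G n \<one>"
proof -
  have "lcs G (n + 1) \<subseteq> carrier G" using lcs_carrier by blast
  then show ?thesis by (simp add: gr_def Let_def gcls_def)
qed

lemma gcls_eq_zero_iff:
  assumes "x \<in> carrier G"
  shows "gcls G n x = \<zero>\<^bsub>gr G n\<^esub> \<longleftrightarrow> x \<in> lcs G (n + 1)"
  unfolding gr_zero using gcls_eq_iff[OF assms one_closed] assms by simp

lemma gcls_closed: "x \<in> lcs G n \<Longrightarrow> gcls G n x \<in> carrier (gr G n)"
  by (simp add: carrier_gr)

lemma gr_cases:
  assumes "X \<in> carrier (gr G n)"
  obtains x where "x \<in> lcs G n" "x \<in> carrier G" "X = gcls G n x"
  using assms lcs_carrier unfolding carrier_gr by blast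

lemma gcls_self: "x \<in> carrier G \<Longrightarrow> x \<in> gcls G n x"
  unfolding gcls_def using rcos_self lcs_subgroup by blast

lemma mem_gcls:
  assumes "x \<in> lcs G n" "y \<in> gcls G n x"
  shows "y \<in> lcs G n" "gcls G n y = gcls G n x"
proof -
  obtain h where h: "h \<in> lcs G (n + 1)" "y = h \<otimes> x"
    using assms(2) by (auto simp: gcls_def r_coset_def)
  then have "h \<in> lcs G n" using lcs_Suc_subset by auto
  then show "y \<in> lcs G n" using h assms by auto
  show "gcls G n y = gcls G n x"
    using repr_independence[OF _ lcs_carrier[OF assms(1)] lcs_subgroup] assms(2) by (simp add: gcls_def)
qed

lemma gcls_mult_commute:
  assumes "n \<ge> 1" "x \<in> lcs G n" "y \<in> lcs G n"
  shows "gcls G n (x \<otimes> y) = gcls G n (y \<otimes> x)"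
proof -
  have c: "x \<in> carrier G" "y \<in> carrier G" using assms lcs_carrier by auto
  have "(x \<otimes> y) \<otimes> inv (y \<otimes> x) = comm G x y"
    using c by (simp add: comm_def inv_mult_group m_assoc)
  also have "\<dots> \<in> lcs G (n + 1)"
    using comm_in_lcs_Suc(1)[OF assms(1,2) c(2)] by simp
  finally show ?thesis
    using c gcls_eq_iff by simp
qed

lemma f3space_gr:
  assumes "n \<ge> 1"
  shows "f3space (gr G n)"
proof -
  have ag: "abelian_group (gr G n)"
  proof (rule abelian_groupI)
    fix x assume "x \<in> carrier (gr G n)"
    then obtain a where a: "a \<in> lcs G n" "a \<in> carrier G" "x = gcls G n a" by (rule gr_cases)
    have "gcls G n (inv a) \<oplus>\<^bsub>gr G n\<^esub> x = \<zero>\<^bsub>gr G n\<^esub>"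
      using a by (simp add: gcls_add gr_zero)
    then show "\<exists>y\<in>carrier (gr G n). y \<oplus>\<^bsub>gr G n\<^esub> x = \<zero>\<^bsub>gr G n\<^esub>"
      using a gcls_closed lcs_inv by blast
  qed (auto elim!: gr_cases simp: gcls_add gcls_closed gr_zero lcs_mult m_assoc gcls_mult_commute[OF assms])
  \<comment> \<open>A nonnegative integer power unfolds to iterated multiplication in the quotient,
    which is the addition of \<open>gr G n\<close>.\<close>
  have smult: "k \<odot>\<^bsub>gr G n\<^esub> X = rec_nat \<zero>\<^bsub>gr G n\<^esub> (\<lambda>u b. b \<oplus>\<^bsub>gr G n\<^esub> X) (nat k)" if "k \<ge> 0" for k X
    using that by (simp add: gr_def Let_def int_pow_def nat_pow_def)
  interpret abelian_group "gr G n" by fact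
  show ?thesis
  proof
    fix x assume "x \<in> carrier (gr G n)"
    then show "x \<oplus>\<^bsub>gr G n\<^esub> x \<oplus>\<^bsub>gr G n\<^esub> x = \<zero>\<^bsub>gr G n\<^esub>"
      by (auto elim!: gr_cases simp: gcls_add gr_zero cube)
  qed (simp_all add: smult numeral_2_eq_2)
qed

lemma gr_trivial:
  assumes "n \<ge> 4"
  shows "carrier (gr G n) = {\<zero>\<^bsub>gr G n\<^esub>}"
  using lcs_trivial[OF assms] by (simp add: carrier_gr gr_zero)

end

section \<open>The bracket on the graded pieces\<close>

context exponent3
begin

lemma gcls_conj:
  assumes "n \<ge> 1" "c \<in> lcs G n" "g \<in> carrier G"
  shows "gcls G n (g \<otimes> c \<otimes> inv g) = gcls G n c"
proof -
  have c: "c \<in> carrier G" using assms lcs_carrier by auto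
  have "(g \<otimes> c \<otimes> inv g) \<otimes> inv c = comm G g c"
    by (simp add: comm_def)
  also have "\<dots> \<in> lcs G (n + 1)"
    using comm_in_lcs_Suc(2)[OF assms] by simp
  finally show ?thesis
    using c assms gcls_eq_iff by simp
qed

text \<open>The commutator of a product differs from the product of the commutators by a conjugation
  and by the order of the factors; both are invisible modulo the next term of the series.\<close>

lemma gcls_comm_mult_left:
  assumes "n \<ge> 1" "m \<ge> 1" "a \<in> lcs G n" "a' \<in> lcs G n" "b \<in> lcs G m"
  shows "gcls G (n + m) (comm G (a \<otimes> a') b)
    = gcls G (n + m) (comm G a b) \<oplus>\<^bsub>gr G (n + m)\<^esub> gcls G (n + m) (comm G a' b)"
proof -
  interpret M: f3space "gr G (n + m)" using f3space_gr assms by simp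
  have c: "a \<in> carrier G" "a' \<in> carrier G" "b \<in> carrier G" using assms lcs_carrier by auto
  have k: "comm G a' b \<in> lcs G (n + m)" "comm G a b \<in> lcs G (n + m)" using comm_lcs assms by auto
  have "gcls G (n + m) (comm G (a \<otimes> a') b)
      = gcls G (n + m) (a \<otimes> comm G a' b \<otimes> inv a) \<oplus>\<^bsub>gr G (n + m)\<^esub> gcls G (n + m) (comm G a b)"
    using c by (simp add: comm_mult_left gcls_add)
  also have "\<dots> = gcls G (n + m) (comm G a' b) \<oplus>\<^bsub>gr G (n + m)\<^esub> gcls G (n + m) (comm G a b)"
    using gcls_conj[of "n + m"] k c assms by simp
  finally show ?thesis
    using M.a_comm k gcls_closed by simp
qed

lemma gcls_inv:
  assumes "n \<ge> 1" "x \<in> lcs G n"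
  shows "gcls G n (inv x) = \<ominus>\<^bsub>gr G n\<^esub> gcls G n x"
proof -
  interpret M: f3space "gr G n" using f3space_gr assms by simp
  have x: "x \<in> carrier G" using assms lcs_carrier by auto
  have "gcls G n (inv x) \<oplus>\<^bsub>gr G n\<^esub> gcls G n x = \<zero>\<^bsub>gr G n\<^esub>"
    using x by (simp add: gcls_add gr_zero)
  then show ?thesis
    using M.minus_equality gcls_closed assms lcs_inv by metis
qed

lemma gcls_comm_swap:
  assumes "n \<ge> 1" "m \<ge> 1" "a \<in> lcs G n" "b \<in> lcs G m"
  shows "gcls G (n + m) (comm G b a) = \<ominus>\<^bsub>gr G (n + m)\<^esub> gcls G (n + m) (comm G a b)"
  using gcls_inv[of "n + m" "comm G a b"] comm_lcs[OF assms] inv_commutator assms lcs_carrier by simp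

lemma gcls_comm_mult_right:
  assumes "n \<ge> 1" "m \<ge> 1" "a \<in> lcs G n" "b \<in> lcs G m" "b' \<in> lcs G m"
  shows "gcls G (n + m) (comm G a (b \<otimes> b'))
    = gcls G (n + m) (comm G a b) \<oplus>\<^bsub>gr G (n + m)\<^esub> gcls G (n + m) (comm G a b')"
proof -
  have c: "a \<in> carrier G" "b \<in> carrier G" "b' \<in> carrier G" using assms lcs_carrier by auto
  have "comm G a b' \<in> lcs G (n + m)" using comm_lcs assms by auto
  then show ?thesis
    using c gcls_conj[of "n + m"] assms by (simp add: comm_mult_right flip: gcls_add)
      (simp add: gcls_add)
qed

text \<open>Another representative differs by an element one step deeper in the series, which by
  bilinearity adds a commutator of total degree n + m + 1. This makes the \<open>the_elem\<close> in
  \<open>gr_bracket\<close> well defined.\<close>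

lemma gcls_comm_cong:
  assumes "n \<ge> 1" "m \<ge> 1" "a \<in> lcs G n" "b \<in> lcs G m" "a' \<in> gcls G n a" "b' \<in> gcls G m b"
  shows "gcls G (n + m) (comm G a' b') = gcls G (n + m) (comm G a b)"
proof -
  interpret M: f3space "gr G (n + m)" using f3space_gr assms by simp
  obtain h where h: "h \<in> lcs G (n + 1)" "a' = h \<otimes> a"
    using assms(5) by (auto simp: gcls_def r_coset_def)
  obtain k where k: "k \<in> lcs G (m + 1)" "b' = k \<otimes> b"
    using assms(6) by (auto simp: gcls_def r_coset_def)
  have b': "b' \<in> lcs G m" by (rule mem_gcls(1)[OF assms(4,6)])
  have hk: "h \<in> lcs G n" "k \<in> lcs G m" using h k lcs_Suc_subset by auto
  have "comm G h b' \<in> lcs G (n + m + 1)" "comm G a k \<in> lcs G (n + m + 1)"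
    using comm_lcs[of "n + 1" m h b'] comm_lcs[of n "m + 1" a k] h k assms b' by simp_all
  then have z: "gcls G (n + m) (comm G h b') = \<zero>\<^bsub>gr G (n + m)\<^esub>"
      "gcls G (n + m) (comm G a k) = \<zero>\<^bsub>gr G (n + m)\<^esub>"
    using gcls_eq_zero_iff lcs_carrier by simp_all
  have "gcls G (n + m) (comm G a' b') = gcls G (n + m) (comm G a b')"
    using gcls_comm_mult_left[OF assms(1,2) hk(1) assms(3) b'] z h comm_lcs[OF assms(1-3) b'] gcls_closed
    by simp
  also have "\<dots> = gcls G (n + m) (comm G a b)"
    using gcls_comm_mult_right[OF assms(1,2,3) hk(2) assms(4)] z k comm_lcs[OF assms(1-4)] gcls_closed
    by simp
  finally show ?thesis .
qed

lemma gr_bracket_gcls: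
  assumes "n \<ge> 1" "m \<ge> 1" "a \<in> lcs G n" "b \<in> lcs G m"
  shows "gr_bracket G n m (gcls G n a) (gcls G m b) = gcls G (n + m) (comm G a b)"
proof -
  let ?f = "\<lambda>(a, b). lcs G (n + m + 1) #> comm G a b"
  have "the_elem (?f ` (gcls G n a \<times> gcls G m b)) = ?f (a, b)"
  proof (rule the_elem_image_unique)
    show "gcls G n a \<times> gcls G m b \<noteq> {}"
      using assms gcls_self lcs_carrier by blast
    fix y assume "y \<in> gcls G n a \<times> gcls G m b"
    then show "?f y = ?f (a, b)"
      using gcls_comm_cong[OF assms] by (auto simp: gcls_def)
  qed
  then show ?thesis by (simp add: gr_bracket_def gcls_def)
qed

lemma gr_bracket_closed:
  assumes "n \<ge> 1" "m \<ge> 1" "X \<in> carrier (gr G n)" "Y \<in> carrier (gr G m)"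
  shows "gr_bracket G n m X Y \<in> carrier (gr G (n + m))"
  using assms by (auto elim!: gr_cases simp: gr_bracket_gcls gcls_closed comm_lcs)

lemma gr_bracket_add_left:
  assumes "n \<ge> 1" "m \<ge> 1" "X \<in> carrier (gr G n)" "X' \<in> carrier (gr G n)" "Y \<in> carrier (gr G m)"
  shows "gr_bracket G n m (X \<oplus>\<^bsub>gr G n\<^esub> X') Y
    = gr_bracket G n m X Y \<oplus>\<^bsub>gr G (n + m)\<^esub> gr_bracket G n m X' Y"
  using assms by (auto elim!: gr_cases simp: gr_bracket_gcls gcls_add lcs_mult gcls_comm_mult_left)

lemma gr_bracket_add_right:
  assumes "n \<ge> 1" "m \<ge> 1" "X \<in> carrier (gr G n)" "Y \<in> carrier (gr G m)" "Y' \<in> carrier (gr G m)"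
  shows "gr_bracket G n m X (Y \<oplus>\<^bsub>gr G m\<^esub> Y')
    = gr_bracket G n m X Y \<oplus>\<^bsub>gr G (n + m)\<^esub> gr_bracket G n m X Y'"
  using assms by (auto elim!: gr_cases simp: gr_bracket_gcls gcls_add lcs_mult gcls_comm_mult_right)

lemma gr_bracket_swap:
  assumes "n \<ge> 1" "m \<ge> 1" "X \<in> carrier (gr G n)" "Y \<in> carrier (gr G m)"
  shows "gr_bracket G m n Y X = \<ominus>\<^bsub>gr G (n + m)\<^esub> gr_bracket G n m X Y"
  using assms gcls_comm_swap
  by (auto elim!: gr_cases simp: gr_bracket_gcls add.commute[of m n])

end

lemma gr_map_gcls:
  assumes "exponent3 G" "exponent3 H" "f \<in> hom G H" "x \<in> lcs G n"
  shows "gr_map H f n (gcls G n x) = gcls H n (f x)"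
proof -
  interpret G: exponent3 G by fact
  interpret H: exponent3 H by fact
  interpret f: group_hom G H f
    using assms(3) by unfold_locales
  have x: "x \<in> carrier G" using assms G.lcs_carrier by auto
  have "the_elem ((\<lambda>a. lcs H (n + 1) #>\<^bsub>H\<^esub> f a) ` gcls G n x) = lcs H (n + 1) #>\<^bsub>H\<^esub> f x"
  proof (rule the_elem_image_unique)
    show "gcls G n x \<noteq> {}" using G.gcls_self x by blast
    fix y assume "y \<in> gcls G n x"
    then obtain h where h: "h \<in> lcs G (n + 1)" "y = h \<otimes>\<^bsub>G\<^esub> x" by (auto simp: gcls_def r_coset_def)
    then have "h \<in> carrier G" using G.lcs_carrier by auto
    then have "f y \<otimes>\<^bsub>H\<^esub> inv\<^bsub>H\<^esub> f x = f h"
      using h x by (simp add: H.m_assoc)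
    moreover have "f h \<in> lcs H (n + 1)" using f.hom_lcs h by auto
    ultimately have "gcls H n (f y) = gcls H n (f x)"
      using h x \<open>h \<in> carrier G\<close> by (simp add: H.gcls_eq_iff)
    then show "lcs H (n + 1) #>\<^bsub>H\<^esub> f y = lcs H (n + 1) #>\<^bsub>H\<^esub> f x" by (simp add: gcls_def)
  qed
  then show ?thesis by (simp add: gr_map_def gcls_def)
qed

lemma gr_map_hom:
  assumes "exponent3 G" "exponent3 H" "f \<in> hom G H"
  shows "gr_map H f n \<in> ahom (gr G n) (gr H n)"
proof -
  interpret G: exponent3 G by fact
  interpret H: exponent3 H by fact
  interpret f: group_hom G H f
    using assms(3) by unfold_locales
  note [simp] = gr_map_gcls[OF assms]
  show ?thesis
    by (rule homI) (auto elim!: G.gr_cases simp: H.gcls_closed f.hom_lcs G.gcls_add H.gcls_add G.lcs_mult)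
qed

section \<open>Tensor products\<close>

text \<open>Lists are used because a sum of pure tensors may repeat a pair, and because
  \<open>tsum_eq_zero\<close> inducts on the number of summands.\<close>

definition lsum :: "('r, 'l) module \<Rightarrow> ('p \<Rightarrow> 'l) \<Rightarrow> 'p list \<Rightarrow> 'l"
  where "lsum L f ps = foldr (\<lambda>p s. f p \<oplus>\<^bsub>L\<^esub> s) ps \<zero>\<^bsub>L\<^esub>"

lemma lsum_simps [simp]:
  "lsum L f [] = \<zero>\<^bsub>L\<^esub>" "lsum L f (p # ps) = f p \<oplus>\<^bsub>L\<^esub> lsum L f ps"
  by (simp_all add: lsum_def)

context f3space
begin

lemma lsum_closed [simp]:
  "(\<And>p. p \<in> set ps \<Longrightarrow> f p \<in> carrier M) \<Longrightarrow> lsum M f ps \<in> carrier M"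
  by (induction ps) auto

lemma lsum_hom:
  assumes "f3space N" "h \<in> ahom M N" "\<And>p. p \<in> set ps \<Longrightarrow> f p \<in> carrier M"
  shows "h (lsum M f ps) = lsum N (h \<circ> f) ps"
proof -
  interpret N: f3space N by fact
  interpret h: group_hom "add_monoid M" "add_monoid N" h
    by (rule f3space_group_hom[OF f3space_axioms assms(1,2)])
  show ?thesis
    using assms(3)
  proof (induction ps)
    case Nil
    then show ?case using h.hom_one by simp
  next
    case (Cons p ps)
    then show ?case using h.hom_mult[of "f p" "lsum M f ps"] by simp
  qed
qed

end

lemma free_module_simps [simp]:
  "c \<in> carrier (free_module F3 S) \<longleftrightarrow>
     (\<forall>s. c s \<in> {0, 1, 2}) \<and> finite {s. c s \<noteq> 0} \<and> {s. c s \<noteq> 0} \<subseteq> S"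
  "\<zero>\<^bsub>free_module F3 S\<^esub> = (\<lambda>s. 0)"
  "c \<oplus>\<^bsub>free_module F3 S\<^esub> d = (\<lambda>s. (c s + d s) mod 3)"
  "r \<odot>\<^bsub>free_module F3 S\<^esub> c = (\<lambda>s. r * c s mod 3)"
  by (auto simp: free_module_def)

lemma free_module_coeff:
  assumes "c \<in> carrier (free_module F3 S)"
  shows "c s \<in> carrier F3" "finite {s. c s \<noteq> 0}" "c s \<noteq> 0 \<Longrightarrow> s \<in> S"
  using assms by auto

lemma f3space_free: "f3space (free_module F3 S)"
proof -
  have mem: "x mod 3 \<in> {0, 1, 2}" for x :: int
    by auto
  have mod3: "x mod 3 = x" if "x \<in> {0, 1, 2}" for x :: int
    using that by auto
  have "abelian_group (free_module F3 S)"
  proof (rule abelian_groupI)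
    fix c d assume c: "c \<in> carrier (free_module F3 S)" and d: "d \<in> carrier (free_module F3 S)"
    have "{s. (c s + d s) mod 3 \<noteq> 0} \<subseteq> {s. c s \<noteq> 0} \<union> {s. d s \<noteq> 0}" by auto
    then show "c \<oplus>\<^bsub>free_module F3 S\<^esub> d \<in> carrier (free_module F3 S)"
      using c d mem unfolding free_module_simps by (meson finite_UnI finite_subset le_sup_iff order_trans)
  next
    fix c assume c: "c \<in> carrier (free_module F3 S)"
    have "{s. (- c s) mod 3 \<noteq> 0} \<subseteq> {s. c s \<noteq> 0}" by auto
    then have "(\<lambda>s. (- c s) mod 3) \<in> carrier (free_module F3 S)"
      using c mem unfolding free_module_simps by (meson finite_subset order_trans)
    moreover have "(\<lambda>s. (- c s) mod 3) \<oplus>\<^bsub>free_module F3 S\<^esub> c = \<zero>\<^bsub>free_module F3 S\<^esub>"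
      by (simp add: mod_simps)
    ultimately show "\<exists>d\<in>carrier (free_module F3 S). d \<oplus>\<^bsub>free_module F3 S\<^esub> c = \<zero>\<^bsub>free_module F3 S\<^esub>" by blast
  next
    fix c assume "c \<in> carrier (free_module F3 S)"
    then have "c s mod 3 = c s" for s by (intro mod3) simp
    then show "\<zero>\<^bsub>free_module F3 S\<^esub> \<oplus>\<^bsub>free_module F3 S\<^esub> c = c" by simp
  qed (auto simp: mod_simps ac_simps)
  then show ?thesis
    using mod3 by (simp add: f3space_def f3space_axioms_def mod_simps)
qed

lemma free_gen_closed: "s \<in> S \<Longrightarrow> free_gen F3 s \<in> carrier (free_module F3 S)"
  by (auto simp: free_gen_def)

lemma (in f3space)
  assumes K: "subgroup K (add_monoid M)"
  shows f3space_quot: "f3space (quot_module M K)"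
    and quot_hom: "(\<lambda>x. K +> x) \<in> ahom M (quot_module M K)"
    and quot_carrier: "carrier (quot_module M K) = (\<lambda>x. K +> x) ` carrier M"
    and quot_zero: "\<zero>\<^bsub>quot_module M K\<^esub> = K +> \<zero>"
proof -
  let ?A = "add_monoid M"
  interpret K: normal K ?A by (rule comm_group.subgroup_imp_normal[OF a_comm_group K])
  have sub: "K \<subseteq> carrier M" using K.subset by simp
  show car: "carrier (quot_module M K) = (\<lambda>x. K +> x) ` carrier M"
    by (auto simp: quot_module_def A_RCOSETS_def RCOSETS_def a_r_coset_def)
  have add: "(K +> x) \<oplus>\<^bsub>quot_module M K\<^esub> (K +> y) = K +> (x \<oplus> y)"
    if "x \<in> carrier M" "y \<in> carrier M" for x y
    using K.rcos_sum[of x y] that by (simp add: quot_module_def set_add_def a_r_coset_def)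
  show zero: "\<zero>\<^bsub>quot_module M K\<^esub> = K +> \<zero>"
    using add.coset_mult_one[of K] sub by (simp add: quot_module_def a_r_coset_def)
  show "(\<lambda>x. K +> x) \<in> ahom M (quot_module M K)"
    by (rule homI) (auto simp: car add)
  have ag: "abelian_group (quot_module M K)"
  proof (rule abelian_groupI)
    fix X assume "X \<in> carrier (quot_module M K)"
    then obtain x where x: "x \<in> carrier M" "X = K +> x" by (auto simp: car)
    then have "(K +> \<ominus> x) \<oplus>\<^bsub>quot_module M K\<^esub> X = \<zero>\<^bsub>quot_module M K\<^esub>"
      by (simp add: add zero l_neg)
    then show "\<exists>Y\<in>carrier (quot_module M K). Y \<oplus>\<^bsub>quot_module M K\<^esub> X = \<zero>\<^bsub>quot_module M K\<^esub>"
      using x car by blast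
  qed (auto simp: car add zero a_assoc a_comm a_lcomm)
  have smult: "r \<odot>\<^bsub>quot_module M K\<^esub> (K +> x) = K +> (r \<odot> x)"
    if r: "r \<in> carrier F3" and x: "x \<in> carrier M" for r x
  proof -
    have "K +> (r \<odot> y) = K +> (r \<odot> x)" if y: "y \<in> K +> x" for y
    proof -
      have yc: "y \<in> carrier M"
        using y x sub by (auto simp: a_r_coset_def r_coset_def)
      moreover have "K +> y = K +> x"
        using add.repr_independence[of y K x] y x K by (simp add: a_r_coset_def)
      ultimately show ?thesis
        using r x add[of y y] add[of x x] by auto
    qed
    moreover have "x \<in> K +> x"
      using add.rcos_self[OF _ K] x by (simp add: a_r_coset_def)
    ultimately have "(\<Union>y\<in>K +> x. K +> (r \<odot> y)) = K +> (r \<odot> x)"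
      by blast
    then show ?thesis
      by (simp add: quot_module_def)
  qed
  show "f3space (quot_module M K)"
    using ag smult unfolding f3space_def f3space_axioms_def
    by (auto simp add: car add zero triple)
qed

definition tpure :: "(int, 'm) module \<Rightarrow> (int, 'n) module \<Rightarrow> 'm \<Rightarrow> 'n \<Rightarrow> ('m \<times> 'n \<Rightarrow> int) set"
  where "tpure M N x y =
    (let F = free_module F3 (carrier M \<times> carrier N)
     in lin_span F3 F (tensor_rels F3 M N) +>\<^bsub>F\<^esub> free_gen F3 (x, y))"

text \<open>Additivity in each variable suffices, since additive maps between these spaces respect
  the scalars.\<close>

definition bilin ::
    "(int, 'm) module \<Rightarrow> (int, 'n) module \<Rightarrow> (int, 'l) module \<Rightarrow> ('m \<Rightarrow> 'n \<Rightarrow> 'l) \<Rightarrow> bool"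
  where "bilin M N L f \<longleftrightarrow>
    (\<forall>y\<in>carrier N. (\<lambda>x. f x y) \<in> ahom M L) \<and>
    (\<forall>x\<in>carrier M. f x \<in> ahom N L)"

lemma bilinD:
  assumes "bilin M N L f" "x \<in> carrier M" "y \<in> carrier N"
  shows "f x y \<in> carrier L"
    and "x' \<in> carrier M \<Longrightarrow> f (x \<oplus>\<^bsub>M\<^esub> x') y = f x y \<oplus>\<^bsub>L\<^esub> f x' y"
    and "y' \<in> carrier N \<Longrightarrow> f x (y \<oplus>\<^bsub>N\<^esub> y') = f x y \<oplus>\<^bsub>L\<^esub> f x y'"
  using assms unfolding bilin_def hom_def by fastforce+

locale f3tensor = M: f3space M + N: f3space N
  for M :: "(int, 'm) module" and N :: "(int, 'n) module"
begin

abbreviation "F \<equiv> free_module F3 (carrier M \<times> carrier N)"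
abbreviation "K \<equiv> lin_span F3 F (tensor_rels F3 M N)"
abbreviation "T \<equiv> tensor F3 M N"
abbreviation "e x y \<equiv> free_gen F3 (x, y)"

sublocale F: f3space F by (rule f3space_free)

lemma tensor_rels_subset: "tensor_rels F3 M N \<subseteq> carrier F"
proof -
  have e: "x \<in> carrier M \<Longrightarrow> y \<in> carrier N \<Longrightarrow> e x y \<in> carrier F" for x y
    by (rule free_gen_closed) simp
  have "a \<in> carrier F \<Longrightarrow> b \<in> carrier F \<Longrightarrow> a \<ominus>\<^bsub>F\<^esub> b \<in> carrier F" for a b
    by (rule F.minus_closed)
  then show ?thesis
    unfolding tensor_rels_def Let_def
    by (auto simp del: free_module_simps intro!: F.minus_closed F.a_closed F.smult_closed e M.smult_closed N.smult_closed)
qed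

lemma K_subgroup: "subgroup K (add_monoid F)"
  using F.lin_span_subgroup tensor_rels_subset .

lemma rels_K: "tensor_rels F3 M N \<subseteq> K"
  unfolding lin_span_def by blast

lemma f3space_tensor: "f3space T"
  using F.f3space_quot[OF K_subgroup] by (simp add: tensor_def Let_def)

lemma tensor_carrier: "carrier T = (\<lambda>c. K +>\<^bsub>F\<^esub> c) ` carrier F"
  using F.quot_carrier[OF K_subgroup] by (simp add: tensor_def Let_def)

lemma tensor_quot_hom: "(\<lambda>c. K +>\<^bsub>F\<^esub> c) \<in> ahom F T"
  using F.quot_hom[OF K_subgroup] by (simp add: tensor_def Let_def)

lemma tensor_zero: "\<zero>\<^bsub>T\<^esub> = K +>\<^bsub>F\<^esub> \<zero>\<^bsub>F\<^esub>"
  using F.quot_zero[OF K_subgroup] by (simp add: tensor_def Let_def)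

sublocale T: f3space T by (rule f3space_tensor)

lemma gen_closed: "x \<in> carrier M \<Longrightarrow> y \<in> carrier N \<Longrightarrow> e x y \<in> carrier F"
  by (rule free_gen_closed) simp

lemma quot_add:
  assumes "c \<in> carrier F" "d \<in> carrier F"
  shows "K +>\<^bsub>F\<^esub> (c \<oplus>\<^bsub>F\<^esub> d) = (K +>\<^bsub>F\<^esub> c) \<oplus>\<^bsub>T\<^esub> (K +>\<^bsub>F\<^esub> d)"
  using tensor_quot_hom assms by (simp add: hom_def del: free_module_simps)

lemma quot_eqI:
  assumes "c \<in> carrier F" "d \<in> carrier F" "c \<ominus>\<^bsub>F\<^esub> d \<in> K"
  shows "K +>\<^bsub>F\<^esub> c = K +>\<^bsub>F\<^esub> d"
proof -
  have "c = (c \<ominus>\<^bsub>F\<^esub> d) \<oplus>\<^bsub>F\<^esub> d"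
    using assms(1,2) by (simp add: F.minus_eq F.a_assoc F.l_neg del: free_module_simps)
  then have "c \<in> K +>\<^bsub>F\<^esub> d"
    using assms(3) by (auto simp: a_r_coset_def r_coset_def simp del: free_module_simps)
  then show ?thesis
    using F.add.repr_independence[of c K d] K_subgroup assms(2) by (simp add: a_r_coset_def del: free_module_simps)
qed

lemma bilin_tpure: "bilin M N T (tpure M N)"
proof -
  have closed: "tpure M N x y \<in> carrier T" if "x \<in> carrier M" "y \<in> carrier N" for x y
    using gen_closed[OF that] by (simp add: tpure_def Let_def tensor_carrier del: free_module_simps)
  have left: "tpure M N (x \<oplus>\<^bsub>M\<^esub> x') y = tpure M N x y \<oplus>\<^bsub>T\<^esub> tpure M N x' y"
    if "x \<in> carrier M" "x' \<in> carrier M" "y \<in> carrier N" for x x' y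
  proof -
    have "e (x \<oplus>\<^bsub>M\<^esub> x') y \<ominus>\<^bsub>F\<^esub> (e x y \<oplus>\<^bsub>F\<^esub> e x' y) \<in> tensor_rels F3 M N"
      using that unfolding tensor_rels_def Let_def by blast
    then show ?thesis
      using that rels_K unfolding tpure_def Let_def
      by (subst quot_add[symmetric]; intro quot_eqI gen_closed F.a_closed M.a_closed) auto
  qed
  have right: "tpure M N x (y \<oplus>\<^bsub>N\<^esub> y') = tpure M N x y \<oplus>\<^bsub>T\<^esub> tpure M N x y'"
    if "x \<in> carrier M" "y \<in> carrier N" "y' \<in> carrier N" for x y y'
  proof -
    have "e x (y \<oplus>\<^bsub>N\<^esub> y') \<ominus>\<^bsub>F\<^esub> (e x y \<oplus>\<^bsub>F\<^esub> e x y') \<in> tensor_rels F3 M N"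
      using that unfolding tensor_rels_def Let_def by blast
    then show ?thesis
      using that rels_K unfolding tpure_def Let_def
      by (subst quot_add[symmetric]; intro quot_eqI gen_closed F.a_closed N.a_closed) auto
  qed
  show ?thesis
    unfolding bilin_def by (auto intro!: homI simp: closed left right)
qed

abbreviation tsum :: "('m \<times> 'n) list \<Rightarrow> ('m \<times> 'n \<Rightarrow> int) set"
  where "tsum \<equiv> lsum T (\<lambda>(x, y). tpure M N x y)"

lemma tpure_closed: "p \<in> carrier M \<times> carrier N \<Longrightarrow> (\<lambda>(x, y). tpure M N x y) p \<in> carrier T"
  using bilinD(1)[OF bilin_tpure] by auto

text \<open>The only nonzero coefficients are 1 and 2, and 2 is rendered by writing the pair twice;
  this is why the lists carry no coefficients.\<close>

lemma tensor_rep: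
  assumes "t \<in> carrier T"
  obtains ps where "set ps \<subseteq> carrier M \<times> carrier N" "t = tsum ps"
proof -
  \<comment> \<open>The induction runs over a finite set containing the support, so that erasing one
    coordinate of \<open>c\<close> stays within reach of the induction hypothesis.\<close>
  have key: "\<exists>ps. set ps \<subseteq> carrier M \<times> carrier N \<and> K +>\<^bsub>F\<^esub> c = tsum ps"
    if "finite A" "c \<in> carrier F" "{p. c p \<noteq> 0} \<subseteq> A" for A c
    using that
  proof (induction A arbitrary: c)
    case empty
    then have "c = \<zero>\<^bsub>F\<^esub>" by (auto simp: fun_eq_iff)
    then show ?case by (intro exI[of _ "[]"]) (simp add: tensor_zero del: free_module_simps)
  next
    case (insert p A)
    show ?case
    proof (cases "c p = 0")
      case True
      then show ?thesis using insert by (intro insert.IH) auto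
    next
      case False
      then have p: "p \<in> carrier M \<times> carrier N" and cp: "c p = 1 \<or> c p = 2"
        using free_module_coeff(1,3)[OF insert.prems(1), of p] by auto
      then obtain x y where xy: "x \<in> carrier M" "y \<in> carrier N" "p = (x, y)" by auto
      define c' where "c' = c(p := 0)"
      have c': "c' \<in> carrier F" "{p. c' p \<noteq> 0} \<subseteq> A"
        using free_module_coeff[OF insert.prems(1)] insert.prems(2)
        by (auto simp: c'_def elim!: rev_finite_subset)
      then obtain ps where ps: "set ps \<subseteq> carrier M \<times> carrier N" "K +>\<^bsub>F\<^esub> c' = tsum ps"
        using insert.IH by blast
      have one: "K +>\<^bsub>F\<^esub> (e x y \<oplus>\<^bsub>F\<^esub> d) = tsum ((x, y) # qs)"
        if "d \<in> carrier F" "K +>\<^bsub>F\<^esub> d = tsum qs" for d qs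
        using quot_add[OF gen_closed[OF xy(1,2)] that(1)] that(2) by (simp add: tpure_def Let_def del: free_module_simps)
      have mod3: "z mod 3 = z" if "z \<in> {0, 1, 2}" for z :: int
        using that by auto
      have c3: "c q mod 3 = c q" for q
        using free_module_coeff(1)[OF insert.prems(1), of q] by (intro mod3) simp
      have "c = e x y \<oplus>\<^bsub>F\<^esub> c'" if "c p = 1"
        using that xy c3 by (auto simp: c'_def free_gen_def fun_eq_iff)
      moreover have "c = e x y \<oplus>\<^bsub>F\<^esub> (e x y \<oplus>\<^bsub>F\<^esub> c')" if "c p = 2"
        using that xy c3 by (auto simp: c'_def free_gen_def fun_eq_iff mod_simps)
      ultimately have "K +>\<^bsub>F\<^esub> c = tsum ((x, y) # ps) \<or> K +>\<^bsub>F\<^esub> c = tsum ((x, y) # (x, y) # ps)"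
        using one[OF c'(1) ps(2)] one[OF F.a_closed[OF gen_closed[OF xy(1,2)] c'(1)] one[OF c'(1) ps(2)]] cp
        by metis
      then show ?thesis
      proof
        assume "K +>\<^bsub>F\<^esub> c = tsum ((x, y) # ps)"
        then show ?thesis using ps(1) xy by (intro exI[of _ "(x, y) # ps"]) auto
      next
        assume "K +>\<^bsub>F\<^esub> c = tsum ((x, y) # (x, y) # ps)"
        then show ?thesis using ps(1) xy by (intro exI[of _ "(x, y) # (x, y) # ps"]) auto
      qed
    qed
  qed
  have "\<exists>ps. set ps \<subseteq> carrier M \<times> carrier N \<and> K +>\<^bsub>F\<^esub> c = tsum ps" if "c \<in> carrier F" for c
  proof -
    show ?thesis
      by (rule key[OF free_module_coeff(2)[OF that] that order_refl])
  qed
  then show ?thesis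
    using assms that unfolding tensor_carrier by blast
qed

text \<open>The linear extension \<open>E\<close> of \<open>f\<close> takes equal values on the two
  sides of each defining relation, so its kernel contains the relations and, being a subspace, also
  their span \<open>K\<close>. Hence \<open>E\<close> is constant on the cosets of
  \<open>K\<close>.\<close>

lemma tensor_lift_hom:
  assumes "f3space L" "bilin M N L f"
  shows "tensor_lift F3 L f \<in> ahom T L"
    and "x \<in> carrier M \<Longrightarrow> y \<in> carrier N \<Longrightarrow> tensor_lift F3 L f (tpure M N x y) = f x y"
proof -
  interpret L: f3space L by fact
  define E where "E c = (\<Oplus>\<^bsub>L\<^esub>p\<in>{p. c p \<noteq> \<zero>\<^bsub>F3\<^esub>}. c p \<odot>\<^bsub>L\<^esub> f (fst p) (snd p))" for c
  have fc: "f (fst p) (snd p) \<in> carrier L" if "p \<in> carrier M \<times> carrier N" for p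
    using bilinD(1)[OF assms(2)] that by auto
  \<comment> \<open>Elements of the free module have different supports; for additivity their sums
    have to run over a common finite index set.\<close>
  have E_alt: "E c = (\<Oplus>\<^bsub>L\<^esub>p\<in>A. c p \<odot>\<^bsub>L\<^esub> f (fst p) (snd p))"
    if "c \<in> carrier F" "finite A" "{p. c p \<noteq> 0} \<subseteq> A" "A \<subseteq> carrier M \<times> carrier N" for c A
  proof -
    have "c p \<odot>\<^bsub>L\<^esub> f (fst p) (snd p) \<in> carrier L" if "p \<in> A" for p
      using that \<open>A \<subseteq> _\<close> by (intro L.smult_closed fc free_module_coeff(1)[OF \<open>c \<in> carrier F\<close>]) auto
    then show ?thesis
      unfolding E_def using that fc
      by (intro L.add.finprod_mono_neutral_cong_left) (auto simp del: free_module_simps)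
  qed
  have E_closed: "E c \<in> carrier L" if "c \<in> carrier F" for c
    unfolding E_def
  proof (intro L.finsum_closed Pi_I)
    fix p assume "p \<in> {p. c p \<noteq> \<zero>\<^bsub>F3\<^esub>}"
    then have "c p \<in> carrier F3" "p \<in> carrier M \<times> carrier N"
      using free_module_coeff(1)[OF that, of p] free_module_coeff(3)[OF that, of p] by simp_all
    then show "c p \<odot>\<^bsub>L\<^esub> f (fst p) (snd p) \<in> carrier L" by (intro L.smult_closed fc)
  qed
  have E_add: "E (c \<oplus>\<^bsub>F\<^esub> d) = E c \<oplus>\<^bsub>L\<^esub> E d" if "c \<in> carrier F" "d \<in> carrier F" for c d
  proof -
    define A where "A = {p. c p \<noteq> 0} \<union> {p. d p \<noteq> 0}"
    have A: "finite A" "A \<subseteq> carrier M \<times> carrier N" "{p. c p \<noteq> 0} \<subseteq> A" "{p. d p \<noteq> 0} \<subseteq> A"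
      "{p. (c \<oplus>\<^bsub>F\<^esub> d) p \<noteq> 0} \<subseteq> A"
      using that by (auto simp: A_def)
    have cl: "c p \<in> carrier F3" "d p \<in> carrier F3" for p
      by (rule free_module_coeff(1)[OF that(1)], rule free_module_coeff(1)[OF that(2)])
    have "E (c \<oplus>\<^bsub>F\<^esub> d) = (\<Oplus>\<^bsub>L\<^esub>p\<in>A. (c \<oplus>\<^bsub>F\<^esub> d) p \<odot>\<^bsub>L\<^esub> f (fst p) (snd p))"
      using that A by (intro E_alt F.a_closed)
    also have "\<dots> = (\<Oplus>\<^bsub>L\<^esub>p\<in>A. c p \<odot>\<^bsub>L\<^esub> f (fst p) (snd p) \<oplus>\<^bsub>L\<^esub> d p \<odot>\<^bsub>L\<^esub> f (fst p) (snd p))"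
      unfolding free_module_simps
      using A(2) cl by (intro L.finsum_cong' refl)
        (auto intro!: L.smult_l_distr L.a_closed L.smult_closed fc simp del: F3_simps)
    also have "\<dots> = (\<Oplus>\<^bsub>L\<^esub>p\<in>A. c p \<odot>\<^bsub>L\<^esub> f (fst p) (snd p)) \<oplus>\<^bsub>L\<^esub> (\<Oplus>\<^bsub>L\<^esub>p\<in>A. d p \<odot>\<^bsub>L\<^esub> f (fst p) (snd p))"
      using A(2) cl by (intro L.finsum_addf) (auto intro!: L.smult_closed fc simp del: F3_simps)
    finally show ?thesis using that A by (simp only: E_alt)
  qed
  have E_gen: "E (e x y) = f x y" if "x \<in> carrier M" "y \<in> carrier N" for x y
  proof -
    have "E (e x y) = (\<Oplus>\<^bsub>L\<^esub>p\<in>{(x, y)}. e x y p \<odot>\<^bsub>L\<^esub> f (fst p) (snd p))"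
      using that by (intro E_alt gen_closed) (auto simp: free_gen_def)
    then show ?thesis
      using that bilinD(1)[OF assms(2)] by (simp add: free_gen_def)
  qed
  have E_hom: "E \<in> ahom F L"
    using E_closed E_add by (intro homI) (simp_all del: free_module_simps)
  interpret E: group_hom "add_monoid F" "add_monoid L" E
    by (rule f3space_group_hom[OF F.f3space_axioms assms(1) E_hom])
  have E_diff: "c \<ominus>\<^bsub>F\<^esub> d \<in> kernel (add_monoid F) (add_monoid L) E"
    if "c \<in> carrier F" "d \<in> carrier F" "E c = E d" for c d
  proof -
    have "E (c \<ominus>\<^bsub>F\<^esub> d) \<oplus>\<^bsub>L\<^esub> E d = E c"
      using E_add[of "c \<ominus>\<^bsub>F\<^esub> d" d] that F.minus_closed
      by (simp add: F.minus_eq F.a_assoc F.l_neg del: free_module_simps)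
    then have "E (c \<ominus>\<^bsub>F\<^esub> d) = \<zero>\<^bsub>L\<^esub>"
      using that E_closed F.minus_closed by (metis L.add.r_cancel_one')
    then show ?thesis
      using F.minus_closed[OF that(1,2)] by (simp add: kernel_def del: free_module_simps)
  qed
  have E_smult: "E (r \<odot>\<^bsub>F\<^esub> c) = r \<odot>\<^bsub>L\<^esub> E c" if "r \<in> carrier F3" "c \<in> carrier F" for r c
    using f3space_hom_smult[OF F.f3space_axioms assms(1) E_hom that] .
  have fl: "f (r \<odot>\<^bsub>M\<^esub> x) y = r \<odot>\<^bsub>L\<^esub> f x y" "f x (r \<odot>\<^bsub>N\<^esub> y) = r \<odot>\<^bsub>L\<^esub> f x y"
    if "r \<in> carrier F3" "x \<in> carrier M" "y \<in> carrier N" for r x y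
    using f3space_hom_smult[OF M.f3space_axioms assms(1) _ that(1,2), of "\<lambda>x. f x y"]
      f3space_hom_smult[OF N.f3space_axioms assms(1) _ that(1,3), of "f x"] that assms(2)
    by (simp_all add: bilin_def del: F3_simps)
  note cls = gen_closed M.a_closed N.a_closed F.a_closed M.smult_closed N.smult_closed F.smult_closed
  have "tensor_rels F3 M N \<subseteq> kernel (add_monoid F) (add_monoid L) E"
    unfolding tensor_rels_def Let_def
    using bilinD[OF assms(2)]
    by (auto intro!: E_diff cls simp: E_add E_gen E_smult fl cls simp del: F3_simps free_module_simps)
  then have "K \<subseteq> kernel (add_monoid F) (add_monoid L) E"
    by (intro F.lin_span_subset E.subgroup_kernel)
  then have EK: "E k = \<zero>\<^bsub>L\<^esub>" "k \<in> carrier F" if "k \<in> K" for k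
    using that by (auto simp: kernel_def simp del: free_module_simps)
  have lift: "tensor_lift F3 L f (K +>\<^bsub>F\<^esub> c) = E c" if c: "c \<in> carrier F" for c
  proof -
    have "the_elem (E ` (K +>\<^bsub>F\<^esub> c)) = E c"
    proof (rule the_elem_image_unique)
      show "K +>\<^bsub>F\<^esub> c \<noteq> {}"
        using F.add.rcos_self[of c K] K_subgroup c by (auto simp: a_r_coset_def simp del: free_module_simps)
      fix d assume "d \<in> K +>\<^bsub>F\<^esub> c"
      then obtain k where "k \<in> K" "d = k \<oplus>\<^bsub>F\<^esub> c" by (auto simp: a_r_coset_def r_coset_def simp del: free_module_simps)
      then show "E d = E c"
        using EK E_add c E_closed by (simp del: free_module_simps)
    qed
    then show ?thesis by (simp add: tensor_lift_def E_def)
  qed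
  show "tensor_lift F3 L f \<in> ahom T L"
    by (rule homI) (auto simp: tensor_carrier lift E_closed E_add F.a_closed simp flip: quot_add simp del: free_module_simps)
  show "tensor_lift F3 L f (tpure M N x y) = f x y" if "x \<in> carrier M" "y \<in> carrier N"
    using lift[OF gen_closed[OF that]] E_gen[OF that] by (simp add: tpure_def Let_def)
qed

lemma tensor_lift_tsum:
  assumes "f3space L" "bilin M N L f" "set ps \<subseteq> carrier M \<times> carrier N"
  shows "tensor_lift F3 L f (tsum ps) = lsum L (\<lambda>(x, y). f x y) ps"
proof -
  have "tensor_lift F3 L f (tsum ps) = lsum L (tensor_lift F3 L f \<circ> (\<lambda>(x, y). tpure M N x y)) ps"
    using assms tpure_closed by (intro T.lsum_hom tensor_lift_hom) auto
  also have "\<dots> = lsum L (\<lambda>(x, y). f x y) ps"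
    using assms(3) tensor_lift_hom(2)[OF assms(1,2)] by (induction ps) auto
  finally show ?thesis .
qed

end

section \<open>Functionals with values in the field of three elements\<close>

text \<open>Functionals take values in the ring type \<open>3\<close> of integers modulo 3, where
  \<open>algebra_simps\<close> applies, whereas the scalars of the modules are integers in the
  carrier of \<open>F3\<close>.\<close>

lemma three_eq_zero: "(3::3) = 0"
  by (simp add: iszero_def[symmetric])

lemma Z3_cases:
  obtains "(k::3) = 0" | "k = 1" | "k = 2"
proof (cases k)
  case (of_int z)
  then have "z = 0 \<or> z = 1 \<or> z = 2" by auto
  then show ?thesis using of_int that by auto
qed

lemma Z3_mult_three: "(k::3) * 3 = 0"
  by (simp add: three_eq_zero)

text \<open>A maximal subgroup avoiding \<open>x\<close> has index 3.\<close>
lemma (in comm_group) exponent3_functional: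
  assumes cube: "\<And>y. y \<in> carrier G \<Longrightarrow> y \<otimes> y \<otimes> y = \<one>" and x: "x \<in> carrier G" "x \<noteq> \<one>"
  obtains \<psi> :: "'a \<Rightarrow> 3"
  where "\<And>y z. y \<in> carrier G \<Longrightarrow> z \<in> carrier G \<Longrightarrow> \<psi> (y \<otimes> z) = \<psi> y + \<psi> z" "\<psi> x = 1"
proof -
  interpret E: exponent3 G using cube by unfold_locales
  define \<A> where "\<A> = {S. subgroup S G \<and> x \<notin> S}"
  have "\<exists>M\<in>\<A>. \<forall>S\<in>\<A>. M \<subseteq> S \<longrightarrow> S = M"
  proof (rule subset_Zorn_nonempty)
    show "\<A> \<noteq> {}" using triv_subgroup x by (auto simp: \<A>_def)
    fix \<C> assume C: "\<C> \<noteq> {}" "subset.chain \<A> \<C>"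
    have sub: "subgroup S G" "x \<notin> S" if "S \<in> \<C>" for S
      using C that by (auto simp: subset_chain_def \<A>_def)
    have "subgroup (\<Union>\<C>) G"
    proof (rule subgroupI)
      show "\<Union>\<C> \<subseteq> carrier G" using subgroup.subset[OF sub(1)] by blast
      show "\<Union>\<C> \<noteq> {}" using C(1) subgroup.one_closed[OF sub(1)] by blast
      show "inv a \<in> \<Union>\<C>" if "a \<in> \<Union>\<C>" for a
        using that subgroup.m_inv_closed[OF sub(1)] by blast
      fix a b assume "a \<in> \<Union>\<C>" "b \<in> \<Union>\<C>"
      then obtain S T where "S \<in> \<C>" "T \<in> \<C>" "a \<in> S" "b \<in> T" by auto
      moreover have "S \<subseteq> T \<or> T \<subseteq> S"
        using C(2) \<open>S \<in> \<C>\<close> \<open>T \<in> \<C>\<close> by (auto simp: subset_chain_def)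
      ultimately obtain U where "U \<in> \<C>" "a \<in> U" "b \<in> U" by blast
      then show "a \<otimes> b \<in> \<Union>\<C>"
        using subgroup.m_closed[OF sub(1)] by blast
    qed
    then show "\<Union>\<C> \<in> \<A>" using sub by (auto simp: \<A>_def)
  qed
  then obtain S where S: "subgroup S G" "x \<notin> S"
    and max: "\<And>T. subgroup T G \<Longrightarrow> x \<notin> T \<Longrightarrow> S \<subseteq> T \<Longrightarrow> T = S"
    by (auto simp: \<A>_def)
  interpret S: subgroup S G by fact
  \<comment> \<open>By maximality the product of \<open>S\<close> with {1, y, y^-1} is either
    \<open>S\<close> itself or contains \<open>x\<close>; in the second case the expression for
    \<open>x\<close> is solved for \<open>y\<close>.\<close>
  have decomp: "\<exists>k::int. \<exists>s\<in>S. y = s \<otimes> x [^] k" if y: "y \<in> carrier G" for y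
  proof -
    have "subgroup {\<one>, y, inv y} G"
      using y E.mult_self[of y] E.mult_self[of "inv y"] by unfold_locales auto
    then have T: "subgroup (S <#> {\<one>, y, inv y}) G"
      using S mult_subgroups by blast
    have sub: "s \<otimes> z \<in> S <#> {\<one>, y, inv y}" if "s \<in> S" "z \<in> {\<one>, y, inv y}" for s z
      using that by (auto simp: set_mult_def)
    have "S \<subseteq> S <#> {\<one>, y, inv y}"
      using sub[of _ \<one>] S.mem_carrier by auto
    show ?thesis
    proof (cases "x \<in> S <#> {\<one>, y, inv y}")
      case False
      then have "S <#> {\<one>, y, inv y} = S"
        using max T \<open>S \<subseteq> _\<close> by blast
      then have "y \<in> S"
        using sub[of \<one> y] y S.one_closed by simp
      then show ?thesis using y by (intro exI[of _ 0] bexI[of _ y]) auto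
    next
      case True
      then obtain s z where s: "s \<in> S" "z \<in> {\<one>, y, inv y}" "x = s \<otimes> z"
        unfolding set_mult_def by blast
      then have sc: "s \<in> carrier G" by auto
      consider "x = s \<otimes> y" | "x = s \<otimes> inv y"
        using s S(2) sc by auto
      then show ?thesis
      proof cases
        case 1
        then have "y = inv s \<otimes> x [^] (1::int)"
          using y sc by (simp add: int_pow_1)
        then show ?thesis using s(1) by blast
      next
        case 2
        then have "y = s \<otimes> x [^] (-1::int)"
          using y sc by (simp add: int_pow_neg_int int_pow_neg inv_mult_group m_comm m_lcomm[of s y "inv s"])
        then show ?thesis using s(1) by blast
      qed
    qed
  qed
  \<comment> \<open>Otherwise x^j is \<open>x\<close> or its inverse, and \<open>x\<close> would lie
    in \<open>S\<close>.\<close>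
  have power: "3 dvd j" if "x [^] (j::int) \<in> S" for j
  proof (rule ccontr)
    assume "\<not> 3 dvd j"
    then have j: "j mod 3 = 1 \<or> j mod 3 = 2" by presburger
    have "x [^] (3::int) = \<one>"
      using cube[OF x(1)] x(1) int_pow_mult[of x 1 2] int_pow_mult[of x 1 1] by (simp add: m_assoc)
    then have "x [^] (3 * (j div 3)) = \<one>"
      using x(1) by (simp flip: int_pow_pow)
    then have "x [^] j = x [^] (j mod 3)"
      using x(1) int_pow_mult[of x "3 * (j div 3)" "j mod 3"] by simp
    moreover have "x [^] (1::int) = x" "x [^] (2::int) = inv x"
      using x(1) E.mult_self[of x] int_pow_mult[of x 1 1] by auto
    ultimately have "x \<in> S \<or> inv x \<in> S"
      using j that by auto
    then show False
      using S(2) S.m_inv_closed[of "inv x"] x(1) by auto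
  qed
  \<comment> \<open>The functional reads off the exponent of \<open>x\<close> modulo
    \<open>S\<close>. The integer \<open>k\<close> is not unique, but by \<open>power\<close> its
    residue modulo 3 is.\<close>
  define R where "R y k \<longleftrightarrow> (\<exists>s\<in>S. y = s \<otimes> x [^] k)" for y and k :: int
  define \<psi> :: "'a \<Rightarrow> 3" where "\<psi> y = of_int (SOME k. R y k)" for y
  have mult: "R (y \<otimes> z) (k + l)" if R: "R y k" "R z l" for y z k l
  proof -
    obtain s t where "s \<in> S" "t \<in> S" "y = s \<otimes> x [^] k" "z = t \<otimes> x [^] l"
      using R by (auto simp: R_def)
    then have "y \<otimes> z = (s \<otimes> t) \<otimes> x [^] (k + l)" "s \<otimes> t \<in> S"
      using x(1) S.mem_carrier by (auto simp: int_pow_mult m_ac)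
    then show ?thesis unfolding R_def by blast
  qed
  have uniq: "of_int k = (of_int l :: 3)" if R: "R y k" "R y l" for y k l
  proof -
    obtain s t where st: "s \<in> S" "t \<in> S" "s \<otimes> x [^] k = t \<otimes> x [^] l"
      using R by (auto simp: R_def)
    define p q where "p = x [^] k" and "q = x [^] l"
    have c: "p \<in> carrier G" "q \<in> carrier G" "s \<in> carrier G" "t \<in> carrier G"
      using x(1) st by (auto simp: p_def q_def)
    have "x [^] (k - l) = p \<otimes> inv q"
      using x(1) by (simp add: int_pow_diff p_def q_def)
    also have "\<dots> = inv s \<otimes> (s \<otimes> p) \<otimes> inv q"
      using c by simp
    also have "\<dots> = inv s \<otimes> (t \<otimes> q) \<otimes> inv q"
      using st(3) by (simp only: p_def q_def)
    also have "\<dots> = inv s \<otimes> t"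
      using c by (simp add: m_assoc)
    finally have "x [^] (k - l) = inv s \<otimes> t" .
    then have "3 dvd k - l"
      using st power by simp
    then obtain q where "k = l + 3 * q"
      by (metis add_diff_cancel_left' diff_add_cancel dvdE add.commute)
    then show ?thesis by (simp add: three_eq_zero)
  qed
  have val: "\<psi> y = of_int k" if "R y k" for y k
    unfolding \<psi>_def by (rule uniq) (use that in \<open>auto intro: someI\<close>)
  show ?thesis
  proof (rule that)
    have "R x 1" using x(1) S.one_closed unfolding R_def by (intro bexI[of _ \<one>]) auto
    then show "\<psi> x = 1" using val by fastforce
    fix y z assume "y \<in> carrier G" "z \<in> carrier G"
    then obtain k l where kl: "R y k" "R z l" using decomp unfolding R_def by meson
    show "\<psi> (y \<otimes> z) = \<psi> y + \<psi> z"
      using val[OF mult[OF kl]] val[OF kl(1)] val[OF kl(2)] by simp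
  qed
qed

section \<open>Linear functionals and separating families\<close>

definition functionals :: "('r, 'm) module \<Rightarrow> ('m \<Rightarrow> 3) set"
  where "functionals M =
    {\<phi>. \<forall>x\<in>carrier M. \<forall>y\<in>carrier M. \<phi> (x \<oplus>\<^bsub>M\<^esub> y) = \<phi> x + \<phi> y}"

text \<open>A family rather than the whole dual space, because in degree 2 the functionals at hand
  are the \<open>engel_functionals\<close>. The value 1 is a normalisation that makes the chosen
  functional usable as a pivot in an elimination.\<close>

definition separating :: "('r, 'm) module \<Rightarrow> ('m \<Rightarrow> 3) set \<Rightarrow> bool"
  where "separating M \<Phi> \<longleftrightarrow>
    \<Phi> \<subseteq> functionals M \<and> (\<forall>x\<in>carrier M. x \<noteq> \<zero>\<^bsub>M\<^esub> \<longrightarrow> (\<exists>\<phi>\<in>\<Phi>. \<phi> x = 1))"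

lemma functionals_add:
  "\<phi> \<in> functionals M \<Longrightarrow> x \<in> carrier M \<Longrightarrow> y \<in> carrier M \<Longrightarrow> \<phi> (x \<oplus>\<^bsub>M\<^esub> y) = \<phi> x + \<phi> y"
  by (simp add: functionals_def)

context f3space
begin

lemma separating_functionals: "separating M (functionals M)"
proof -
  have "\<exists>\<phi>\<in>functionals M. \<phi> x = 1" if x: "x \<in> carrier M" "x \<noteq> \<zero>" for x
  proof -
    have "\<exists>\<phi> :: 'm \<Rightarrow> 3. (\<forall>y\<in>carrier M. \<forall>z\<in>carrier M. \<phi> (y \<oplus> z) = \<phi> y + \<phi> z) \<and> \<phi> x = 1"
    proof (rule comm_group.exponent3_functional[OF a_comm_group, of x])
      fix \<psi> :: "'m \<Rightarrow> 3"
      assume \<psi>: "\<And>y z. y \<in> carrier (add_monoid M) \<Longrightarrow> z \<in> carrier (add_monoid M) \<Longrightarrow>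
          \<psi> (y \<otimes>\<^bsub>add_monoid M\<^esub> z) = \<psi> y + \<psi> z" "\<psi> x = 1"
      show ?thesis
        by (rule exI[of _ \<psi>]) (use \<psi>(1)[simplified] \<psi>(2) in simp)
    qed (use x triple in simp_all)
    then show ?thesis unfolding functionals_def by blast
  qed
  then show ?thesis by (simp add: separating_def)
qed

lemma functionals_zero:
  assumes "\<phi> \<in> functionals M"
  shows "\<phi> \<zero> = 0"
  using functionals_add[OF assms zero_closed zero_closed] by simp

lemma functionals_minus:
  assumes "\<phi> \<in> functionals M" "x \<in> carrier M"
  shows "\<phi> (\<ominus> x) = - \<phi> x"
proof -
  have "\<phi> (\<ominus> x) + \<phi> x = 0"
    using functionals_add[OF assms(1), of "\<ominus> x" x] functionals_zero[OF assms(1)] assms by (simp add: l_neg)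
  then show ?thesis by (simp add: eq_neg_iff_add_eq_0)
qed

text \<open>Scalar multiplication by elements of the type \<open>3\<close>, so that the value of a
  functional can act on a vector.\<close>

definition scale :: "3 \<Rightarrow> 'm \<Rightarrow> 'm"
  where "scale k x = (if k = 0 then \<zero> else if k = 1 then x else x \<oplus> x)"

lemma scale_closed [simp]: "x \<in> carrier M \<Longrightarrow> scale k x \<in> carrier M"
  by (simp add: scale_def)

lemma functionals_scale:
  assumes "\<phi> \<in> functionals M" "x \<in> carrier M"
  shows "\<phi> (scale k x) = k * \<phi> x"
  using functionals_add[OF assms(1) assms(2) assms(2)] functionals_zero[OF assms(1)]
  by (cases k rule: Z3_cases) (simp_all add: scale_def)

lemma functionals_lsum:
  assumes "\<phi> \<in> functionals M" "\<And>p. p \<in> set ps \<Longrightarrow> f p \<in> carrier M"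
  shows "\<phi> (lsum M f ps) = sum_list (map (\<lambda>p. \<phi> (f p)) ps)"
  using assms(2) by (induction ps) (simp_all add: functionals_zero functionals_add assms(1))

end

lemma hom_scale:
  assumes "f3space M" "f3space N" "h \<in> ahom M N" "x \<in> carrier M"
  shows "h (f3space.scale M k x) = f3space.scale N k (h x)"
proof -
  interpret M: f3space M by fact
  interpret N: f3space N by fact
  interpret h: group_hom "add_monoid M" "add_monoid N" h
    by (rule f3space_group_hom[OF assms(1-3)])
  show ?thesis
    using h.hom_one h.hom_mult[of x x] assms(4) by (simp add: M.scale_def N.scale_def)
qed

section \<open>Detecting zero in a tensor product\<close>

context f3tensor
begin

lemma tpure_zero_left: "y \<in> carrier N \<Longrightarrow> tpure M N \<zero>\<^bsub>M\<^esub> y = \<zero>\<^bsub>T\<^esub>"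
  using bilinD(1,2)[OF bilin_tpure M.zero_closed, of y] M.zero_closed
  by (metis M.l_zero T.add.l_cancel_one')

lemma tpure_zero_right: "x \<in> carrier M \<Longrightarrow> tpure M N x \<zero>\<^bsub>N\<^esub> = \<zero>\<^bsub>T\<^esub>"
  using bilinD(1,3)[OF bilin_tpure _ N.zero_closed, of x] N.zero_closed
  by (metis N.l_zero T.add.l_cancel_one')

lemma tpure_scale:
  assumes "x \<in> carrier M" "y \<in> carrier N"
  shows "tpure M N (M.scale k x) y = tpure M N x (N.scale k y)"
  using hom_scale[OF M.f3space_axioms f3space_tensor, of "\<lambda>x. tpure M N x y" x k]
    hom_scale[OF N.f3space_axioms f3space_tensor, of "tpure M N x" y k] bilin_tpure assms
  by (simp add: bilin_def)

text \<open>Each first factor splits as x = (x - \<kappa>(x) a) + \<kappa>(x) a. The scalar is moved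
  to the second factor, and all terms with first factor \<open>a\<close> are collected. Here
  \<kappa> is an arbitrary function; the application takes a functional with value 1 at
  \<open>a\<close>.\<close>

lemma tsum_eliminate:
  assumes a: "a \<in> carrier M" and "set qs \<subseteq> carrier M \<times> carrier N"
  shows "tsum qs = tsum (map (\<lambda>(x, y). (x \<ominus>\<^bsub>M\<^esub> M.scale (\<kappa> x) a, y)) qs)
    \<oplus>\<^bsub>T\<^esub> tpure M N a (lsum N (\<lambda>(x, y). N.scale (\<kappa> x) y) qs)"
  using assms(2)
proof (induction qs)
  case Nil
  then show ?case using tpure_zero_right[OF a] by simp
next
  case (Cons p qs)
  obtain x y where p: "p = (x, y)" "x \<in> carrier M" "y \<in> carrier N"
    using Cons.prems by auto
  let ?w = "lsum N (\<lambda>(x, y). N.scale (\<kappa> x) y) qs"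
  let ?t = "tsum (map (\<lambda>(x, y). (x \<ominus>\<^bsub>M\<^esub> M.scale (\<kappa> x) a, y)) qs)"
  let ?x = "x \<ominus>\<^bsub>M\<^esub> M.scale (\<kappa> x) a"
  have w: "?w \<in> carrier N"
    using Cons.prems by (intro N.lsum_closed) auto
  have t: "?t \<in> carrier T"
    using Cons.prems a by (intro T.lsum_closed tpure_closed) auto
  have x: "?x \<in> carrier M" using p a by simp
  have "x = ?x \<oplus>\<^bsub>M\<^esub> M.scale (\<kappa> x) a"
    using p a by (simp add: M.minus_eq M.a_assoc M.l_neg)
  then have "tpure M N x y = tpure M N ?x y \<oplus>\<^bsub>T\<^esub> tpure M N a (N.scale (\<kappa> x) y)"
    using bilinD(2)[OF bilin_tpure x p(3), of "M.scale (\<kappa> x) a"] a p tpure_scale[OF a p(3)] by simp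
  moreover have "tpure M N a (N.scale (\<kappa> x) y \<oplus>\<^bsub>N\<^esub> ?w)
      = tpure M N a (N.scale (\<kappa> x) y) \<oplus>\<^bsub>T\<^esub> tpure M N a ?w"
    using a p w by (intro bilinD(3)[OF bilin_tpure]) auto
  ultimately show ?case
    using Cons t w x p a bilinD(1)[OF bilin_tpure]
    by (simp add: T.a_assoc T.a_lcomm)
qed

text \<open>
  If \<open>\<phi> a = 1\<close>, then the second factors satisfy a linear relation that rewrites the sum as a
  shorter one with \<open>a\<close> eliminated.
\<close>
lemma tsum_eq_zero:
  assumes \<Phi>: "separating M \<Phi>" and \<Psi>: "separating N \<Psi>"
    and "set ps \<subseteq> carrier M \<times> carrier N"
    and "\<And>\<phi> \<psi>. \<phi> \<in> \<Phi> \<Longrightarrow> \<psi> \<in> \<Psi> \<Longrightarrow> sum_list (map (\<lambda>(x, y). \<phi> x * \<psi> y) ps) = 0"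
  shows "tsum ps = \<zero>\<^bsub>T\<^esub>"
  using assms(3,4)
proof (induction "length ps" arbitrary: ps)
  case 0
  then show ?case by simp
next
  case (Suc n)
  then obtain a b qs where ps: "ps = (a, b) # qs" by (cases ps) auto
  then have ab: "a \<in> carrier M" "b \<in> carrier N" and qs: "set qs \<subseteq> carrier M \<times> carrier N" "length qs = n"
    using Suc.prems Suc.hyps(2) by auto
  note bl = bilin_tpure
  have fnl: "\<Phi> \<subseteq> functionals M" "\<Psi> \<subseteq> functionals N"
    using \<Phi> \<Psi> by (auto simp: separating_def)
  show ?case
  proof (cases "a = \<zero>\<^bsub>M\<^esub>")
    case True
    have "tpure M N a b = \<zero>\<^bsub>T\<^esub>"
      using tpure_zero_left[OF ab(2)] True by simp
    moreover have "tsum qs = \<zero>\<^bsub>T\<^esub>"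
    proof (rule Suc.hyps(1))
      fix \<phi> \<psi> assume "\<phi> \<in> \<Phi>" "\<psi> \<in> \<Psi>"
      then show "sum_list (map (\<lambda>(x, y). \<phi> x * \<psi> y) qs) = 0"
        using Suc.prems(2)[of \<phi> \<psi>] fnl M.functionals_zero[of \<phi>] by (auto simp: ps True)
    qed (use qs in auto)
    ultimately show ?thesis by (simp add: ps)
  next
    case False
    then obtain \<phi>0 where \<phi>0: "\<phi>0 \<in> \<Phi>" "\<phi>0 a = 1"
      using \<Phi> ab by (auto simp: separating_def)
    \<comment> \<open>After the elimination \<open>a\<close> is paired with b + w.\<close>
    define w where "w = lsum N (\<lambda>(x, y). N.scale (\<phi>0 x) y) qs"
    have wc: "w \<in> carrier N"
      unfolding w_def using qs by (intro N.lsum_closed) auto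
    have \<psi>w: "\<psi> w = sum_list (map (\<lambda>(x, y). \<phi>0 x * \<psi> y) qs)" if "\<psi> \<in> \<Psi>" for \<psi>
    proof -
      have "\<psi> w = sum_list (map (\<lambda>p. \<psi> ((\<lambda>(x, y). N.scale (\<phi>0 x) y) p)) qs)"
        unfolding w_def using qs that fnl by (intro N.functionals_lsum) auto
      also have "map (\<lambda>p. \<psi> ((\<lambda>(x, y). N.scale (\<phi>0 x) y) p)) qs = map (\<lambda>(x, y). \<phi>0 x * \<psi> y) qs"
        using qs that fnl by (auto intro!: N.functionals_scale)
      finally show ?thesis .
    qed
    \<comment> \<open>Because \<phi>0 takes the value 1 at \<open>a\<close>, the hypothesis for
      \<phi>0 and \<psi> reads \<psi>(b) + \<psi>(w) = 0. So no member of the separating family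
      \<Psi> detects b + w.\<close>
    have "b \<oplus>\<^bsub>N\<^esub> w = \<zero>\<^bsub>N\<^esub>"
    proof (rule ccontr)
      assume "b \<oplus>\<^bsub>N\<^esub> w \<noteq> \<zero>\<^bsub>N\<^esub>"
      then obtain \<psi> where \<psi>: "\<psi> \<in> \<Psi>" "\<psi> (b \<oplus>\<^bsub>N\<^esub> w) = 1"
        using \<Psi> ab wc by (auto simp: separating_def)
      have "\<psi> (b \<oplus>\<^bsub>N\<^esub> w) = \<psi> b + \<psi> w"
        using \<psi> fnl ab wc by (intro functionals_add) auto
      also have "\<dots> = 0"
        using Suc.prems(2)[OF \<phi>0(1) \<psi>(1)] \<phi>0(2) \<psi>w[OF \<psi>(1)] by (simp add: ps)
      finally show False using \<psi>(2) by simp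
    qed
    define qs' where "qs' = map (\<lambda>(x, y). (x \<ominus>\<^bsub>M\<^esub> M.scale (\<phi>0 x) a, y)) qs"
    have qs': "set qs' \<subseteq> carrier M \<times> carrier N" "length qs' = n"
      using qs ab by (auto simp: qs'_def)
    \<comment> \<open>The shorter list inherits the hypothesis: its sum is the one over
      \<open>qs\<close> minus \<phi>(a) \<psi>(w), and \<psi>(w) = -\<psi>(b) restores the original
      sum over \<open>ps\<close>, which vanishes.\<close>
    have "tsum qs' = \<zero>\<^bsub>T\<^esub>"
    proof (rule Suc.hyps(1))
      fix \<phi> \<psi> assume \<phi>: "\<phi> \<in> \<Phi>" and \<psi>: "\<psi> \<in> \<Psi>"
      have diff: "\<phi> (x \<ominus>\<^bsub>M\<^esub> M.scale (\<phi>0 x) a) = \<phi> x - \<phi>0 x * \<phi> a" if "x \<in> carrier M" for x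
        using that ab \<phi> fnl
        by (simp add: M.minus_eq functionals_add M.functionals_minus M.functionals_scale subset_iff)
      have "\<phi> (x \<ominus>\<^bsub>M\<^esub> M.scale (\<phi>0 x) a) * \<psi> y = \<phi> x * \<psi> y - \<phi> a * (\<phi>0 x * \<psi> y)"
        if "x \<in> carrier M" for x y
        unfolding diff[OF that] by (simp add: algebra_simps)
      then have "sum_list (map (\<lambda>(x, y). \<phi> x * \<psi> y) qs')
          = sum_list (map (\<lambda>(x, y). \<phi> x * \<psi> y - \<phi> a * (\<phi>0 x * \<psi> y)) qs)"
        unfolding qs'_def using qs by (intro arg_cong[where f = sum_list]) auto
      also have "\<dots> = sum_list (map (\<lambda>(x, y). \<phi> x * \<psi> y) qs) - \<phi> a * \<psi> w"
        unfolding \<psi>w[OF \<psi>] by (induction qs) (auto simp: algebra_simps)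
      also have "\<psi> w = - \<psi> b"
        using Suc.prems(2)[OF \<phi>0(1) \<psi>] \<phi>0(2) \<psi>w[OF \<psi>] by (simp add: ps eq_neg_iff_add_eq_0 add.commute)
      also have "sum_list (map (\<lambda>(x, y). \<phi> x * \<psi> y) qs) - \<phi> a * - \<psi> b = 0"
        using Suc.prems(2)[OF \<phi> \<psi>] by (simp add: ps add.commute)
      finally show "sum_list (map (\<lambda>(x, y). \<phi> x * \<psi> y) qs') = 0" .
    qed (use qs' in auto)
    moreover have "tsum qs = tsum qs' \<oplus>\<^bsub>T\<^esub> tpure M N a w"
      unfolding qs'_def w_def by (rule tsum_eliminate[OF ab(1) qs(1)])
    moreover have "tpure M N a b \<oplus>\<^bsub>T\<^esub> tpure M N a w = \<zero>\<^bsub>T\<^esub>"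
      using bilinD(3)[OF bl ab wc] \<open>b \<oplus>\<^bsub>N\<^esub> w = \<zero>\<^bsub>N\<^esub>\<close> tpure_zero_right[OF ab(1)] by simp
    ultimately show ?thesis
      using bilinD(1)[OF bl ab(1)] ab wc by (simp add: ps)
  qed
qed

end

section \<open>The coproduct\<close>

context group
begin

lemma normal_closure_normal:
  assumes "S \<subseteq> carrier G"
  shows "normal_closure G S \<lhd> G"
proof (rule normal_invI)
  show "subgroup (normal_closure G S) G"
    unfolding normal_closure_def
  proof (rule subgroups_Inter)
    show "subgroup N G" if "N \<in> {N. N \<lhd> G \<and> S \<subseteq> N}" for N
      using that normal_imp_subgroup by auto
    show "{N. N \<lhd> G \<and> S \<subseteq> N} \<noteq> {}"
      using normal_self assms by blast
  qed
  fix x h assume "x \<in> carrier G" "h \<in> normal_closure G S"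
  then show "x \<otimes> h \<otimes> inv x \<in> normal_closure G S"
    using normal.inv_op_closed2 unfolding normal_closure_def by fastforce
qed

lemma normal_closure_incl: "S \<subseteq> normal_closure G S"
  unfolding normal_closure_def by blast

lemma normal_closure_minimal: "N \<lhd> G \<Longrightarrow> S \<subseteq> N \<Longrightarrow> normal_closure G S \<subseteq> N"
  unfolding normal_closure_def by blast

end

locale two_groups = G: group G + H: group H
  for G :: "('a, 'c) monoid_scheme" and H :: "('b, 'd) monoid_scheme"
begin

abbreviation "FP \<equiv> free_prod G H"
abbreviation "N \<equiv> cubes_closure G H"
abbreviation "P \<equiv> coprod3 G H"
abbreviation "\<iota> \<equiv> coprod3_inl G H"
abbreviation "\<kappa> \<equiv> coprod3_inr G H"
abbreviation "eqv \<equiv> free_prod_eq G H"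
abbreviation "cl \<equiv> free_prod_class G H"
definition W :: "('a + 'b) list set"
  where "W = lists (carrier G <+> carrier H)"

lemma W_simps [simp]:
  "[] \<in> W" "Inl x # w \<in> W \<longleftrightarrow> x \<in> carrier G \<and> w \<in> W" "Inr y # w \<in> W \<longleftrightarrow> y \<in> carrier H \<and> w \<in> W"
  "u @ v \<in> W \<longleftrightarrow> u \<in> W \<and> v \<in> W"
  by (auto simp: W_def)

lemma W_Cons: "l # w \<in> W \<longleftrightarrow> l \<in> carrier G <+> carrier H \<and> w \<in> W"
  by (auto simp: W_def)

lemma eqv_refl: "w \<in> W \<Longrightarrow> free_prod_eq G H w w"
  by (auto simp: W_def intro: free_prod_eq.refl)

lemma eqv_lists: "eqv u v \<Longrightarrow> u \<in> W \<and> v \<in> W"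
  by (induction rule: free_prod_eq.induct) (auto simp: W_def)

lemma class_eq: "u \<in> W \<Longrightarrow> eqv u v \<Longrightarrow> cl u = cl v"
  unfolding free_prod_class_def by (auto intro: free_prod_eq.trans free_prod_eq.sym)

lemma class_self: "u \<in> W \<Longrightarrow> u \<in> cl u"
  unfolding free_prod_class_def by (auto intro: eqv_refl)

lemma mem_class: "v \<in> cl u \<Longrightarrow> eqv u v"
  by (simp add: free_prod_class_def)

lemma carrier_free_prod: "carrier FP = cl ` W"
  by (simp add: free_prod_def W_def)

lemma one_free_prod: "\<one>\<^bsub>FP\<^esub> = cl []"
  by (simp add: free_prod_def)

lemma mult_free_prod:
  assumes "u \<in> W" "v \<in> W"
  shows "cl u \<otimes>\<^bsub>FP\<^esub> cl v = cl (u @ v)"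
proof -
  have "cl (u' @ v') = cl (u @ v)" if "u' \<in> cl u" "v' \<in> cl v" for u' v'
  proof -
    have "eqv (u @ v) (u' @ v')"
      using that mem_class free_prod_eq.append by blast
    then show ?thesis using class_eq[of "u @ v"] assms by simp
  qed
  then have "(\<Union>u'\<in>cl u. \<Union>v'\<in>cl v. cl (u' @ v')) = cl (u @ v)"
    using class_self assms by blast
  then show ?thesis by (simp add: free_prod_def)
qed

fun inv_letter :: "'a + 'b \<Rightarrow> 'a + 'b"
  where "inv_letter (Inl x) = Inl (inv\<^bsub>G\<^esub> x)" | "inv_letter (Inr y) = Inr (inv\<^bsub>H\<^esub> y)"

lemma inv_letter_closed: "l \<in> carrier G <+> carrier H \<Longrightarrow> inv_letter l \<in> carrier G <+> carrier H"
  by (cases l) auto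

lemma inv_word_closed: "w \<in> W \<Longrightarrow> rev (map inv_letter w) \<in> W"
  using inv_letter_closed unfolding W_def in_lists_conv_set by auto

lemma inv_letter_cancel: "l \<in> carrier G <+> carrier H \<Longrightarrow> eqv [inv_letter l, l] []"
proof (cases l)
  case (Inl x)
  moreover assume "l \<in> carrier G <+> carrier H"
  ultimately have "eqv [inv_letter l, l] [Inl \<one>\<^bsub>G\<^esub>]"
    using free_prod_eq.mult_left[of "inv\<^bsub>G\<^esub> x" G x H] by auto
  then show ?thesis using free_prod_eq.one_left free_prod_eq.trans by blast
next
  case (Inr y)
  moreover assume "l \<in> carrier G <+> carrier H"
  ultimately have "eqv [inv_letter l, l] [Inr \<one>\<^bsub>H\<^esub>]"
    using free_prod_eq.mult_right[of "inv\<^bsub>H\<^esub> y" H y G] by auto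
  then show ?thesis using free_prod_eq.one_right free_prod_eq.trans by blast
qed

lemma inv_word: "w \<in> W \<Longrightarrow> eqv (rev (map inv_letter w) @ w) []"
proof (induction w)
  case Nil
  then show ?case by (auto intro: eqv_refl)
next
  case (Cons l w)
  let ?r = "rev (map inv_letter w)"
  have l: "l \<in> carrier G <+> carrier H" and w: "w \<in> W" using Cons.prems by (auto simp: W_Cons)
  have r: "?r \<in> W" using w by (rule inv_word_closed)
  have "eqv (?r @ ([inv_letter l, l] @ w)) (?r @ ([] @ w))"
    using r w inv_letter_cancel[OF l]
    by (intro free_prod_eq.append eqv_refl)
  then show ?case
    using Cons.IH w free_prod_eq.trans by fastforce
qed

lemma group_free_prod: "group FP"
proof (rule groupI)
  fix X assume "X \<in> carrier FP"
  then obtain w where w: "w \<in> W" "X = cl w" by (auto simp: carrier_free_prod)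
  have r: "rev (map inv_letter w) \<in> W" using w inv_word_closed by auto
  then have "cl (rev (map inv_letter w)) \<otimes>\<^bsub>FP\<^esub> X = \<one>\<^bsub>FP\<^esub>"
    using w inv_word[OF w(1)] class_eq by (simp add: mult_free_prod one_free_prod)
  then show "\<exists>Y\<in>carrier FP. Y \<otimes>\<^bsub>FP\<^esub> X = \<one>\<^bsub>FP\<^esub>"
    using r carrier_free_prod by blast
qed (auto simp: carrier_free_prod mult_free_prod one_free_prod)

lemma cubes_closure_normal: "N \<lhd> FP"
proof -
  interpret P: group FP by (rule group_free_prod)
  show ?thesis
    unfolding cubes_closure_def by (rule P.normal_closure_normal) auto
qed

lemma exponent3_coprod3: "exponent3 P"
proof -
  interpret F: group FP by (rule group_free_prod)
  interpret N: normal N FP by (rule cubes_closure_normal)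
  interpret P: group P
    unfolding coprod3_def by (rule N.factorgroup_is_group)
  show ?thesis
  proof
    fix X assume "X \<in> carrier P"
    then obtain x where x: "x \<in> carrier FP" "X = N #>\<^bsub>FP\<^esub> x"
      by (auto simp: coprod3_def carrier_FactGroup)
    have "x [^]\<^bsub>FP\<^esub> (3::nat) \<in> N"
      unfolding cubes_closure_def by (rule subsetD[OF F.normal_closure_incl imageI[OF x(1)]])
    then have "x \<otimes>\<^bsub>FP\<^esub> x \<otimes>\<^bsub>FP\<^esub> x \<in> N"
      using x by (simp add: numeral_3_eq_3)
    then show "X \<otimes>\<^bsub>P\<^esub> X \<otimes>\<^bsub>P\<^esub> X = \<one>\<^bsub>P\<^esub>"
      using x by (simp add: coprod3_def N.rcos_sum F.coset_join2[OF _ N.subgroup_axioms])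
  qed
qed

lemma coset_hom: "(\<lambda>x. N #>\<^bsub>FP\<^esub> x) \<in> hom FP P"
  unfolding coprod3_def using normal.r_coset_hom_Mod[OF cubes_closure_normal] .

lemma letter_hom:
  "(\<lambda>x. cl [Inl x]) \<in> hom G FP" "(\<lambda>y. cl [Inr y]) \<in> hom H FP"
  by (rule homI; auto simp: carrier_free_prod mult_free_prod intro!: class_eq[symmetric] free_prod_eq.mult_left free_prod_eq.mult_right)+

lemma inl_hom: "\<iota> \<in> hom G P"
  using hom_compose[OF letter_hom(1) coset_hom] by (simp add: comp_def coprod3_inl_def[abs_def])

lemma inr_hom: "\<kappa> \<in> hom H P"
  using hom_compose[OF letter_hom(2) coset_hom] by (simp add: comp_def coprod3_inr_def[abs_def])

lemma coprod3_generated: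
  assumes S: "subgroup S P"
    and "\<And>x. x \<in> carrier G \<Longrightarrow> \<iota> x \<in> S" "\<And>y. y \<in> carrier H \<Longrightarrow> \<kappa> y \<in> S"
  shows "carrier P \<subseteq> S"
proof -
  interpret S: subgroup S P by fact
  interpret F: group FP by (rule group_free_prod)
  interpret P: exponent3 P by (rule exponent3_coprod3)
  interpret q: group_hom FP P "\<lambda>x. N #>\<^bsub>FP\<^esub> x"
    using coset_hom by unfold_locales
  have "N #>\<^bsub>FP\<^esub> cl w \<in> S" if "w \<in> W" for w
    using that
  proof (induction w)
    case Nil
    then show ?case using q.hom_one S.one_closed by (simp add: one_free_prod)
  next
    case (Cons l w)
    have "cl (l # w) = cl [l] \<otimes>\<^bsub>FP\<^esub> cl w"
      using Cons.prems by (subst mult_free_prod) (auto simp: W_Cons)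
    moreover have "cl [l] \<in> carrier FP" "cl w \<in> carrier FP"
      using Cons.prems by (auto simp: carrier_free_prod W_Cons)
    moreover have "N #>\<^bsub>FP\<^esub> cl [l] \<in> S"
      using Cons.prems assms(2,3) by (cases l) (auto simp: coprod3_inl_def coprod3_inr_def)
    ultimately show ?case
      using Cons by (simp add: q.hom_mult W_Cons)
  qed
  then show ?thesis
    by (auto simp: coprod3_def carrier_FactGroup carrier_free_prod)
qed

text \<open>Words are evaluated letter by letter in \<open>K\<close>; the evaluation respects the
  congruence of the free product. Cubes evaluate to 1 because \<open>K\<close> has exponent 3, so
  their normal closure lies in the kernel.\<close>

lemma coprod3_universal:
  fixes K :: "('e, 'f) monoid_scheme"
  assumes "exponent3 K" "u \<in> hom G K" "v \<in> hom H K"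
  shows "\<exists>\<theta>\<in>hom P K. (\<forall>x\<in>carrier G. \<theta> (\<iota> x) = u x) \<and> (\<forall>y\<in>carrier H. \<theta> (\<kappa> y) = v y)"
proof -
  interpret K: exponent3 K by fact
  interpret u: group_hom G K u using assms by unfold_locales
  interpret v: group_hom H K v using assms by unfold_locales
  interpret F: group FP by (rule group_free_prod)
  define ev where "ev w = foldr (\<lambda>l s. (case l of Inl x \<Rightarrow> u x | Inr y \<Rightarrow> v y) \<otimes>\<^bsub>K\<^esub> s) w \<one>\<^bsub>K\<^esub>" for w
  have ev_simps [simp]: "ev [] = \<one>\<^bsub>K\<^esub>" "ev (Inl x # w) = u x \<otimes>\<^bsub>K\<^esub> ev w" "ev (Inr y # w) = v y \<otimes>\<^bsub>K\<^esub> ev w"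
    for x y w by (simp_all add: ev_def)
  have ev_closed [simp]: "ev w \<in> carrier K" if "w \<in> W" for w
    using that
  proof (induction w)
    case (Cons l w)
    then show ?case by (cases l) auto
  qed simp
  have ev_append: "ev (w @ w') = ev w \<otimes>\<^bsub>K\<^esub> ev w'" if "w \<in> W" "w' \<in> W" for w w'
    using that
  proof (induction w)
    case (Cons l w)
    then show ?case by (cases l) (auto simp: K.m_assoc)
  qed simp
  have ev_eqv: "ev w = ev w'" if "eqv w w'" for w w'
    using that
  proof (induction rule: free_prod_eq.induct)
    case (append w1 w2 w3 w4)
    then show ?case using eqv_lists ev_append by metis
  qed (auto simp: K.m_assoc)
  \<comment> \<open>An arbitrary word of the class is evaluated; \<open>ev_eqv\<close> makes the
    choice immaterial.\<close>
  define h where "h X = ev (SOME w. w \<in> X)" for X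
  have h: "h (cl w) = ev w" if "w \<in> W" for w
  proof -
    have "(SOME w'. w' \<in> cl w) \<in> cl w" using class_self[OF that] by (rule someI)
    then show ?thesis using ev_eqv mem_class unfolding h_def by metis
  qed
  interpret h: group_hom FP K h
    by unfold_locales (auto intro!: homI simp: carrier_free_prod h mult_free_prod ev_append)
  have "N \<subseteq> kernel FP K h"
    unfolding cubes_closure_def
  proof (rule F.normal_closure_minimal[OF h.normal_kernel])
    have "h (x [^]\<^bsub>FP\<^esub> (3::nat)) = \<one>\<^bsub>K\<^esub>" if "x \<in> carrier FP" for x
      using that K.cube[of "h x"] by (simp add: numeral_3_eq_3)
    then show "(\<lambda>x. x [^]\<^bsub>FP\<^esub> (3::nat)) ` carrier FP \<subseteq> kernel FP K h"
      by (auto simp: kernel_def)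
  qed
  then have ker: "h n = \<one>\<^bsub>K\<^esub>" if "n \<in> N" for n
    using that by (auto simp: kernel_def)
  obtain \<theta> where \<theta>: "\<theta> \<in> hom P K"
    "\<And>x. x \<in> carrier FP \<Longrightarrow> \<theta> (N #>\<^bsub>FP\<^esub> x) = h x"
  proof (rule FactGroup_universal[OF h.homh cubes_closure_normal])
    fix x y
    assume xy: "x \<in> carrier FP" "y \<in> carrier FP"
      "N #>\<^bsub>FP\<^esub> x = N #>\<^bsub>FP\<^esub> y"
    then have "x \<in> N #>\<^bsub>FP\<^esub> y"
      using F.rcos_self normal_imp_subgroup[OF cubes_closure_normal] by blast
    then obtain n where n: "n \<in> N" "x = n \<otimes>\<^bsub>FP\<^esub> y"
      by (auto simp: r_coset_def)
    moreover have "n \<in> carrier FP"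
      using n normal_imp_subgroup[OF cubes_closure_normal] subgroup.mem_carrier by metis
    ultimately show "h x = h y" using xy ker by simp
  qed (auto simp: coprod3_def)
  show ?thesis
  proof (intro bexI[OF _ \<theta>(1)] conjI ballI)
    show "\<theta> (\<iota> x) = u x" if "x \<in> carrier G" for x
      using that \<theta>(2)[of "cl [Inl x]"] h[of "[Inl x]"] by (simp add: coprod3_inl_def carrier_free_prod)
    show "\<theta> (\<kappa> y) = v y" if "y \<in> carrier H" for y
      using that \<theta>(2)[of "cl [Inr y]"] h[of "[Inr y]"] by (simp add: coprod3_inr_def carrier_free_prod)
  qed
qed

end

section \<open>Test groups of exponent 3\<close>

text \<open>Homomorphisms preserve the lower central series, so a coordinate \<epsilon> of a test
  group can be pulled back to a graded piece. Additivity is asked only on \<open>lcs K n\<close>,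
  since the coordinates used later are not additive on the whole group.\<close>

lemma functional_of_hom:
  assumes "exponent3 G" "exponent3 K" and \<theta>: "\<theta> \<in> hom G K"
    and add: "\<And>x y. x \<in> lcs K n \<Longrightarrow> y \<in> lcs K n \<Longrightarrow> \<epsilon> (x \<otimes>\<^bsub>K\<^esub> y) = \<epsilon> x + (\<epsilon> y :: 3)"
    and zero: "\<And>x. x \<in> lcs K (n + 1) \<Longrightarrow> \<epsilon> x = 0"
  obtains l where "l \<in> functionals (gr G n)" "\<And>x. x \<in> lcs G n \<Longrightarrow> l (gcls G n x) = \<epsilon> (\<theta> x)"
proof -
  interpret G: exponent3 G by fact
  interpret K: exponent3 K by fact
  interpret t: group_hom G K \<theta> using \<theta> by unfold_locales
  define l where "l X = \<epsilon> (\<theta> (SOME x. x \<in> X))" for X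
  have l: "l (gcls G n x) = \<epsilon> (\<theta> x)" if x: "x \<in> lcs G n" for x
  proof -
    have xc: "x \<in> carrier G" using x by (rule G.lcs_carrier)
    define y where "y = (SOME y. y \<in> gcls G n x)"
    have "y \<in> gcls G n x"
      unfolding y_def using G.gcls_self[OF xc] by (rule someI)
    then obtain h where h: "h \<in> lcs G (n + 1)" "y = h \<otimes>\<^bsub>G\<^esub> x"
      by (auto simp: gcls_def r_coset_def)
    have "h \<in> lcs G n" using h(1) G.lcs_Suc_subset by auto
    then have "\<epsilon> (\<theta> y) = \<epsilon> (\<theta> h) + \<epsilon> (\<theta> x)"
      using h(2) xc x G.lcs_carrier add[OF t.hom_lcs t.hom_lcs] by simp
    also have "\<epsilon> (\<theta> h) = 0"
      using zero t.hom_lcs[OF h(1)] by simp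
    finally show ?thesis by (simp add: l_def y_def)
  qed
  have "l \<in> functionals (gr G n)"
    unfolding functionals_def
    by (auto elim!: G.gr_cases simp: G.gcls_add l G.lcs_mult add t.hom_lcs)
  then show ?thesis using that l by blast
qed

lemma (in group) comm_eqI:
  assumes "a \<in> carrier G" "b \<in> carrier G" "k \<in> carrier G" "a \<otimes> b = k \<otimes> (b \<otimes> a)"
  shows "comm G a b = k"
proof -
  have "comm G a b = (a \<otimes> b) \<otimes> inv (b \<otimes> a)"
    using assms by (simp add: comm_def inv_mult_group m_assoc)
  then show ?thesis using assms by (simp add: m_assoc)
qed

lemma (in group) comm_mult_swap:
  "a \<in> carrier G \<Longrightarrow> b \<in> carrier G \<Longrightarrow> a \<otimes> b = comm G a b \<otimes> (b \<otimes> a)"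
  by (simp add: comm_def m_assoc)

text \<open>The upper unitriangular 3 by 3 matrices over the field of three elements, with
  \<open>a\<close>, \<open>b\<close> above the diagonal and \<open>c\<close> in the corner.\<close>

definition heis :: "(3 \<times> 3 \<times> 3) monoid"
  where "heis = \<lparr>carrier = UNIV, monoid.mult = (\<lambda>(a, b, c) (a', b', c'). (a + a', b + b', c + c' + a * b')),
    one = (0, 0, 0)\<rparr>"

lemma heis_simps [simp]:
  "carrier heis = UNIV" "(a, b, c) \<otimes>\<^bsub>heis\<^esub> (a', b', c') = (a + a', b + b', c + c' + a * b')"
  "\<one>\<^bsub>heis\<^esub> = (0, 0, 0)"
  by (simp_all add: heis_def)

text \<open>The corner entry of the cube of (a, b, c) is 3c + 3ab, and the other two entries are 3a
  and 3b.\<close>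

lemma exponent3_heis: "exponent3 heis"
proof -
  interpret group heis
  proof (rule groupI)
    fix x :: "3 \<times> 3 \<times> 3"
    obtain a b c where "x = (a, b, c)" by (cases x)
    then have "(- a, - b, - c + a * b) \<otimes>\<^bsub>heis\<^esub> x = \<one>\<^bsub>heis\<^esub>" by simp
    then show "\<exists>y\<in>carrier heis. y \<otimes>\<^bsub>heis\<^esub> x = \<one>\<^bsub>heis\<^esub>" by auto
  qed (auto simp: algebra_simps)
  show ?thesis
  proof
    fix x :: "3 \<times> 3 \<times> 3"
    obtain a b c where "x = (a, b, c)" by (cases x)
    then show "x \<otimes>\<^bsub>heis\<^esub> x \<otimes>\<^bsub>heis\<^esub> x = \<one>\<^bsub>heis\<^esub>"
      by (simp add: algebra_simps Z3_mult_three)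
  qed
qed

interpretation heis: exponent3 heis by (rule exponent3_heis)

lemma comm_heis: "comm heis (a, b, c) (a', b', c') = (0, 0, a * b' - a' * b)"
  by (rule heis.comm_eqI) (simp_all add: algebra_simps)

lemma lcs_heis_2: "x \<in> lcs heis 2 \<Longrightarrow> \<exists>c. x = (0, 0, c)"
proof -
  have inv: "inv\<^bsub>heis\<^esub> (0, 0, c) = (0, 0, - c)" for c
    by (rule heis.inv_equality) auto
  have "subgroup {(0, 0, c) | c. True} heis"
    by (rule heis.subgroupI) (auto simp: inv)
  moreover have "{comm heis a b | a b. a \<in> lcs heis 1 \<and> b \<in> carrier heis} \<subseteq> {(0, 0, c) | c. True}"
    by (auto simp: comm_heis)
  ultimately have "lcs heis 2 \<subseteq> {(0, 0, c) | c. True}"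
    using heis.generate_subgroup_incl by (simp add: numeral_2_eq_2)
  then show "x \<in> lcs heis 2 \<Longrightarrow> \<exists>c. x = (0, 0, c)" by blast
qed

lemma lcs_heis_3: "x \<in> lcs heis 3 \<Longrightarrow> x = (0, 0, 0)"
proof -
  have "{comm heis a b | a b. a \<in> lcs heis 2 \<and> b \<in> carrier heis} \<subseteq> {\<one>\<^bsub>heis\<^esub>}"
    by (auto simp: comm_heis dest: lcs_heis_2)
  then have "lcs heis 3 \<subseteq> {\<one>\<^bsub>heis\<^esub>}"
    using heis.generate_subgroup_incl[OF _ heis.triv_subgroup] heis.lcs_Suc[of 2] by simp
  then show "x \<in> lcs heis 3 \<Longrightarrow> x = (0, 0, 0)" by auto
qed

lemma degree_2_functional:
  assumes "exponent3 P" "\<theta> \<in> hom P heis"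
  obtains l where "l \<in> functionals (gr P 2)" "\<And>p. p \<in> lcs P 2 \<Longrightarrow> l (gcls P 2 p) = snd (snd (\<theta> p))"
  by (rule functional_of_hom[OF assms(1) exponent3_heis assms(2), of 2 "\<lambda>x. snd (snd x)"])
    (use lcs_heis_2 lcs_heis_3 in \<open>fastforce+\<close>)

text \<open>
  These functions form the largest group of \<open>3\<close>-valued functions on \<open>G\<close> whose semidirect
  product with \<open>G\<close>, acting by translation, has exponent 3.
\<close>
definition engel_fun :: "('a, 'c) monoid_scheme \<Rightarrow> ('a \<Rightarrow> 3) set"
  where "engel_fun G = {m. (\<forall>x. x \<notin> carrier G \<longrightarrow> m x = 0) \<and>
    (\<forall>x\<in>carrier G. \<forall>g\<in>carrier G. m x + m (x \<otimes>\<^bsub>G\<^esub> g) + m (x \<otimes>\<^bsub>G\<^esub> g \<otimes>\<^bsub>G\<^esub> g) = 0)}"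

text \<open>Right translation of the argument makes this a left action: shifting by \<open>h\<close>
  and then by \<open>g\<close> is shifting by the product g h. The value 0 outside the carrier keeps
  the functions determined by their values on the group.\<close>

definition shift :: "('a, 'c) monoid_scheme \<Rightarrow> 'a \<Rightarrow> ('a \<Rightarrow> 3) \<Rightarrow> 'a \<Rightarrow> 3"
  where "shift G g m = (\<lambda>x. if x \<in> carrier G then m (x \<otimes>\<^bsub>G\<^esub> g) else 0)"

definition engel_ext :: "('a, 'c) monoid_scheme \<Rightarrow> (('a \<Rightarrow> 3) \<times> 'a) monoid"
  where "engel_ext G = \<lparr>carrier = engel_fun G \<times> carrier G,
    monoid.mult = (\<lambda>(m, g) (m', g'). (\<lambda>x. m x + shift G g m' x, g \<otimes>\<^bsub>G\<^esub> g')),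
    one = (\<lambda>x. 0, \<one>\<^bsub>G\<^esub>)\<rparr>"

lemma engel_ext_simps [simp]:
  "(m, g) \<in> carrier (engel_ext G) \<longleftrightarrow> m \<in> engel_fun G \<and> g \<in> carrier G"
  "(m, g) \<otimes>\<^bsub>engel_ext G\<^esub> (m', g') = (\<lambda>x. m x + shift G g m' x, g \<otimes>\<^bsub>G\<^esub> g')"
  "\<one>\<^bsub>engel_ext G\<^esub> = (\<lambda>x. 0, \<one>\<^bsub>G\<^esub>)"
  by (simp_all add: engel_ext_def)

section \<open>The semidirect product of a group with its Engel functions\<close>

context exponent3
begin

lemma engel_fun_zero: "(\<lambda>x. 0) \<in> engel_fun G"
  by (simp add: engel_fun_def)

lemma engel_fun_add:
  assumes "m \<in> engel_fun G" "m' \<in> engel_fun G"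
  shows "(\<lambda>x. m x + m' x) \<in> engel_fun G"
proof -
  have eq: "m x + m' x + (m y + m' y) + (m z + m' z) = (m x + m y + m z) + (m' x + m' y + m' z)" for x y z
    by (simp add: algebra_simps)
  show ?thesis using assms unfolding engel_fun_def mem_Collect_eq eq by simp
qed

lemma engel_fun_scale:
  assumes "m \<in> engel_fun G"
  shows "(\<lambda>x. k * m x) \<in> engel_fun G"
proof -
  have eq: "k * m x + k * m y + k * m z = k * (m x + m y + m z)" for x y z
    by (simp add: algebra_simps)
  show ?thesis using assms unfolding engel_fun_def mem_Collect_eq eq by simp
qed

text \<open>Since x h g = (x g)(g^-1 h g), the condition for the translate at x and h is the
  original condition at x g and the conjugate of h.\<close>

lemma engel_fun_shift:
  assumes m: "m \<in> engel_fun G" and g: "g \<in> carrier G"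
  shows "shift G g m \<in> engel_fun G"
proof -
  have "m (x \<otimes> g) + m (x \<otimes> h \<otimes> g) + m (x \<otimes> h \<otimes> h \<otimes> g) = 0"
    if "x \<in> carrier G" "h \<in> carrier G" for x h
  proof -
    let ?h = "inv g \<otimes> h \<otimes> g"
    have "m (x \<otimes> g) + m (x \<otimes> g \<otimes> ?h) + m (x \<otimes> g \<otimes> ?h \<otimes> ?h) = 0"
      using m g that by (simp add: engel_fun_def)
    then show ?thesis using g that by (simp add: m_assoc)
  qed
  then show ?thesis by (simp add: engel_fun_def shift_def)
qed

abbreviation "Q \<equiv> engel_ext G"

lemma exponent3_engel_ext: "exponent3 Q"
proof -
  have out: "m x = 0" if "m \<in> engel_fun G" "x \<notin> carrier G" for m x
    using that by (simp add: engel_fun_def)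
  interpret E: group Q
  proof (rule groupI)
    fix X assume X: "X \<in> carrier Q"
    obtain m g where mg: "X = (m, g)" by (cases X)
    let ?Y = "(\<lambda>x. (- 1) * shift G (inv g) m x, inv g)"
    have "?Y \<in> carrier Q"
      using X mg engel_fun_scale[OF engel_fun_shift, of m "inv g" "- 1"] by simp
    moreover have "?Y \<otimes>\<^bsub>Q\<^esub> X = \<one>\<^bsub>Q\<^esub>"
      using X mg by (auto simp: fun_eq_iff shift_def)
    ultimately show "\<exists>Y\<in>carrier Q. Y \<otimes>\<^bsub>Q\<^esub> X = \<one>\<^bsub>Q\<^esub>" by blast
  next
    fix X assume X: "X \<in> carrier Q"
    then show "\<one>\<^bsub>Q\<^esub> \<otimes>\<^bsub>Q\<^esub> X = X"
      using out by (cases X) (auto simp: fun_eq_iff shift_def)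
  next
    fix X Y Z assume "X \<in> carrier Q" "Y \<in> carrier Q" "Z \<in> carrier Q"
    then show "X \<otimes>\<^bsub>Q\<^esub> Y \<otimes>\<^bsub>Q\<^esub> Z = X \<otimes>\<^bsub>Q\<^esub> (Y \<otimes>\<^bsub>Q\<^esub> Z)"
      by (cases X; cases Y; cases Z) (auto simp: fun_eq_iff shift_def m_assoc)
  next
    fix X Y assume "X \<in> carrier Q" "Y \<in> carrier Q"
    then show "X \<otimes>\<^bsub>Q\<^esub> Y \<in> carrier Q"
      by (cases X; cases Y) (auto intro: engel_fun_add engel_fun_shift)
  qed (simp add: engel_fun_zero)
  show ?thesis
  proof
    fix X assume X: "X \<in> carrier Q"
    obtain m g where mg: "X = (m, g)" by (cases X)
    then have m: "m \<in> engel_fun G" and g: "g \<in> carrier G" using X by auto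
    \<comment> \<open>This sum is the function part of the cube of (m, g); its vanishing is the
      defining condition of \<open>engel_fun\<close>.\<close>
    have "m x + shift G g m x + shift G (g \<otimes> g) m x = 0" for x
    proof (cases "x \<in> carrier G")
      case True
      then have "m x + m (x \<otimes> g) + m (x \<otimes> g \<otimes> g) = 0"
        using m g by (simp add: engel_fun_def)
      then show ?thesis using True g by (simp add: shift_def m_assoc)
    next
      case False
      then show ?thesis using out[OF m] by (simp add: shift_def)
    qed
    then show "X \<otimes>\<^bsub>Q\<^esub> X \<otimes>\<^bsub>Q\<^esub> X = \<one>\<^bsub>Q\<^esub>"
      using mg cube[OF g] by simp
  qed
qed

text \<open>Elements of the third term are central. Commuting with (0, h) says that \<open>m\<close>
  is invariant under translation by \<open>h\<close>, and evaluation at the identity gives the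
  claim.\<close>

lemma lcs_3_engel_ext:
  assumes "(m, g) \<in> lcs Q 3" "h \<in> carrier G"
  shows "m h = m \<one>"
proof -
  interpret E: exponent3 Q by (rule exponent3_engel_ext)
  have "(\<lambda>x. 0, h) \<in> carrier Q"
    using assms engel_fun_zero by simp
  then have "(m, g) \<otimes>\<^bsub>Q\<^esub> (\<lambda>x. 0, h) = (\<lambda>x. 0, h) \<otimes>\<^bsub>Q\<^esub> (m, g)"
    using E.lcs_3_central[OF assms(1)] by blast
  then have "m x + shift G g (\<lambda>x. 0) x = 0 + shift G h m x" for x
    by (simp add: fun_eq_iff)
  from this[of \<one>] show ?thesis
    using assms(2) by (simp add: shift_def)
qed

text \<open>The product of pairs shifts the second function, so evaluation at the identity is not
  additive in general. On \<open>lcs Q 3\<close> the functions are constant on the group, and there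
  the shift does not change the value.\<close>

lemma engel_ext_functional:
  assumes "exponent3 P" "\<theta> \<in> hom P Q"
  obtains l where "l \<in> functionals (gr P 3)" "\<And>p. p \<in> lcs P 3 \<Longrightarrow> l (gcls P 3 p) = fst (\<theta> p) \<one>"
proof (rule functional_of_hom[OF assms(1) exponent3_engel_ext assms(2), of 3 "\<lambda>x. fst x \<one>"])
  interpret E: exponent3 Q by (rule exponent3_engel_ext)
  show "fst x \<one> = 0" if "x \<in> lcs Q (3 + 1)" for x
    using that E.lcs_trivial[of 4] by simp
  fix x y assume x: "x \<in> lcs Q 3" and y: "y \<in> lcs Q 3"
  then obtain m g m' g' where *: "x = (m, g)" "y = (m', g')" by (cases x, cases y)
  have "g \<in> carrier G" using E.lcs_carrier[OF x] * by simp
  then show "fst (x \<otimes>\<^bsub>Q\<^esub> y) \<one> = fst x \<one> + fst y \<one>"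
    using lcs_3_engel_ext[of m' g' g] y * by (simp add: shift_def)
qed (use that in blast)

text \<open>Commuting a group element with a function yields the difference between the translate
  and the function itself; the normalisation f(1) = 0 removes the second term at the
  identity.\<close>

lemma comm_engel_ext:
  assumes f: "f \<in> engel_fun G" "f \<one> = 0" and c: "c \<in> carrier G"
  shows "fst (comm Q (\<lambda>x. 0, c) (\<lambda>x. k * f x, \<one>)) \<one> = k * f c"
proof -
  interpret E: exponent3 Q by (rule exponent3_engel_ext)
  have kf: "(\<lambda>x. k * f x) \<in> engel_fun G" using engel_fun_scale f by blast
  let ?d = "\<lambda>x. shift G c (\<lambda>x. k * f x) x + (- 1) * (k * f x)"
  have d: "?d \<in> engel_fun G"
    using engel_fun_add[OF engel_fun_shift[OF kf c] engel_fun_scale[OF kf, of "- 1"]] .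
  have out: "f x = 0" if "x \<notin> carrier G" for x
    using that f by (simp add: engel_fun_def)
  have "comm Q (\<lambda>x. 0, c) (\<lambda>x. k * f x, \<one>) = (?d, \<one>)"
    using kf d c engel_fun_zero out
    by (intro E.comm_eqI) (auto simp: fun_eq_iff shift_def)
  then show ?thesis using c f(2) by (simp add: shift_def)
qed

text \<open>
  For a group of exponent 3 and class 2 this is the addition of the Lie ring attached to the group
  by the Baer correspondence: it equals \<open>x y [x, y]\<close>, the exponent \<open>-1/2\<close> of the commutator
  being \<open>1\<close> modulo 3.
\<close>
definition baer :: "'a \<Rightarrow> 'a \<Rightarrow> 'a"
  where "baer x y = inv y \<otimes> x \<otimes> inv y"

lemma baer_closed [simp]: "x \<in> carrier G \<Longrightarrow> y \<in> carrier G \<Longrightarrow> baer x y \<in> carrier G"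
  by (simp add: baer_def)

text \<open>The square of x y^-1 is its inverse y x^-1; multiplying this equation by x^-1 from the
  left gives y^-1 x y^-1 = x^-1 y x^-1.\<close>

lemma baer_commute:
  assumes "x \<in> carrier G" "y \<in> carrier G"
  shows "baer x y = baer y x"
proof -
  have "(x \<otimes> inv y) \<otimes> (x \<otimes> inv y) = y \<otimes> inv x"
    using mult_self[of "x \<otimes> inv y"] assms by (simp add: inv_mult_group)
  then have "inv x \<otimes> ((x \<otimes> inv y) \<otimes> (x \<otimes> inv y)) = inv x \<otimes> (y \<otimes> inv x)" by simp
  then show ?thesis using assms by (simp add: baer_def m_assoc)
qed

lemma baer_one [simp]: "x \<in> carrier G \<Longrightarrow> baer \<one> x = x" "x \<in> carrier G \<Longrightarrow> baer x \<one> = x"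
  using mult_self[of "inv x"] by (auto simp: baer_def)

lemma baer_inv: "x \<in> carrier G \<Longrightarrow> baer (inv x) x = \<one>"
  using cube[of "inv x"] by (simp add: baer_def)

text \<open>The additive shadow is x + (x + g) + (x + 2g) = 0 modulo 3. Concretely, the first two
  terms have Baer sum p = g x^-1, the third is p^-1, and the Baer sum of these is p^3. This identity
  makes Baer-additive functions Engel functions.\<close>

lemma baer_triple:
  assumes "x \<in> carrier G" "g \<in> carrier G"
  shows "baer (baer x (x \<otimes> g)) (x \<otimes> g \<otimes> g) = \<one>"
proof -
  have "baer x (x \<otimes> g) = g \<otimes> inv x"
    using assms baer_commute[of x "x \<otimes> g"] by (simp add: baer_def)
  moreover have "x \<otimes> g \<otimes> g = inv (g \<otimes> inv x)"
    using assms mult_self[of g] by (simp add: m_assoc inv_mult_group)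
  ultimately show ?thesis
    using assms cube[of "g \<otimes> inv x"] by (simp add: baer_def inv_mult_group)
qed

text \<open>The two bracketings are (z^-1 y^-1) x (y^-1 z^-1) and p x p with p = z y^-1 z. The outer
  factors differ from \<open>p\<close> by the central commutator \<open>k\<close> and by its
  inverse, which cancel across \<open>x\<close>.\<close>

lemma baer_assoc:
  assumes central: "\<And>a b c. a \<in> carrier G \<Longrightarrow> b \<in> carrier G \<Longrightarrow> c \<in> carrier G \<Longrightarrow>
      comm G a b \<otimes> c = c \<otimes> comm G a b"
    and x: "x \<in> carrier G" and y: "y \<in> carrier G" and z: "z \<in> carrier G"
  shows "baer (baer x y) z = baer x (baer y z)"
proof -
  define k where "k = comm G z y"
  define p where "p = z \<otimes> inv y \<otimes> z"
  have c: "k \<in> carrier G" "p \<in> carrier G" using y z by (auto simp: k_def p_def)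
  have k: "k \<otimes> a = a \<otimes> k" if "a \<in> carrier G" for a
    using central y z that by (simp add: k_def)
  have "comm G z (inv y) = inv k"
    using y z by (simp add: comm_inv_right k_def)
  then have "z \<otimes> inv y = inv k \<otimes> (inv y \<otimes> z)"
    using comm_mult_swap[of z "inv y"] y z by simp
  then have "p = inv k \<otimes> (inv y \<otimes> (z \<otimes> z))"
    using y z c by (simp add: p_def m_assoc)
  then have yz: "inv y \<otimes> inv z = k \<otimes> p"
    using y z c mult_self[of z] by simp
  have "comm G (inv z) (inv y) = inv (comm G (inv z) y)"
    using y z by (simp add: comm_inv_right)
  also have "\<dots> = comm G y (inv z)"
    using y z by (simp add: inv_commutator)
  also have "\<dots> = k"
    using y z by (simp add: comm_inv_right inv_commutator k_def)
  finally have "inv z \<otimes> inv y = k \<otimes> (inv y \<otimes> inv z)"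
    using comm_mult_swap[of "inv z" "inv y"] y z by simp
  then have zy: "inv z \<otimes> inv y = inv k \<otimes> p"
    unfolding yz using c mult_self[of k] by (simp flip: m_assoc)
  have "baer (baer x y) z = (inv z \<otimes> inv y) \<otimes> x \<otimes> (inv y \<otimes> inv z)"
    using x y z by (simp add: baer_def m_assoc)
  also have "\<dots> = inv k \<otimes> p \<otimes> x \<otimes> (k \<otimes> p)"
    by (simp only: yz zy)
  also have "\<dots> = inv k \<otimes> (p \<otimes> x \<otimes> k) \<otimes> p"
    using c x by (simp add: m_assoc)
  also have "p \<otimes> x \<otimes> k = k \<otimes> (p \<otimes> x)"
    using k c x by simp
  also have "inv k \<otimes> (k \<otimes> (p \<otimes> x)) \<otimes> p = baer x (baer y z)"
    using c x y z by (simp add: baer_def p_def inv_mult_group m_assoc)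
  finally show ?thesis .
qed

lemma comm_group_baer:
  assumes "\<And>a b c. a \<in> carrier G \<Longrightarrow> b \<in> carrier G \<Longrightarrow> c \<in> carrier G \<Longrightarrow>
      comm G a b \<otimes> c = c \<otimes> comm G a b"
  shows "comm_group \<lparr>carrier = carrier G, monoid.mult = baer, one = \<one>\<rparr>"
proof (rule comm_groupI)
  fix x assume "x \<in> carrier \<lparr>carrier = carrier G, monoid.mult = baer, one = \<one>\<rparr>"
  then show "\<exists>y\<in>carrier \<lparr>carrier = carrier G, monoid.mult = baer, one = \<one>\<rparr>.
      y \<otimes>\<^bsub>\<lparr>carrier = carrier G, monoid.mult = baer, one = \<one>\<rparr>\<^esub> x
        = \<one>\<^bsub>\<lparr>carrier = carrier G, monoid.mult = baer, one = \<one>\<rparr>\<^esub>"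
    using baer_inv by auto
qed (auto simp: baer_assoc[OF assms] intro: baer_commute)

end

text \<open>The extension \<open>f\<close> to the whole group is what the other factor of the
  coproduct is mapped to inside \<open>engel_ext G\<close>; f(1) = 0 is the normalisation used by
  \<open>comm_engel_ext\<close>.\<close>

definition engel_functionals :: "('a, 'c) monoid_scheme \<Rightarrow> ('a set \<Rightarrow> 3) set"
  where "engel_functionals G = {\<phi> \<in> functionals (gr G 2).
    \<exists>f\<in>engel_fun G. f \<one>\<^bsub>G\<^esub> = 0 \<and> (\<forall>d\<in>lcs G 2. \<phi> (gcls G 2 d) = f d)}"

section \<open>Engel functions from the Baer addition\<close>

context exponent3
begin

lemma id_hom: "(\<lambda>x. x) \<in> hom G G"
  by (rule homI) auto

text \<open>
  A function on \<open>G\<close> that is additive for the Baer addition on \<open>G / lcs G 3\<close> lies in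
  \<open>engel_fun G\<close>.
\<close>
lemma separating_engel_functionals: "separating (gr G 2) (engel_functionals G)"
proof -
  let ?q = "gcls G 2"
  interpret N: normal "lcs G 3" G by (rule lcs_normal)
  \<comment> \<open>The Baer addition is associative only after passing to this class 2 quotient,
    whose projection is \<open>?q\<close> on all of \<open>G\<close>.\<close>
  define H where "H = G Mod lcs G 3"
  have q: "?q \<in> hom G H"
    using N.r_coset_hom_Mod unfolding H_def gcls_def[abs_def] by simp
  interpret H: group H unfolding H_def by (rule N.factorgroup_is_group)
  interpret q: group_hom G H ?q using q by unfold_locales
  have carH: "carrier H = ?q ` carrier G"
    unfolding H_def gcls_def[abs_def] by (auto simp: carrier_FactGroup)
  interpret H: exponent3 H
  proof
    fix X assume "X \<in> carrier H"
    then obtain x where x: "x \<in> carrier G" "X = ?q x" by (auto simp: carH)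
    then have "?q (x \<otimes> x \<otimes> x) = X \<otimes>\<^bsub>H\<^esub> X \<otimes>\<^bsub>H\<^esub> X"
      by (simp del: q.hom_one)
    then show "X \<otimes>\<^bsub>H\<^esub> X \<otimes>\<^bsub>H\<^esub> X = \<one>\<^bsub>H\<^esub>"
      using x by (simp add: cube)
  qed
  \<comment> \<open>\<open>H\<close> has class at most 2, which is the hypothesis of
    \<open>baer_assoc\<close>.\<close>
  have central: "comm H A B \<otimes>\<^bsub>H\<^esub> C = C \<otimes>\<^bsub>H\<^esub> comm H A B"
    if ABC: "A \<in> carrier H" "B \<in> carrier H" "C \<in> carrier H" for A B C
  proof -
    obtain a b c where abc: "a \<in> carrier G" "b \<in> carrier G" "c \<in> carrier G" "A = ?q a" "B = ?q b" "C = ?q c"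
      using ABC by (auto simp: carH)
    have "comm G a b \<in> lcs G 2"
      using comm_in_lcs_Suc(1)[of 1 a b] abc by (simp add: numeral_2_eq_2)
    then have "comm G (comm G a b) c \<in> lcs G 3"
      using comm_in_lcs_Suc(1)[of 2] abc by simp
    moreover have "(comm G a b \<otimes> c) \<otimes> inv (c \<otimes> comm G a b) = comm G (comm G a b) c"
      using abc by (simp add: comm_def[of G "comm G a b"] inv_mult_group m_assoc)
    ultimately have "?q (comm G a b \<otimes> c) = ?q (c \<otimes> comm G a b)"
      using abc by (subst gcls_eq_iff) auto
    then show ?thesis using abc by (simp add: q.hom_comm)
  qed
  let ?L = "\<lparr>carrier = carrier H, monoid.mult = H.baer, one = \<one>\<^bsub>H\<^esub>\<rparr>"
  have L: "comm_group ?L" by (rule H.comm_group_baer) (rule central)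
  have sep: "\<exists>\<phi>\<in>engel_functionals G. \<phi> (?q c) = 1" if c: "c \<in> lcs G 2" "c \<notin> lcs G 3" for c
  proof -
    have cc: "c \<in> carrier G" using c lcs_carrier by blast
    have "\<exists>\<pi> :: 'a set \<Rightarrow> 3. (\<forall>X\<in>carrier H. \<forall>Y\<in>carrier H. \<pi> (H.baer X Y) = \<pi> X + \<pi> Y) \<and> \<pi> (?q c) = 1"
    proof (rule comm_group.exponent3_functional[OF L, of "?q c"])
      fix Y assume "Y \<in> carrier ?L"
      then show "Y \<otimes>\<^bsub>?L\<^esub> Y \<otimes>\<^bsub>?L\<^esub> Y = \<one>\<^bsub>?L\<^esub>"
        using H.baer_triple[of Y "\<one>\<^bsub>H\<^esub>"] by simp
    next
      show "?q c \<in> carrier ?L" using cc by simp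
      have "?q c \<noteq> ?q \<one>"
        using gcls_eq_iff[OF cc one_closed, of 2] c cc by simp
      then show "?q c \<noteq> \<one>\<^bsub>?L\<^esub>" by simp
    next
      fix \<psi> :: "'a set \<Rightarrow> 3"
      assume \<psi>: "\<And>Y Z. Y \<in> carrier ?L \<Longrightarrow> Z \<in> carrier ?L \<Longrightarrow> \<psi> (Y \<otimes>\<^bsub>?L\<^esub> Z) = \<psi> Y + \<psi> Z" "\<psi> (?q c) = 1"
      show ?thesis
        by (rule exI[of _ \<psi>]) (use \<psi>(1)[simplified] \<psi>(2) in simp)
    qed
    then obtain \<pi> :: "'a set \<Rightarrow> 3"
      where \<pi>: "\<And>X Y. X \<in> carrier H \<Longrightarrow> Y \<in> carrier H \<Longrightarrow> \<pi> (H.baer X Y) = \<pi> X + \<pi> Y" "\<pi> (?q c) = 1"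
      by blast
    have \<pi>1: "\<pi> \<one>\<^bsub>H\<^esub> = 0"
      using \<pi>(1)[of "\<one>\<^bsub>H\<^esub>" "\<one>\<^bsub>H\<^esub>"] by simp
    define f where "f x = (if x \<in> carrier G then \<pi> (?q x) else 0)" for x
    \<comment> \<open>Additivity of \<pi> for the Baer addition turns \<open>baer_triple\<close>
      into the Engel condition.\<close>
    have "\<pi> (?q x) + \<pi> (?q (x \<otimes> g)) + \<pi> (?q (x \<otimes> g \<otimes> g)) = 0" if "x \<in> carrier G" "g \<in> carrier G" for x g
    proof -
      have X: "?q x \<in> carrier H" "?q g \<in> carrier H" using that by simp_all
      have "\<pi> (H.baer (H.baer (?q x) (?q x \<otimes>\<^bsub>H\<^esub> ?q g)) (?q x \<otimes>\<^bsub>H\<^esub> ?q g \<otimes>\<^bsub>H\<^esub> ?q g)) = 0"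
        using H.baer_triple[OF X] \<pi>1 by simp
      then show ?thesis using that X \<pi>(1) by simp
    qed
    then have f: "f \<in> engel_fun G"
      by (simp add: engel_fun_def f_def)
    have f1: "f \<one> = 0" using \<pi>1 by (simp add: f_def)
    have add: "f (a \<otimes> b) = f a + f b" if "a \<in> lcs G 2" "b \<in> lcs G 2" for a b
    proof -
      have ab: "a \<in> carrier G" "b \<in> carrier G" using that lcs_carrier by auto
      \<comment> \<open>In the abelian group \<open>lcs G 2\<close> the Baer sum is a b^-2, and b^-2
        = b in exponent 3, so it is the ordinary product.\<close>
      have "inv b \<otimes> a = a \<otimes> inv b" using that lcs_2_commute lcs_inv by blast
      then have "inv b \<otimes> a \<otimes> inv b = a \<otimes> b"
        using ab mult_self[of "inv b"] by (simp add: m_assoc)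
      then have "?q (a \<otimes> b) = H.baer (?q a) (?q b)"
        using ab by (simp add: H.baer_def flip: q.hom_mult q.hom_inv)
      then show ?thesis using ab \<pi>(1) by (simp add: f_def)
    qed
    have zero: "f a = 0" if "a \<in> lcs G (2 + 1)" for a
    proof -
      have "a \<in> carrier G" "?q a = ?q \<one>"
        using that lcs_carrier gcls_eq_iff[of a \<one> 2] by auto
      then show ?thesis using \<pi>1 by (simp add: f_def)
    qed
    \<comment> \<open>Applied to the identity homomorphism with coordinate \<open>f\<close>, which
      thus descends to \<open>gr G 2\<close>.\<close>
    obtain \<phi> where \<phi>: "\<phi> \<in> functionals (gr G 2)" "\<And>x. x \<in> lcs G 2 \<Longrightarrow> \<phi> (?q x) = f x"
      using functional_of_hom[OF exponent3_axioms exponent3_axioms id_hom add zero] by metis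
    have "\<phi> \<in> engel_functionals G"
      using \<phi> f f1 unfolding engel_functionals_def by blast
    moreover have "\<phi> (?q c) = 1"
      using \<phi>(2)[OF c(1)] cc \<pi>(2) by (simp add: f_def)
    ultimately show ?thesis by blast
  qed
  have "\<exists>\<phi>\<in>engel_functionals G. \<phi> X = 1" if X: "X \<in> carrier (gr G 2)" "X \<noteq> \<zero>\<^bsub>gr G 2\<^esub>" for X
  proof -
    obtain x where "x \<in> lcs G 2" "x \<in> carrier G" "X = ?q x"
      using gr_cases[OF X(1)] .
    then show ?thesis using sep[of x] X(2) gcls_eq_zero_iff[of x 2] by simp
  qed
  moreover have "engel_functionals G \<subseteq> functionals (gr G 2)"
    by (auto simp: engel_functionals_def)
  ultimately show ?thesis by (simp add: separating_def)
qed

end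

text \<open>Stated for any \<open>P\<close> with the mapping property of the coproduct into
  \<open>engel_ext G\<close>, so that it can be applied a second time with the two factors
  exchanged.\<close>

lemma engel_pairing:
  fixes G :: "('a, 'c) monoid_scheme" and H :: "('b, 'd) monoid_scheme" and P :: "('e, 'f) monoid_scheme"
  assumes "exponent3 G" "exponent3 H" "exponent3 P"
    and \<iota>: "\<iota> \<in> hom G P" and \<kappa>: "\<kappa> \<in> hom H P"
    and univ: "\<And>u v. u \<in> hom G (engel_ext G) \<Longrightarrow> v \<in> hom H (engel_ext G) \<Longrightarrow>
      \<exists>\<theta>\<in>hom P (engel_ext G). (\<forall>x\<in>carrier G. \<theta> (\<iota> x) = u x) \<and> (\<forall>y\<in>carrier H. \<theta> (\<kappa> y) = v y)"
    and \<phi>: "\<phi> \<in> engel_functionals G" and \<psi>: "\<psi> \<in> functionals (gr H 1)"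
  obtains l where "l \<in> functionals (gr P 3)"
    "\<And>c y. c \<in> lcs G 2 \<Longrightarrow> y \<in> carrier H \<Longrightarrow>
      l (gcls P 3 (comm P (\<iota> c) (\<kappa> y))) = \<phi> (gcls G 2 c) * \<psi> (gcls H 1 y)"
    "\<And>x d. x \<in> carrier G \<Longrightarrow> d \<in> lcs H 2 \<Longrightarrow> l (gcls P 3 (comm P (\<iota> x) (\<kappa> d))) = 0"
proof -
  interpret G: exponent3 G by fact
  interpret H: exponent3 H by fact
  interpret P: exponent3 P by fact
  interpret E: exponent3 "engel_ext G" by (rule G.exponent3_engel_ext)
  interpret \<iota>: group_hom G P \<iota> using \<iota> by unfold_locales
  interpret \<kappa>: group_hom H P \<kappa> using \<kappa> by unfold_locales
  obtain f where f: "f \<in> engel_fun G" "f \<one>\<^bsub>G\<^esub> = 0" "\<And>d. d \<in> lcs G 2 \<Longrightarrow> \<phi> (gcls G 2 d) = f d"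
    using \<phi> by (auto simp: engel_functionals_def)
  have out: "f x = 0" if "x \<notin> carrier G" for x
    using that f by (simp add: engel_fun_def)
  \<comment> \<open>\<open>G\<close> goes to the complement of the semidirect product;
    \<open>H\<close> goes to multiples of \<open>f\<close>, with \<psi> as coefficient, so its image
    is abelian.\<close>
  let ?u = "\<lambda>x. (\<lambda>_. 0 :: 3, x)"
  let ?v = "\<lambda>y. (\<lambda>x. \<psi> (gcls H 1 y) * f x, \<one>\<^bsub>G\<^esub>)"
  have u: "?u \<in> hom G (engel_ext G)"
    by (rule homI) (auto simp: G.engel_fun_zero shift_def fun_eq_iff)
  have v: "?v \<in> hom H (engel_ext G)"
  proof (rule homI)
    show "?v y \<in> carrier (engel_ext G)" if "y \<in> carrier H" for y
      using G.engel_fun_scale f by simp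
    fix y z assume yz: "y \<in> carrier H" "z \<in> carrier H"
    then have "\<psi> (gcls H 1 (y \<otimes>\<^bsub>H\<^esub> z)) = \<psi> (gcls H 1 y) + \<psi> (gcls H 1 z)"
      using functionals_add[OF \<psi>] H.gcls_closed[of _ 1] by (simp flip: H.gcls_add)
    then show "?v (y \<otimes>\<^bsub>H\<^esub> z) = ?v y \<otimes>\<^bsub>engel_ext G\<^esub> ?v z"
      using out by (auto simp: fun_eq_iff shift_def algebra_simps)
  qed
  obtain \<theta> where \<theta>: "\<theta> \<in> hom P (engel_ext G)" "\<And>x. x \<in> carrier G \<Longrightarrow> \<theta> (\<iota> x) = ?u x"
    "\<And>y. y \<in> carrier H \<Longrightarrow> \<theta> (\<kappa> y) = ?v y"
    using univ[OF u v] by blast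
  interpret \<theta>: group_hom P "engel_ext G" \<theta> using \<theta>(1) by unfold_locales
  obtain l where l: "l \<in> functionals (gr P 3)" "\<And>p. p \<in> lcs P 3 \<Longrightarrow> l (gcls P 3 p) = fst (\<theta> p) \<one>\<^bsub>G\<^esub>"
    using G.engel_ext_functional[OF assms(3) \<theta>(1)] by blast
  show ?thesis
  proof (rule that[OF l(1)])
    show "l (gcls P 3 (comm P (\<iota> c) (\<kappa> y))) = \<phi> (gcls G 2 c) * \<psi> (gcls H 1 y)"
      if c: "c \<in> lcs G 2" and y: "y \<in> carrier H" for c y
    proof -
      have cc: "c \<in> carrier G" using G.lcs_carrier[OF c] .
      have "comm P (\<iota> c) (\<kappa> y) \<in> lcs P 3"
        using P.comm_in_lcs_Suc(1)[of 2 "\<iota> c" "\<kappa> y"] \<iota>.hom_lcs[OF c] y by simp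
      then have "l (gcls P 3 (comm P (\<iota> c) (\<kappa> y))) = fst (comm (engel_ext G) (?u c) (?v y)) \<one>\<^bsub>G\<^esub>"
        using l(2) cc y by (simp add: \<theta>.hom_comm \<theta>(2,3))
      then show ?thesis
        using G.comm_engel_ext[OF f(1,2) cc] f(3)[OF c] by simp
    qed
    \<comment> \<open>An element of \<open>lcs H 2\<close> is zero in \<open>gr H 1\<close>, so its
      image is the multiple 0 of \<open>f\<close>. This separates the two tensor summands of degree
      3.\<close>
    show "l (gcls P 3 (comm P (\<iota> x) (\<kappa> d))) = 0" if x: "x \<in> carrier G" and d: "d \<in> lcs H 2" for x d
    proof -
      have dc: "d \<in> carrier H" using H.lcs_carrier[OF d] .
      interpret M: f3space "gr H 1" using H.f3space_gr by simp
      have "gcls H 1 d = \<zero>\<^bsub>gr H 1\<^esub>"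
        using H.gcls_eq_zero_iff[OF dc, of 1] d by (simp add: numeral_2_eq_2)
      then have "\<psi> (gcls H 1 d) = 0"
        using M.functionals_zero[OF \<psi>] by simp
      moreover have "comm P (\<iota> x) (\<kappa> d) \<in> lcs P 3"
        using P.comm_in_lcs_Suc(2)[of 2 "\<kappa> d" "\<iota> x"] \<kappa>.hom_lcs[OF d] x by simp
      ultimately show ?thesis
        using l(2) x dc G.comm_engel_ext[OF f(1,2) x, of 0] by (simp add: \<theta>.hom_comm \<theta>(2,3))
    qed
  qed
qed

lemma heis_pairing:
  fixes G :: "('a, 'c) monoid_scheme" and H :: "('b, 'd) monoid_scheme" and P :: "('e, 'f) monoid_scheme"
  assumes "exponent3 G" "exponent3 H" "exponent3 P"
    and \<iota>: "\<iota> \<in> hom G P" and \<kappa>: "\<kappa> \<in> hom H P"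
    and univ: "\<And>u v. u \<in> hom G heis \<Longrightarrow> v \<in> hom H heis \<Longrightarrow>
      \<exists>\<theta>\<in>hom P heis. (\<forall>x\<in>carrier G. \<theta> (\<iota> x) = u x) \<and> (\<forall>y\<in>carrier H. \<theta> (\<kappa> y) = v y)"
    and \<phi>: "\<phi> \<in> functionals (gr G 1)" and \<psi>: "\<psi> \<in> functionals (gr H 1)"
  obtains l where "l \<in> functionals (gr P 2)"
    "\<And>x y. x \<in> carrier G \<Longrightarrow> y \<in> carrier H \<Longrightarrow>
      l (gcls P 2 (comm P (\<iota> x) (\<kappa> y))) = \<phi> (gcls G 1 x) * \<psi> (gcls H 1 y)"
proof -
  interpret G: exponent3 G by fact
  interpret H: exponent3 H by fact
  interpret P: exponent3 P by fact
  interpret \<iota>: group_hom G P \<iota> using \<iota> by unfold_locales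
  interpret \<kappa>: group_hom H P \<kappa> using \<kappa> by unfold_locales
  \<comment> \<open>The factors go to the two superdiagonal directions, where the commutator has the
    product of the two entries in its corner.\<close>
  let ?u = "\<lambda>x. (\<phi> (gcls G 1 x), 0, 0)" and ?v = "\<lambda>y. (0, \<psi> (gcls H 1 y), 0)"
  have u: "?u \<in> hom G heis"
    using functionals_add[OF \<phi>] G.gcls_closed[of _ 1] by (intro homI) (simp_all flip: G.gcls_add)
  have v: "?v \<in> hom H heis"
    using functionals_add[OF \<psi>] H.gcls_closed[of _ 1] by (intro homI) (simp_all flip: H.gcls_add)
  obtain \<theta> where \<theta>: "\<theta> \<in> hom P heis" "\<And>x. x \<in> carrier G \<Longrightarrow> \<theta> (\<iota> x) = ?u x"
    "\<And>y. y \<in> carrier H \<Longrightarrow> \<theta> (\<kappa> y) = ?v y"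
    using univ[OF u v] by blast
  interpret \<theta>: group_hom P heis \<theta> using \<theta>(1) by unfold_locales
  obtain l where l: "l \<in> functionals (gr P 2)" "\<And>p. p \<in> lcs P 2 \<Longrightarrow> l (gcls P 2 p) = snd (snd (\<theta> p))"
    using degree_2_functional[OF assms(3) \<theta>(1)] by blast
  show ?thesis
  proof (rule that[OF l(1)])
    show "l (gcls P 2 (comm P (\<iota> x) (\<kappa> y))) = \<phi> (gcls G 1 x) * \<psi> (gcls H 1 y)"
      if xy: "x \<in> carrier G" "y \<in> carrier H" for x y
    proof -
      have "comm P (\<iota> x) (\<kappa> y) \<in> lcs P 2"
        using P.comm_in_lcs_Suc(1)[of 1 "\<iota> x" "\<kappa> y"] xy by (simp add: numeral_2_eq_2)
      then show ?thesis
        using l(2) xy by (simp add: \<theta>.hom_comm \<theta>(2,3) comm_heis)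
    qed
  qed
qed

section \<open>Brackets of the bihomogeneous components\<close>

lemma hom_vimage_subgroup:
  assumes "f3space M" "f3space N" "h \<in> ahom M N" "subgroup S (add_monoid N)"
  shows "subgroup {x \<in> carrier M. h x \<in> S} (add_monoid M)"
proof -
  interpret M: f3space M by fact
  interpret N: f3space N by fact
  interpret h: group_hom "add_monoid M" "add_monoid N" h
    by (rule f3space_group_hom[OF assms(1-3)])
  interpret S: subgroup S "add_monoid N" by fact
  show ?thesis
  proof (rule M.add.subgroupI)
    show "{x \<in> carrier M. h x \<in> S} \<subseteq> carrier M" by auto
    show "{x \<in> carrier M. h x \<in> S} \<noteq> {}"
      using h.hom_one S.one_closed M.zero_closed by auto
    fix x assume "x \<in> {x \<in> carrier M. h x \<in> S}"
    then show "\<ominus>\<^bsub>M\<^esub> x \<in> {x \<in> carrier M. h x \<in> S}"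
      using h.hom_inv[of x] S.m_inv_closed[of "h x"] by (simp add: a_inv_def)
  next
    fix x y assume "x \<in> {x \<in> carrier M. h x \<in> S}" "y \<in> {x \<in> carrier M. h x \<in> S}"
    then show "x \<oplus>\<^bsub>M\<^esub> y \<in> {x \<in> carrier M. h x \<in> S}"
      using h.hom_mult[of x y] S.m_closed[of "h x" "h y"] by simp
  qed
qed

lemma f3space_hom_zero:
  assumes "f3space M" "f3space N" "h \<in> ahom M N"
  shows "h \<zero>\<^bsub>M\<^esub> = \<zero>\<^bsub>N\<^esub>"
proof -
  interpret M: f3space M by fact
  interpret N: f3space N by fact
  interpret h: group_hom "add_monoid M" "add_monoid N" h
    by (rule f3space_group_hom[OF assms(1-3)])
  show ?thesis using h.hom_one by simp
qed

lemma f3space_hom_image: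
  assumes "f3space M" "f3space N" "h \<in> ahom M N"
  shows "subgroup (h ` carrier M) (add_monoid N)"
proof -
  interpret M: f3space M by fact
  interpret N: f3space N by fact
  interpret h: group_hom "add_monoid M" "add_monoid N" h
    by (rule f3space_group_hom[OF assms(1-3)])
  show ?thesis using h.img_is_subgroup by simp
qed

context f3space
begin

lemma subgroup_add: "subgroup S (add_monoid M) \<Longrightarrow> x \<in> S \<Longrightarrow> y \<in> S \<Longrightarrow> x \<oplus> y \<in> S"
  using subgroup.m_closed by fastforce

lemma subgroup_zero: "subgroup S (add_monoid M) \<Longrightarrow> \<zero> \<in> S"
  using subgroup.one_closed by fastforce

lemma subgroup_minus: "subgroup S (add_monoid M) \<Longrightarrow> x \<in> S \<Longrightarrow> \<ominus> x \<in> S"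
  using subgroup.m_inv_closed by (fastforce simp: a_inv_def)

lemma subgroup_lsum:
  assumes "subgroup S (add_monoid M)" "\<And>p. p \<in> set ps \<Longrightarrow> f p \<in> S"
  shows "lsum M f ps \<in> S"
  using assms(2) by (induction ps) (auto intro: subgroup_add subgroup_zero assms(1))

end

lemma (in exponent3) gr_bracket_hom:
  assumes "n \<ge> 1" "m \<ge> 1"
  shows "X \<in> carrier (gr G n) \<Longrightarrow> gr_bracket G n m X \<in> ahom (gr G m) (gr G (n + m))"
    and "Y \<in> carrier (gr G m) \<Longrightarrow>
      (\<lambda>X. gr_bracket G n m X Y) \<in> ahom (gr G n) (gr G (n + m))"
  using assms
  by (auto intro!: homI simp: gr_bracket_closed gr_bracket_add_left gr_bracket_add_right)

locale exponent3_coproduct = G: exponent3 G + H: exponent3 H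
  for G :: "('a, 'c) monoid_scheme" and H :: "('b, 'd) monoid_scheme"
begin

sublocale two_groups G H ..

sublocale P: exponent3 P by (rule exponent3_coprod3)
sublocale \<iota>: group_hom G P \<iota> using inl_hom by unfold_locales
sublocale \<kappa>: group_hom H P \<kappa> using inr_hom by unfold_locales

abbreviation "etaL \<equiv> eta_left G H"
abbreviation "etaR \<equiv> eta_right G H"
abbreviation "etaM \<equiv> eta_mixed G H"
abbreviation "tens \<equiv> gr_tensor G H"
abbreviation "\<B> \<equiv> bideg G H"

lemma eta_left_gcls: "x \<in> lcs G i \<Longrightarrow> etaL i (gcls G i x) = gcls P i (\<iota> x)"
  unfolding eta_left_def by (rule gr_map_gcls[OF G.exponent3_axioms P.exponent3_axioms inl_hom])

lemma eta_right_gcls: "y \<in> lcs H j \<Longrightarrow> etaR j (gcls H j y) = gcls P j (\<kappa> y)"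
  unfolding eta_right_def by (rule gr_map_gcls[OF H.exponent3_axioms P.exponent3_axioms inr_hom])

lemma eta_left_hom: "etaL i \<in> ahom (gr G i) (gr P i)"
  unfolding eta_left_def by (rule gr_map_hom[OF G.exponent3_axioms P.exponent3_axioms inl_hom])

lemma eta_right_hom: "etaR j \<in> ahom (gr H j) (gr P j)"
  unfolding eta_right_def by (rule gr_map_hom[OF H.exponent3_axioms P.exponent3_axioms inr_hom])

lemma eta_left_closed: "X \<in> carrier (gr G i) \<Longrightarrow> etaL i X \<in> carrier (gr P i)"
  using eta_left_hom[of i] by (auto simp: hom_def)

lemma eta_right_closed: "Y \<in> carrier (gr H j) \<Longrightarrow> etaR j Y \<in> carrier (gr P j)"
  using eta_right_hom[of j] by (auto simp: hom_def)

definition mixed :: "nat \<Rightarrow> nat \<Rightarrow> 'a set \<Rightarrow> 'b set \<Rightarrow> ('a + 'b) list set set set"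
  where "mixed i j X Y = gr_bracket P i j (etaL i X) (etaR j Y)"

lemma mixed_gcls:
  assumes "i \<ge> 1" "j \<ge> 1" "x \<in> lcs G i" "y \<in> lcs H j"
  shows "mixed i j (gcls G i x) (gcls H j y) = gcls P (i + j) (comm P (\<iota> x) (\<kappa> y))"
  unfolding mixed_def using assms \<iota>.hom_lcs \<kappa>.hom_lcs
  by (simp add: eta_left_gcls eta_right_gcls P.gr_bracket_gcls)

lemma bilin_mixed:
  assumes "i \<ge> 1" "j \<ge> 1"
  shows "bilin (gr G i) (gr H j) (gr P (i + j)) (mixed i j)"
proof -
  have "(\<lambda>X. gr_bracket P i j (etaL i X) (etaR j Y)) \<in> ahom (gr G i) (gr P (i + j))"
    if "Y \<in> carrier (gr H j)" for Y
    using hom_compose[OF eta_left_hom P.gr_bracket_hom(2)[OF assms eta_right_closed[OF that]]]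
    by (simp add: comp_def)
  moreover have "(\<lambda>Y. gr_bracket P i j (etaL i X) (etaR j Y)) \<in> ahom (gr H j) (gr P (i + j))"
    if "X \<in> carrier (gr G i)" for X
    using hom_compose[OF eta_right_hom P.gr_bracket_hom(1)[OF assms eta_left_closed[OF that]]]
    by (simp add: comp_def)
  ultimately show ?thesis
    by (simp add: bilin_def mixed_def[abs_def])
qed

lemma f3tensor_gr: "i \<ge> 1 \<Longrightarrow> j \<ge> 1 \<Longrightarrow> f3tensor (gr G i) (gr H j)"
  by (simp add: f3tensor_def G.f3space_gr H.f3space_gr)

lemma eta_mixed_hom:
  assumes "i \<ge> 1" "j \<ge> 1"
  shows "etaM i j \<in> ahom (tens i j) (gr P (i + j))"
  using f3tensor.tensor_lift_hom(1)[OF f3tensor_gr[OF assms] _ bilin_mixed[OF assms]] assms P.f3space_gr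
  by (simp add: eta_mixed_def mixed_def[abs_def])

lemma eta_mixed_tsum:
  assumes "i \<ge> 1" "j \<ge> 1" "set ps \<subseteq> carrier (gr G i) \<times> carrier (gr H j)"
  shows "etaM i j (lsum (tens i j) (\<lambda>(x, y). tpure (gr G i) (gr H j) x y) ps)
    = lsum (gr P (i + j)) (\<lambda>(x, y). mixed i j x y) ps"
  using f3tensor.tensor_lift_tsum[OF f3tensor_gr[OF assms(1,2)] _ bilin_mixed[OF assms(1,2)] assms(3)] assms P.f3space_gr
  by (simp add: eta_mixed_def mixed_def[abs_def])

lemma eta_mixed_pure:
  assumes "i \<ge> 1" "j \<ge> 1" "x \<in> lcs G i" "y \<in> lcs H j"
  shows "gcls P (i + j) (comm P (\<iota> x) (\<kappa> y)) \<in> etaM i j ` carrier (tens i j)"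
proof -
  let ?t = "tpure (gr G i) (gr H j) (gcls G i x) (gcls H j y)"
  have c: "gcls G i x \<in> carrier (gr G i)" "gcls H j y \<in> carrier (gr H j)"
    using assms G.gcls_closed H.gcls_closed by auto
  have "etaM i j ?t = mixed i j (gcls G i x) (gcls H j y)"
    using f3tensor.tensor_lift_hom(2)[OF f3tensor_gr[OF assms(1,2)] _ bilin_mixed[OF assms(1,2)] c] assms P.f3space_gr
    by (simp add: eta_mixed_def mixed_def[abs_def])
  moreover have "?t \<in> carrier (tens i j)"
    using bilinD(1)[OF f3tensor.bilin_tpure[OF f3tensor_gr[OF assms(1,2)]] c] .
  ultimately show ?thesis
    using mixed_gcls[OF assms] by (metis imageI)
qed

text \<open>An induction principle for the mixed summand: membership in a subgroup only has to be
  checked on classes of commutators between the two factors.\<close>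

lemma eta_mixed_in_subgroup:
  assumes ij: "i \<ge> 1" "j \<ge> 1" and t: "t \<in> carrier (tens i j)"
    and S: "subgroup S (add_monoid (gr P (i + j)))"
    and gen: "\<And>x y. x \<in> lcs G i \<Longrightarrow> y \<in> lcs H j \<Longrightarrow> gcls P (i + j) (comm P (\<iota> x) (\<kappa> y)) \<in> S"
  shows "etaM i j t \<in> S"
proof -
  interpret M: f3space "gr P (i + j)" using P.f3space_gr ij by simp
  obtain ps where ps: "set ps \<subseteq> carrier (gr G i) \<times> carrier (gr H j)"
      "t = lsum (tens i j) (\<lambda>(x, y). tpure (gr G i) (gr H j) x y) ps"
    using f3tensor.tensor_rep[OF f3tensor_gr[OF ij] t] .
  have "mixed i j X Y \<in> S" if "X \<in> carrier (gr G i)" "Y \<in> carrier (gr H j)" for X Y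
    using that gen ij by (auto elim!: G.gr_cases H.gr_cases simp: mixed_gcls)
  then show ?thesis
    unfolding ps(2) eta_mixed_tsum[OF ij ps(1)]
    using ps(1) by (intro M.subgroup_lsum[OF S]) auto
qed

lemma bideg_left: "i \<le> 3 \<Longrightarrow> \<B> i 0 = (\<lambda>x. gcls P i (\<iota> x)) ` lcs G i"
  by (auto simp: bideg_def G.carrier_gr eta_left_gcls image_image)

lemma bideg_right: "1 \<le> j \<Longrightarrow> j \<le> 3 \<Longrightarrow> \<B> 0 j = (\<lambda>y. gcls P j (\<kappa> y)) ` lcs H j"
  by (auto simp: bideg_def H.carrier_gr eta_right_gcls image_image)

lemma bideg_mixed:
  "1 \<le> i \<Longrightarrow> 1 \<le> j \<Longrightarrow> i + j \<le> 3 \<Longrightarrow> \<B> i j = etaM i j ` carrier (tens i j)"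
  by (auto simp: bideg_def)

lemma bideg_subgroup:
  assumes "i + j \<ge> 1"
  shows "subgroup (\<B> i j) (add_monoid (gr P (i + j)))"
proof -
  interpret M: f3space "gr P (i + j)" using P.f3space_gr assms by simp
  consider "i + j \<ge> 4" | "i + j < 4" "j = 0" "i \<ge> 1" | "i + j < 4" "i = 0" "j \<ge> 1"
    | "i + j < 4" "i \<ge> 1" "j \<ge> 1"
    using assms by linarith
  then show ?thesis
  proof cases
    case 1
    then show ?thesis using M.add.triv_subgroup by (simp add: bideg_def)
  next
    case 2
    then show ?thesis using f3space_hom_image[OF G.f3space_gr P.f3space_gr eta_left_hom] by (simp add: bideg_def)
  next
    case 3
    then show ?thesis using f3space_hom_image[OF H.f3space_gr P.f3space_gr eta_right_hom] by (simp add: bideg_def)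
  next
    case 4
    then show ?thesis
      using f3space_hom_image[OF f3tensor.f3space_tensor[OF f3tensor_gr] M.f3space_axioms eta_mixed_hom] by (simp add: bideg_def)
  qed
qed

lemma bideg_carrier: "i + j \<ge> 1 \<Longrightarrow> X \<in> \<B> i j \<Longrightarrow> X \<in> carrier (gr P (i + j))"
  using bideg_subgroup[of i j] subgroup.mem_carrier by fastforce

text \<open>Part (2) for single brackets; the step to their span is immediate because the target is
  a subgroup.\<close>

definition compat :: "nat \<Rightarrow> nat \<Rightarrow> nat \<Rightarrow> nat \<Rightarrow> bool"
  where "compat i j k l \<longleftrightarrow> (\<forall>X\<in>\<B> i j. \<forall>Y\<in>\<B> k l.
    gr_bracket P (i + j) (k + l) X Y \<in> \<B> (i + k) (j + l))"

lemma compat_swap: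
  assumes "i + j \<ge> 1" "k + l \<ge> 1" "compat i j k l"
  shows "compat k l i j"
  unfolding compat_def
proof (intro ballI)
  fix Y X assume Y: "Y \<in> \<B> k l" and X: "X \<in> \<B> i j"
  interpret M: f3space "gr P (i + j + (k + l))" using P.f3space_gr assms by simp
  have eq: "i + k + (j + l) = i + j + (k + l)" by simp
  have "gr_bracket P (k + l) (i + j) Y X = \<ominus>\<^bsub>gr P (i + j + (k + l))\<^esub> gr_bracket P (i + j) (k + l) X Y"
    using P.gr_bracket_swap[OF assms(1,2)] bideg_carrier assms X Y by simp
  moreover have "gr_bracket P (i + j) (k + l) X Y \<in> \<B> (i + k) (j + l)"
    using assms(3) X Y by (simp add: compat_def)
  moreover have "subgroup (\<B> (i + k) (j + l)) (add_monoid (gr P (i + j + (k + l))))"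
    using bideg_subgroup[of "i + k" "j + l"] assms unfolding eq by simp
  ultimately show "gr_bracket P (k + l) (i + j) Y X \<in> \<B> (k + i) (l + j)"
    using M.subgroup_minus by (simp add: add.commute)
qed

lemma compat_left: "i \<ge> 1 \<Longrightarrow> k \<ge> 1 \<Longrightarrow> i + k \<le> 3 \<Longrightarrow> compat i 0 k 0"
  unfolding compat_def
  by (auto simp: bideg_left P.gr_bracket_gcls \<iota>.hom_lcs G.lcs_carrier G.comm_lcs simp flip: \<iota>.hom_comm)

lemma compat_right: "j \<ge> 1 \<Longrightarrow> l \<ge> 1 \<Longrightarrow> j + l \<le> 3 \<Longrightarrow> compat 0 j 0 l"
  unfolding compat_def
  by (auto simp: bideg_right P.gr_bracket_gcls \<kappa>.hom_lcs H.lcs_carrier H.comm_lcs simp flip: \<kappa>.hom_comm)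

lemma compat_pure: "i \<ge> 1 \<Longrightarrow> l \<ge> 1 \<Longrightarrow> i + l \<le> 3 \<Longrightarrow> compat i 0 0 l"
  unfolding compat_def
  using eta_mixed_pure
  by (auto simp: bideg_left bideg_right bideg_mixed P.gr_bracket_gcls \<iota>.hom_lcs \<kappa>.hom_lcs)

text \<open>The bracket with \<open>X\<close> is additive, so the elements of the mixed component
  that it sends into \<open>D\<close> form a subgroup, and commutators between the factors
  suffice.\<close>

lemma compat_mixed:
  assumes X: "X \<in> carrier (gr P 1)" and D: "D = \<B> (1 + i) (1 + j)" and ij: "i + j = 1"
    and gen: "\<And>x y. x \<in> carrier G \<Longrightarrow> y \<in> carrier H \<Longrightarrow>
      gr_bracket P 1 2 X (gcls P 2 (comm P (\<iota> x) (\<kappa> y))) \<in> D"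
    and Y: "Y \<in> \<B> 1 1"
  shows "gr_bracket P 1 2 X Y \<in> D"
proof -
  have sub: "subgroup D (add_monoid (gr P (1 + 2)))"
    using bideg_subgroup[of "1 + i" "1 + j"] ij unfolding D by simp
  let ?S = "{Y \<in> carrier (gr P 2). gr_bracket P 1 2 X Y \<in> D}"
  have S: "subgroup ?S (add_monoid (gr P 2))"
    using P.f3space_gr[of 2] P.f3space_gr[of "1 + 2"] P.gr_bracket_hom(1)[of 1 2, OF _ _ X] sub
    by (intro hom_vimage_subgroup[where N = "gr P (1 + 2)"]) simp_all
  obtain t where t: "t \<in> carrier (tens 1 1)" "Y = etaM 1 1 t"
    using Y by (auto simp: bideg_mixed)
  have "comm P (\<iota> x) (\<kappa> y) \<in> lcs P 2" if "x \<in> carrier G" "y \<in> carrier H" for x y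
    using P.comm_in_lcs_Suc(1)[of 1 "\<iota> x" "\<kappa> y"] that by (simp add: numeral_2_eq_2)
  then have "Y \<in> ?S"
    unfolding t(2) using S gen t(1) P.gcls_closed
    by (intro eta_mixed_in_subgroup) (simp_all add: numeral_2_eq_2)
  then show ?thesis by simp
qed

text \<open>The Jacobi identity alone would leave a second term [x, [a, y]]. Rotation instead
  gathers both letters from \<open>G\<close> into one commutator: [a, [x, y]] = [y, [a, x]], the
  inverse of [[a, x], y], with [a, x] in \<open>lcs G 2\<close>.\<close>

lemma compat_1_0_1_1: "compat 1 0 1 1"
  unfolding compat_def
proof (intro ballI)
  fix X Y assume "X \<in> \<B> 1 0" and Y: "Y \<in> \<B> 1 1"
  then obtain a where a: "a \<in> carrier G" "X = gcls P 1 (\<iota> a)" by (auto simp: bideg_left)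
  interpret M: f3space "gr P 3" using P.f3space_gr by simp
  have "gr_bracket P 1 2 X (gcls P 2 (comm P (\<iota> x) (\<kappa> y))) \<in> \<B> 2 1"
    if x: "x \<in> carrier G" and y: "y \<in> carrier H" for x y
  proof -
    have c: "comm P (\<iota> x) (\<kappa> y) \<in> lcs P 2" "comm G a x \<in> lcs G 2"
      using P.comm_in_lcs_Suc(1)[of 1 "\<iota> x" "\<kappa> y"] G.comm_in_lcs_Suc(1)[of 1 a x] a x y
      by (simp_all add: numeral_2_eq_2)
    then have c': "comm P (comm P (\<iota> a) (\<iota> x)) (\<kappa> y) \<in> lcs P 3"
      using P.comm_in_lcs_Suc(1)[of 2 "comm P (\<iota> a) (\<iota> x)" "\<kappa> y"] P.comm_in_lcs_Suc(1)[of 1 "\<iota> a" "\<iota> x"] a x y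
      by (simp add: numeral_2_eq_2 numeral_3_eq_3)
    have "comm P (\<iota> a) (comm P (\<iota> x) (\<kappa> y)) = comm P (\<kappa> y) (comm P (\<iota> a) (\<iota> x))"
      using P.triple_comm_rotate a x y by simp
    also have "\<dots> = inv\<^bsub>P\<^esub> (comm P (comm P (\<iota> a) (\<iota> x)) (\<kappa> y))"
      using a x y by (simp add: P.inv_commutator)
    finally have "gr_bracket P 1 2 X (gcls P 2 (comm P (\<iota> x) (\<kappa> y)))
        = \<ominus>\<^bsub>gr P 3\<^esub> gcls P 3 (comm P (\<iota> (comm G a x)) (\<kappa> y))"
      using P.gr_bracket_gcls[of 1 2 "\<iota> a"] P.gcls_inv[of 3] a x c c' by (simp add: \<iota>.hom_comm numeral_3_eq_3)
    moreover have "gcls P 3 (comm P (\<iota> (comm G a x)) (\<kappa> y)) \<in> \<B> 2 1"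
      using eta_mixed_pure[of 2 1 "comm G a x" y] c y by (simp add: bideg_mixed)
    ultimately show ?thesis
      using M.subgroup_minus bideg_subgroup[of 2 1] by simp
  qed
  then show "gr_bracket P (1 + 0) (1 + 1) X Y \<in> \<B> (1 + 1) (0 + 1)"
    using compat_mixed[of X "\<B> 2 1" 1 0 Y] Y a P.gcls_closed[of "\<iota> a" 1]
    by (simp add: numeral_2_eq_2)
qed

text \<open>Two rotations gather the letters from \<open>H\<close>: [b, [x, y]] = [x,
  [y, b]].\<close>

lemma compat_0_1_1_1: "compat 0 1 1 1"
  unfolding compat_def
proof (intro ballI)
  fix X Y assume "X \<in> \<B> 0 1" and Y: "Y \<in> \<B> 1 1"
  then obtain b where b: "b \<in> carrier H" "X = gcls P 1 (\<kappa> b)" by (auto simp: bideg_right)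
  have "gr_bracket P 1 2 X (gcls P 2 (comm P (\<iota> x) (\<kappa> y))) \<in> \<B> 1 2"
    if x: "x \<in> carrier G" and y: "y \<in> carrier H" for x y
  proof -
    have c: "comm P (\<iota> x) (\<kappa> y) \<in> lcs P 2" "comm H y b \<in> lcs H 2"
      using P.comm_in_lcs_Suc(1)[of 1 "\<iota> x" "\<kappa> y"] H.comm_in_lcs_Suc(1)[of 1 y b] b x y
      by (simp_all add: numeral_2_eq_2)
    have "comm P (\<kappa> b) (comm P (\<iota> x) (\<kappa> y)) = comm P (\<iota> x) (\<kappa> (comm H y b))"
      using P.triple_comm_rotate[of "\<iota> x" "\<kappa> y" "\<kappa> b"] P.triple_comm_rotate[of "\<kappa> b" "\<iota> x" "\<kappa> y"] b x y
      by (simp add: \<kappa>.hom_comm)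
    then show ?thesis
      using P.gr_bracket_gcls[of 1 2 "\<kappa> b"] b c eta_mixed_pure[of 1 2 x "comm H y b"] x
      by (simp add: bideg_mixed)
  qed
  then show "gr_bracket P (0 + 1) (1 + 1) X Y \<in> \<B> (0 + 1) (1 + 1)"
    using compat_mixed[of X "\<B> 1 2" 0 1 Y] Y b P.gcls_closed[of "\<kappa> b" 1]
    by (simp add: numeral_2_eq_2)
qed

lemma compat:
  assumes "i + j \<ge> 1" "k + l \<ge> 1"
  shows "compat i j k l"
proof (cases "i + j + (k + l) \<ge> 4")
  case True
  \<comment> \<open>In total degree at least 4 the graded piece is zero and the target component is
    all of it.\<close>
  have eq: "i + k + (j + l) = i + j + (k + l)" by simp
  have "\<B> (i + k) (j + l) = carrier (gr P (i + j + (k + l)))"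
    using P.gr_trivial[OF True] True unfolding bideg_def eq by simp
  then show ?thesis
    using P.gr_bracket_closed assms bideg_carrier unfolding compat_def by simp
next
  case False
  \<comment> \<open>Total degree at most 3 forces one argument to have degree 1; antisymmetry allows
    it to be the first.\<close>
  have step: "compat i j k l" if "i + j = 1" "k + l = 1 \<or> k + l = 2" for i j k l
  proof -
    have "i = 1 \<and> j = 0 \<or> i = 0 \<and> j = 1"
      "k = 1 \<and> l = 0 \<or> k = 0 \<and> l = 1 \<or> k = 2 \<and> l = 0 \<or> k = 1 \<and> l = 1 \<or> k = 0 \<and> l = 2"
      using that by arith+
    then show ?thesis
      using compat_left[of 1 1] compat_left[of 1 2] compat_right[of 1 1] compat_right[of 1 2]
        compat_pure[of 1 1] compat_pure[of 1 2] compat_swap[OF _ _ compat_pure[of 1 1]]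
        compat_swap[OF _ _ compat_pure[of 2 1]] compat_1_0_1_1 compat_0_1_1_1
      by (elim disjE conjE) simp_all
  qed
  from False assms consider "i + j = 1" "k + l = 1 \<or> k + l = 2" | "k + l = 1" "i + j = 2"
    by linarith
  then show ?thesis
  proof cases
    case 1
    then show ?thesis by (rule step)
  next
    case 2
    then show ?thesis using compat_swap[OF _ _ step[of k l i j]] assms by simp
  qed
qed

lemma bracket_span_bideg:
  assumes "(i, j) \<noteq> (0, 0)" "(k, l) \<noteq> (0, 0)"
  shows "gr_bracket_span P (i + j) (k + l) (\<B> i j) (\<B> k l) \<subseteq> \<B> (i + k) (j + l)"
proof -
  have ij: "i + j \<ge> 1" "k + l \<ge> 1" using assms by auto
  interpret M: f3space "gr P (i + j + (k + l))" using P.f3space_gr ij by simp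
  have eq: "i + k + (j + l) = i + j + (k + l)" by simp
  have "subgroup (\<B> (i + k) (j + l)) (add_monoid (gr P (i + j + (k + l))))"
    using bideg_subgroup[of "i + k" "j + l"] ij unfolding eq by simp
  then show ?thesis
    unfolding gr_bracket_span_def
    using compat[OF ij] by (intro M.lin_span_subset) (auto simp: compat_def)
qed

section \<open>The natural maps are isomorphisms\<close>

text \<open>The elements of \<open>P\<close> whose class lies in \<open>S\<close> form a subgroup
  containing the images of both factors, and these generate \<open>P\<close>.\<close>

lemma gr1_generated:
  assumes S: "subgroup S (add_monoid (gr P 1))" and gen: "\<And>i j. i + j = 1 \<Longrightarrow> \<B> i j \<subseteq> S"
  shows "carrier (gr P 1) \<subseteq> S"
proof -
  interpret M: f3space "gr P 1" using P.f3space_gr by simp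
  have "subgroup {p \<in> carrier P. gcls P 1 p \<in> S} P"
  proof (rule P.subgroupI)
    show "{p \<in> carrier P. gcls P 1 p \<in> S} \<noteq> {}"
      using M.subgroup_zero[OF S] P.gr_zero by auto
    show "inv\<^bsub>P\<^esub> p \<in> {p \<in> carrier P. gcls P 1 p \<in> S}" if "p \<in> {p \<in> carrier P. gcls P 1 p \<in> S}" for p
      using that M.subgroup_minus[OF S] P.gcls_inv[of 1 p] by simp
    show "p \<otimes>\<^bsub>P\<^esub> q \<in> {p \<in> carrier P. gcls P 1 p \<in> S}"
      if "p \<in> {p \<in> carrier P. gcls P 1 p \<in> S}" "q \<in> {p \<in> carrier P. gcls P 1 p \<in> S}" for p q
      using that M.subgroup_add[OF S] by (simp flip: P.gcls_add)
  qed auto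
  then have "carrier P \<subseteq> {p \<in> carrier P. gcls P 1 p \<in> S}"
    using gen[of 1 0] gen[of 0 1] by (intro coprod3_generated) (auto simp: bideg_left bideg_right)
  then show ?thesis by (auto elim!: P.gr_cases)
qed

text \<open>Part (2) lets the generation statement climb along the lower central series.\<close>
lemma gr_generated:
  assumes "n \<ge> 1" and "subgroup S (add_monoid (gr P n))" and "\<And>i j. i + j = n \<Longrightarrow> \<B> i j \<subseteq> S"
  shows "carrier (gr P n) \<subseteq> S"
  using assms
proof (induction n arbitrary: S rule: nat_induct_at_least)
  case base
  then show ?case by (rule gr1_generated)
next
  case (Suc n)
  have n1: "n + 1 \<ge> 1" by simp
  interpret M: f3space "gr P (n + 1)" using P.f3space_gr by simp
  have S: "subgroup S (add_monoid (gr P (n + 1)))" using Suc.prems(1) by simp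
  have fn: "f3space (gr P n)" "f3space (gr P 1)" using P.f3space_gr Suc.hyps by auto
  \<comment> \<open>Both arguments are bihomogeneous here. The next two claims extend this by
    additivity, first in the degree 1 argument and then, through the induction hypothesis, in the
    other.\<close>
  have bi: "gr_bracket P n 1 X Y \<in> S"
    if "i + j = n" "k + l = 1" "X \<in> \<B> i j" "Y \<in> \<B> k l" for i j k l X Y
  proof -
    have "gr_bracket P (i + j) (k + l) X Y \<in> \<B> (i + k) (j + l)"
      using compat[of i j k l] that Suc.hyps by (auto simp: compat_def)
    then show ?thesis
      using Suc.prems(2)[of "i + k" "j + l"] that by auto
  qed
  have right: "gr_bracket P n 1 X Y \<in> S"
    if "i + j = n" "X \<in> \<B> i j" "Y \<in> carrier (gr P 1)" for i j X Y
  proof -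
    have X: "X \<in> carrier (gr P n)" using bideg_carrier[of i j X] that Suc.hyps by simp
    let ?S = "{Y \<in> carrier (gr P 1). gr_bracket P n 1 X Y \<in> S}"
    have sub: "subgroup ?S (add_monoid (gr P 1))"
      using hom_vimage_subgroup[OF fn(2) M.f3space_axioms P.gr_bracket_hom(1)[OF Suc.hyps _ X] S] by simp
    have "\<B> k l \<subseteq> ?S" if "k + l = 1" for k l
      using bi[OF \<open>i + j = n\<close> that \<open>X \<in> \<B> i j\<close>] bideg_carrier[of k l] that by auto
    then have "carrier (gr P 1) \<subseteq> ?S"
      by (intro gr1_generated[OF sub])
    then show ?thesis using that by auto
  qed
  have all: "gr_bracket P n 1 X Y \<in> S" if X: "X \<in> carrier (gr P n)" and Y: "Y \<in> carrier (gr P 1)" for X Y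
  proof -
    let ?S = "{X \<in> carrier (gr P n). gr_bracket P n 1 X Y \<in> S}"
    have sub: "subgroup ?S (add_monoid (gr P n))"
      using hom_vimage_subgroup[OF fn(1) M.f3space_axioms P.gr_bracket_hom(2)[OF Suc.hyps _ Y] S] by simp
    have "\<B> i j \<subseteq> ?S" if "i + j = n" for i j
      using right[OF that _ Y] bideg_carrier[of i j] that Suc.hyps by auto
    then have "carrier (gr P n) \<subseteq> ?S"
      by (intro Suc.IH[OF sub])
    then show ?thesis using X by auto
  qed
  \<comment> \<open>A subgroup that contains the commutators generating
    \<open>lcs P (Suc n)\<close>, hence all of it.\<close>
  let ?L = "{p \<in> lcs P (Suc n). gcls P (n + 1) p \<in> S}"
  have "subgroup ?L P"
  proof (rule P.subgroupI)
    show "?L \<subseteq> carrier P" using P.lcs_carrier by auto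
    show "?L \<noteq> {}"
      using M.subgroup_zero[OF S] P.gr_zero[of "n + 1"] P.lcs_one[of "Suc n"] by auto
    show "inv\<^bsub>P\<^esub> p \<in> ?L" if "p \<in> ?L" for p
      using that M.subgroup_minus[OF S] P.gcls_inv[OF n1, of p] P.lcs_inv[of p "Suc n"] by simp
    show "p \<otimes>\<^bsub>P\<^esub> q \<in> ?L" if "p \<in> ?L" "q \<in> ?L" for p q
    proof -
      have "gcls P (n + 1) (p \<otimes>\<^bsub>P\<^esub> q) \<in> S"
        using that M.subgroup_add[OF S] P.lcs_carrier[of _ "Suc n"]
        by (subst P.gcls_add[symmetric]) auto
      then show ?thesis using that P.lcs_mult[of p "Suc n" q] by simp
    qed
  qed
  moreover have "{comm P a b | a b. a \<in> lcs P n \<and> b \<in> carrier P} \<subseteq> ?L"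
  proof clarify
    fix a b assume ab: "a \<in> lcs P n" "b \<in> carrier P"
    then have "gcls P (n + 1) (comm P a b) = gr_bracket P n 1 (gcls P n a) (gcls P 1 b)"
      using P.gr_bracket_gcls[OF Suc.hyps, of 1 a b] by simp
    also have "\<dots> \<in> S"
      using all ab P.gcls_closed[of a n] P.gcls_closed[of b 1] by simp
    finally show "comm P a b \<in> lcs P (Suc n) \<and> gcls P (n + 1) (comm P a b) \<in> S"
      using P.comm_in_lcs_Suc(1)[OF Suc.hyps ab] by simp
  qed
  ultimately have "lcs P (Suc n) \<subseteq> ?L"
    unfolding P.lcs_Suc[OF Suc.hyps] using P.generate_subgroup_incl by blast
  then show ?case by (auto elim!: P.gr_cases)
qed

lemma eta1_hom: "eta1 G H \<in> ahom (gr G 1 \<oplus>\<^sub>m gr H 1) (gr P 1)"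
proof -
  interpret M: f3space "gr P 1" using P.f3space_gr by simp
  show ?thesis
    using eta_left_hom[of 1] eta_right_hom[of 1]
    by (intro homI) (auto simp: dsum_def eta1_def hom_def Pi_iff M.a_ac simp del: One_nat_def)
qed

lemma eta2_hom:
  "eta2 G H \<in> ahom (gr G 2 \<oplus>\<^sub>m tens 1 1 \<oplus>\<^sub>m gr H 2) (gr P 2)"
proof -
  interpret M: f3space "gr P 2" using P.f3space_gr by simp
  have "etaM 1 1 \<in> ahom (tens 1 1) (gr P 2)"
    using eta_mixed_hom[of 1 1] by (simp add: numeral_2_eq_2)
  then show ?thesis
    using eta_left_hom[of 2] eta_right_hom[of 2]
    by (intro homI) (auto simp: dsum_def eta2_def hom_def Pi_iff M.a_ac simp del: One_nat_def)
qed

lemma eta3_hom: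
  "eta3 G H \<in> ahom (gr G 3 \<oplus>\<^sub>m tens 2 1 \<oplus>\<^sub>m tens 1 2 \<oplus>\<^sub>m gr H 3) (gr P 3)"
proof -
  interpret M: f3space "gr P 3" using P.f3space_gr by simp
  have "etaM 2 1 \<in> ahom (tens 2 1) (gr P 3)"
    "etaM 1 2 \<in> ahom (tens 1 2) (gr P 3)"
    using eta_mixed_hom[of 2 1] eta_mixed_hom[of 1 2] by (simp_all add: numeral_3_eq_3 numeral_2_eq_2)
  then show ?thesis
    using eta_left_hom[of 3] eta_right_hom[of 3]
    by (intro homI) (auto simp: dsum_def eta3_def hom_def Pi_iff M.a_ac simp del: One_nat_def)
qed

section \<open>Retractions, pairings and the isomorphisms\<close>

lemma const_hom: "group K \<Longrightarrow> (\<lambda>x. \<one>\<^bsub>K\<^esub>) \<in> hom L K"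
  by (rule homI) (simp_all add: group.is_monoid monoid.one_closed monoid.l_one)

text \<open>If the images of the two factors commute in \<open>K\<close>, the commutators spanning
  the mixed summands become trivial. Both retractions are of this kind, since each makes one factor
  trivial.\<close>

lemma gr_map_eta_mixed:
  assumes "exponent3 K" and \<rho>: "\<rho> \<in> hom P K"
    and triv: "\<And>x y. x \<in> carrier G \<Longrightarrow> y \<in> carrier H \<Longrightarrow> comm K (\<rho> (\<iota> x)) (\<rho> (\<kappa> y)) = \<one>\<^bsub>K\<^esub>"
    and ij: "i \<ge> 1" "j \<ge> 1" and t: "t \<in> carrier (tens i j)"
  shows "gr_map K \<rho> (i + j) (etaM i j t) = \<zero>\<^bsub>gr K (i + j)\<^esub>"
proof -
  interpret K: exponent3 K by fact
  interpret \<rho>: group_hom P K \<rho> using \<rho> by unfold_locales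
  have f3: "f3space (gr P (i + j))" "f3space (gr K (i + j))"
    using P.f3space_gr K.f3space_gr ij by auto
  interpret N: f3space "gr K (i + j)" by (rule f3(2))
  let ?S = "{X \<in> carrier (gr P (i + j)). gr_map K \<rho> (i + j) X \<in> {\<zero>\<^bsub>gr K (i + j)\<^esub>}}"
  have "subgroup ?S (add_monoid (gr P (i + j)))"
    using N.add.triv_subgroup
    by (intro hom_vimage_subgroup[OF f3 gr_map_hom[OF P.exponent3_axioms assms(1) \<rho>]]) simp
  moreover have "gcls P (i + j) (comm P (\<iota> x) (\<kappa> y)) \<in> ?S" if xy: "x \<in> lcs G i" "y \<in> lcs H j" for x y
  proof -
    have c: "comm P (\<iota> x) (\<kappa> y) \<in> lcs P (i + j)"
      using P.comm_lcs[OF ij \<iota>.hom_lcs[OF xy(1)] \<kappa>.hom_lcs[OF xy(2)]] .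
    have "\<rho> (comm P (\<iota> x) (\<kappa> y)) = \<one>\<^bsub>K\<^esub>"
      using triv xy G.lcs_carrier H.lcs_carrier by (simp add: \<rho>.hom_comm)
    then show ?thesis
      using P.gcls_closed[OF c] gr_map_gcls[OF P.exponent3_axioms assms(1) \<rho> c] by (simp add: K.gr_zero)
  qed
  ultimately have "etaM i j t \<in> ?S"
    by (rule eta_mixed_in_subgroup[OF ij t])
  then show ?thesis by simp
qed

lemma retraction_left:
  assumes "n \<ge> 1"
  obtains r where "r \<in> ahom (gr P n) (gr G n)"
    "\<And>X. X \<in> carrier (gr G n) \<Longrightarrow> r (etaL n X) = X"
    "\<And>Y. Y \<in> carrier (gr H n) \<Longrightarrow> r (etaR n Y) = \<zero>\<^bsub>gr G n\<^esub>"
    "\<And>i j t. i \<ge> 1 \<Longrightarrow> j \<ge> 1 \<Longrightarrow> i + j = n \<Longrightarrow> t \<in> carrier (tens i j) \<Longrightarrow>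
      r (etaM i j t) = \<zero>\<^bsub>gr G n\<^esub>"
proof -
  obtain \<rho> where \<rho>: "\<rho> \<in> hom P G" "\<And>x. x \<in> carrier G \<Longrightarrow> \<rho> (\<iota> x) = x" "\<And>y. y \<in> carrier H \<Longrightarrow> \<rho> (\<kappa> y) = \<one>\<^bsub>G\<^esub>"
    using coprod3_universal[OF G.exponent3_axioms G.id_hom const_hom[OF G.is_group]] by blast
  interpret \<rho>: group_hom P G \<rho> using \<rho>(1) by unfold_locales
  note r = gr_map_hom[OF P.exponent3_axioms G.exponent3_axioms \<rho>(1), of n]
    gr_map_gcls[OF P.exponent3_axioms G.exponent3_axioms \<rho>(1), of _ n]
  show ?thesis
  proof (rule that[OF r(1)])
    show "gr_map G \<rho> n (etaL n X) = X" if "X \<in> carrier (gr G n)" for X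
      using that by (auto elim!: G.gr_cases simp: eta_left_gcls r(2) \<iota>.hom_lcs \<rho>(2))
    show "gr_map G \<rho> n (etaR n Y) = \<zero>\<^bsub>gr G n\<^esub>" if "Y \<in> carrier (gr H n)" for Y
      using that by (auto elim!: H.gr_cases simp: eta_right_gcls r(2) \<kappa>.hom_lcs \<rho>(3) G.gr_zero)
    fix i j t assume ij: "i \<ge> 1" "j \<ge> 1" "i + j = n" and t: "t \<in> carrier (tens i j)"
    show "gr_map G \<rho> n (etaM i j t) = \<zero>\<^bsub>gr G n\<^esub>"
      using gr_map_eta_mixed[OF G.exponent3_axioms \<rho>(1) _ ij(1,2) t] G.comm_eq_one_iff[of _ "\<one>\<^bsub>G\<^esub>"]
      unfolding ij(3) by (simp add: \<rho>(2,3))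
  qed
qed

lemma retraction_right:
  assumes "n \<ge> 1"
  obtains r where "r \<in> ahom (gr P n) (gr H n)"
    "\<And>X. X \<in> carrier (gr G n) \<Longrightarrow> r (etaL n X) = \<zero>\<^bsub>gr H n\<^esub>"
    "\<And>Y. Y \<in> carrier (gr H n) \<Longrightarrow> r (etaR n Y) = Y"
    "\<And>i j t. i \<ge> 1 \<Longrightarrow> j \<ge> 1 \<Longrightarrow> i + j = n \<Longrightarrow> t \<in> carrier (tens i j) \<Longrightarrow>
      r (etaM i j t) = \<zero>\<^bsub>gr H n\<^esub>"
proof -
  obtain \<rho> where \<rho>: "\<rho> \<in> hom P H" "\<And>x. x \<in> carrier G \<Longrightarrow> \<rho> (\<iota> x) = \<one>\<^bsub>H\<^esub>" "\<And>y. y \<in> carrier H \<Longrightarrow> \<rho> (\<kappa> y) = y"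
    using coprod3_universal[OF H.exponent3_axioms const_hom[OF H.is_group] H.id_hom] by blast
  interpret \<rho>: group_hom P H \<rho> using \<rho>(1) by unfold_locales
  note r = gr_map_hom[OF P.exponent3_axioms H.exponent3_axioms \<rho>(1), of n]
    gr_map_gcls[OF P.exponent3_axioms H.exponent3_axioms \<rho>(1), of _ n]
  show ?thesis
  proof (rule that[OF r(1)])
    show "gr_map H \<rho> n (etaL n X) = \<zero>\<^bsub>gr H n\<^esub>" if "X \<in> carrier (gr G n)" for X
      using that by (auto elim!: G.gr_cases simp: eta_left_gcls r(2) \<iota>.hom_lcs \<rho>(2) H.gr_zero)
    show "gr_map H \<rho> n (etaR n Y) = Y" if "Y \<in> carrier (gr H n)" for Y
      using that by (auto elim!: H.gr_cases simp: eta_right_gcls r(2) \<kappa>.hom_lcs \<rho>(3))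
    fix i j t assume ij: "i \<ge> 1" "j \<ge> 1" "i + j = n" and t: "t \<in> carrier (tens i j)"
    show "gr_map H \<rho> n (etaM i j t) = \<zero>\<^bsub>gr H n\<^esub>"
      using gr_map_eta_mixed[OF H.exponent3_axioms \<rho>(1) _ ij(1,2) t] H.comm_eq_one_iff[of "\<one>\<^bsub>H\<^esub>"]
      unfolding ij(3) by (simp add: \<rho>(2,3))
  qed
qed

lemma functional_eta_mixed_zero:
  assumes ij: "i \<ge> 1" "j \<ge> 1" and t: "t \<in> carrier (tens i j)"
    and l: "l \<in> functionals (gr P (i + j))"
    and gen: "\<And>x y. x \<in> lcs G i \<Longrightarrow> y \<in> lcs H j \<Longrightarrow> l (gcls P (i + j) (comm P (\<iota> x) (\<kappa> y))) = 0"
  shows "l (etaM i j t) = 0"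
proof -
  interpret M: f3space "gr P (i + j)" using P.f3space_gr ij by simp
  let ?S = "{X \<in> carrier (gr P (i + j)). l X = 0}"
  have "subgroup ?S (add_monoid (gr P (i + j)))"
  proof (rule M.add.subgroupI)
    show "?S \<noteq> {}" using M.functionals_zero[OF l] by blast
    show "\<ominus>\<^bsub>gr P (i + j)\<^esub> X \<in> ?S" if "X \<in> ?S" for X
      using that M.functionals_minus[OF l] by simp
    show "X \<oplus>\<^bsub>gr P (i + j)\<^esub> Y \<in> ?S" if "X \<in> ?S" "Y \<in> ?S" for X Y
      using that functionals_add[OF l] by simp
  qed auto
  moreover have "gcls P (i + j) (comm P (\<iota> x) (\<kappa> y)) \<in> ?S" if xy: "x \<in> lcs G i" "y \<in> lcs H j" for x y
    using gen[OF xy] P.gcls_closed P.comm_lcs[OF ij \<iota>.hom_lcs[OF xy(1)] \<kappa>.hom_lcs[OF xy(2)]] by simp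
  ultimately have "etaM i j t \<in> ?S"
    by (rule eta_mixed_in_subgroup[OF ij t])
  then show ?thesis by simp
qed

text \<open>Evaluating \<open>l\<close> on the image of a sum of pure tensors gives the sum of the
  products \<phi>(x) \<psi>(y), so \<open>tsum_eq_zero\<close> applies. Only
  \<open>l (etaM i j t) = 0\<close> is asked, and not the vanishing of \<open>etaM i j t\<close>,
  because in degree 3 at first only the sum of the two mixed images is known to vanish.\<close>

lemma tensor_eq_zero:
  assumes ij: "i \<ge> 1" "j \<ge> 1" and t: "t \<in> carrier (tens i j)"
    and \<Phi>: "separating (gr G i) \<Phi>" and \<Psi>: "separating (gr H j) \<Psi>"
    and pair: "\<And>\<phi> \<psi>. \<phi> \<in> \<Phi> \<Longrightarrow> \<psi> \<in> \<Psi> \<Longrightarrow> \<exists>l\<in>functionals (gr P (i + j)).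
      l (etaM i j t) = 0 \<and> (\<forall>x\<in>lcs G i. \<forall>y\<in>lcs H j.
        l (gcls P (i + j) (comm P (\<iota> x) (\<kappa> y))) = \<phi> (gcls G i x) * \<psi> (gcls H j y))"
  shows "t = \<zero>\<^bsub>tens i j\<^esub>"
proof -
  interpret M: f3space "gr P (i + j)" using P.f3space_gr ij by simp
  obtain ps where ps: "set ps \<subseteq> carrier (gr G i) \<times> carrier (gr H j)"
      "t = lsum (tens i j) (\<lambda>(x, y). tpure (gr G i) (gr H j) x y) ps"
    using f3tensor.tensor_rep[OF f3tensor_gr[OF ij] t] .
  have "sum_list (map (\<lambda>(x, y). \<phi> x * \<psi> y) ps) = 0" if \<phi>\<psi>: "\<phi> \<in> \<Phi>" "\<psi> \<in> \<Psi>" for \<phi> \<psi>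
  proof -
    obtain l where l: "l \<in> functionals (gr P (i + j))" "l (etaM i j t) = 0"
      "\<And>x y. x \<in> lcs G i \<Longrightarrow> y \<in> lcs H j \<Longrightarrow>
        l (gcls P (i + j) (comm P (\<iota> x) (\<kappa> y))) = \<phi> (gcls G i x) * \<psi> (gcls H j y)"
      using pair[OF \<phi>\<psi>] by blast
    have lm: "l (mixed i j X Y) = \<phi> X * \<psi> Y" if "X \<in> carrier (gr G i)" "Y \<in> carrier (gr H j)" for X Y
      using that l(3) by (auto elim!: G.gr_cases H.gr_cases simp: mixed_gcls[OF ij])
    have "l (etaM i j t) = sum_list (map (\<lambda>p. l ((\<lambda>(x, y). mixed i j x y) p)) ps)"
      unfolding ps(2) eta_mixed_tsum[OF ij ps(1)]
      using ps(1) bilinD(1)[OF bilin_mixed[OF ij]] by (intro M.functionals_lsum[OF l(1)]) auto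
    also have "map (\<lambda>p. l ((\<lambda>(x, y). mixed i j x y) p)) ps = map (\<lambda>(x, y). \<phi> x * \<psi> y) ps"
      using ps(1) lm by auto
    finally show ?thesis using l(2) by simp
  qed
  then show ?thesis
    unfolding ps(2) by (intro f3tensor.tsum_eq_zero[OF f3tensor_gr[OF ij] \<Phi> \<Psi> ps(1)])
qed

lemmas exps = G.exponent3_axioms H.exponent3_axioms P.exponent3_axioms

lemma f3space_gr_tensor: "i \<ge> 1 \<Longrightarrow> j \<ge> 1 \<Longrightarrow> f3space (tens i j)"
  by (rule f3tensor.f3space_tensor[OF f3tensor_gr])

lemma eta_zero:
  assumes "i \<ge> 1"
  shows "etaL i \<zero>\<^bsub>gr G i\<^esub> = \<zero>\<^bsub>gr P i\<^esub>" "etaR i \<zero>\<^bsub>gr H i\<^esub> = \<zero>\<^bsub>gr P i\<^esub>"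
  using f3space_hom_zero[OF G.f3space_gr P.f3space_gr eta_left_hom] f3space_hom_zero[OF H.f3space_gr P.f3space_gr eta_right_hom]
    assms by auto

lemma eta_mixed_zero:
  assumes "i \<ge> 1" "j \<ge> 1" "i + j = n"
  shows "etaM i j \<zero>\<^bsub>tens i j\<^esub> = \<zero>\<^bsub>gr P n\<^esub>"
  using f3space_hom_zero[OF f3space_gr_tensor P.f3space_gr eta_mixed_hom] assms by auto

lemma eta_mixed_closed:
  assumes "i \<ge> 1" "j \<ge> 1" "i + j = n" "t \<in> carrier (tens i j)"
  shows "etaM i j t \<in> carrier (gr P n)"
  using eta_mixed_hom[OF assms(1,2)] assms(3,4) by (auto simp: hom_def)

lemma eta_surj:
  assumes "n \<ge> 1" "f3space M" "h \<in> ahom M (gr P n)"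
    and "\<And>i j. i + j = n \<Longrightarrow> \<B> i j \<subseteq> h ` carrier M" and "Y \<in> carrier (gr P n)"
  shows "Y \<in> h ` carrier M"
  using gr_generated[OF assms(1) f3space_hom_image[OF assms(2) P.f3space_gr[OF assms(1)] assms(3)] assms(4)] assms(5)
  by blast

lemma eta1_iso: "eta1 G H \<in> lin_iso F3 (gr G 1 \<oplus>\<^sub>m gr H 1) (gr P 1)"
proof -
  interpret M: f3space "gr P 1" using P.f3space_gr by simp
  interpret A: f3space "gr G 1" using G.f3space_gr by simp
  interpret B: f3space "gr H 1" using H.f3space_gr by simp
  note [simp del] = One_nat_def
  let ?D = "gr G 1 \<oplus>\<^sub>m gr H 1"
  have D: "f3space ?D"
    by (intro f3space_dsum A.f3space_axioms B.f3space_axioms)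
  note z = eta_zero[of 1]
  note c = eta_left_closed[of _ 1] eta_right_closed[of _ 1]
  show ?thesis
  proof (rule lin_isoI[OF D M.f3space_axioms eta1_hom])
    fix x assume "x \<in> carrier ?D" and 0: "eta1 G H x = \<zero>\<^bsub>gr P 1\<^esub>"
    then obtain a b where x: "x = (a, b)" "a \<in> carrier (gr G 1)" "b \<in> carrier (gr H 1)"
      by (auto simp: dsum_def)
    obtain r where r: "r \<in> ahom (gr P 1) (gr G 1)"
      "\<And>X. X \<in> carrier (gr G 1) \<Longrightarrow> r (etaL 1 X) = X"
      "\<And>Y. Y \<in> carrier (gr H 1) \<Longrightarrow> r (etaR 1 Y) = \<zero>\<^bsub>gr G 1\<^esub>"
      using retraction_left[of 1] by (metis order_refl)
    obtain s where s: "s \<in> ahom (gr P 1) (gr H 1)"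
      "\<And>X. X \<in> carrier (gr G 1) \<Longrightarrow> s (etaL 1 X) = \<zero>\<^bsub>gr H 1\<^esub>"
      "\<And>Y. Y \<in> carrier (gr H 1) \<Longrightarrow> s (etaR 1 Y) = Y"
      using retraction_right[of 1] by (metis order_refl)
    have "r (eta1 G H x) = a" "s (eta1 G H x) = b"
      using x r s c by (auto simp: eta1_def hom_def)
    then show "x = \<zero>\<^bsub>?D\<^esub>"
      using x 0 f3space_hom_zero[OF M.f3space_axioms A.f3space_axioms r(1)]
        f3space_hom_zero[OF M.f3space_axioms B.f3space_axioms s(1)]
      by (simp add: dsum_def)
  next
    have L: "etaL 1 X \<in> eta1 G H ` carrier ?D" if "X \<in> carrier (gr G 1)" for X
      using that c z by (intro image_eqI[of _ _ "(X, \<zero>\<^bsub>gr H 1\<^esub>)"]) (auto simp: dsum_def eta1_def)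
    have R: "etaR 1 Y \<in> eta1 G H ` carrier ?D" if "Y \<in> carrier (gr H 1)" for Y
      using that c z by (intro image_eqI[of _ _ "(\<zero>\<^bsub>gr G 1\<^esub>, Y)"]) (auto simp: dsum_def eta1_def)
    have "\<B> i j \<subseteq> eta1 G H ` carrier ?D" if "i + j = 1" for i j
    proof -
      have "i = 1 \<and> j = 0 \<or> i = 0 \<and> j = 1" using that by arith
      then show ?thesis using L R by (auto simp: bideg_def)
    qed
    then show "Y \<in> eta1 G H ` carrier ?D" if "Y \<in> carrier (gr P 1)" for Y
      using eta_surj[OF _ D eta1_hom _ that] by simp
  qed
qed

lemma eta2_iso: "eta2 G H \<in> lin_iso F3 (gr G 2 \<oplus>\<^sub>m tens 1 1 \<oplus>\<^sub>m gr H 2) (gr P 2)"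
proof -
  interpret M: f3space "gr P 2" using P.f3space_gr by simp
  interpret A: f3space "gr G 2" using G.f3space_gr by simp
  interpret B: f3space "gr H 2" using H.f3space_gr by simp
  interpret T: f3space "tens 1 1" using f3space_gr_tensor by simp
  note [simp del] = One_nat_def
  let ?D = "gr G 2 \<oplus>\<^sub>m tens 1 1 \<oplus>\<^sub>m gr H 2"
  have D: "f3space ?D"
    by (intro f3space_dsum A.f3space_axioms B.f3space_axioms T.f3space_axioms)
  have one: "(1::nat) \<le> 1" "(1::nat) + 1 = 2" by simp_all
  note z = eta_zero[of 2] eta_mixed_zero[OF one(1) one]
  note c = eta_left_closed[of _ 2] eta_right_closed[of _ 2] eta_mixed_closed[OF one(1) one]
  show ?thesis
  proof (rule lin_isoI[OF D M.f3space_axioms eta2_hom])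
    fix x assume "x \<in> carrier ?D" and 0: "eta2 G H x = \<zero>\<^bsub>gr P 2\<^esub>"
    then obtain a t b where x: "x = (a, t, b)" "a \<in> carrier (gr G 2)"
      "t \<in> carrier (tens 1 1)" "b \<in> carrier (gr H 2)"
      by (auto simp: dsum_def)
    obtain r where r: "r \<in> ahom (gr P 2) (gr G 2)"
      "\<And>X. X \<in> carrier (gr G 2) \<Longrightarrow> r (etaL 2 X) = X"
      "\<And>Y. Y \<in> carrier (gr H 2) \<Longrightarrow> r (etaR 2 Y) = \<zero>\<^bsub>gr G 2\<^esub>"
      "\<And>t. t \<in> carrier (tens 1 1) \<Longrightarrow> r (etaM 1 1 t) = \<zero>\<^bsub>gr G 2\<^esub>"
      using retraction_left[of 2] one by (metis one_le_numeral)
    obtain s where s: "s \<in> ahom (gr P 2) (gr H 2)"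
      "\<And>X. X \<in> carrier (gr G 2) \<Longrightarrow> s (etaL 2 X) = \<zero>\<^bsub>gr H 2\<^esub>"
      "\<And>Y. Y \<in> carrier (gr H 2) \<Longrightarrow> s (etaR 2 Y) = Y"
      "\<And>t. t \<in> carrier (tens 1 1) \<Longrightarrow> s (etaM 1 1 t) = \<zero>\<^bsub>gr H 2\<^esub>"
      using retraction_right[of 2] one by (metis one_le_numeral)
    have "r (eta2 G H x) = a" "s (eta2 G H x) = b"
      using x r s c by (auto simp: eta2_def hom_def)
    then have ab: "a = \<zero>\<^bsub>gr G 2\<^esub>" "b = \<zero>\<^bsub>gr H 2\<^esub>"
      using 0 f3space_hom_zero[OF M.f3space_axioms A.f3space_axioms r(1)]
        f3space_hom_zero[OF M.f3space_axioms B.f3space_axioms s(1)]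
      by simp_all
    then have t0: "etaM 1 1 t = \<zero>\<^bsub>gr P 2\<^esub>"
      using 0 x c z by (simp add: eta2_def)
    have "t = \<zero>\<^bsub>tens 1 1\<^esub>"
    proof (rule tensor_eq_zero[OF one(1) one(1) x(3)])
      show "separating (gr G 1) (functionals (gr G 1))" "separating (gr H 1) (functionals (gr H 1))"
        using f3space.separating_functionals G.f3space_gr H.f3space_gr one by blast+
      fix \<phi> \<psi> assume \<phi>: "\<phi> \<in> functionals (gr G 1)" and \<psi>: "\<psi> \<in> functionals (gr H 1)"
      obtain l where "l \<in> functionals (gr P 2)"
        "\<And>x y. x \<in> carrier G \<Longrightarrow> y \<in> carrier H \<Longrightarrow>
          l (gcls P 2 (comm P (\<iota> x) (\<kappa> y))) = \<phi> (gcls G 1 x) * \<psi> (gcls H 1 y)"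
        using heis_pairing[OF exps inl_hom inr_hom
            coprod3_universal[OF exponent3_heis] \<phi> \<psi>] by blast
      then show "\<exists>l\<in>functionals (gr P (1 + 1)). l (etaM 1 1 t) = 0 \<and>
          (\<forall>x\<in>lcs G 1. \<forall>y\<in>lcs H 1.
            l (gcls P (1 + 1) (comm P (\<iota> x) (\<kappa> y))) = \<phi> (gcls G 1 x) * \<psi> (gcls H 1 y))"
        unfolding one t0 using M.functionals_zero G.lcs_carrier H.lcs_carrier by blast
    qed
    then show "x = \<zero>\<^bsub>?D\<^esub>"
      using x ab by (simp add: dsum_def)
  next
    have L: "etaL 2 X \<in> eta2 G H ` carrier ?D" if "X \<in> carrier (gr G 2)" for X
      using that c z
      by (intro image_eqI[of _ _ "(X, \<zero>\<^bsub>tens 1 1\<^esub>, \<zero>\<^bsub>gr H 2\<^esub>)"]) (auto simp: dsum_def eta2_def)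
    have R: "etaR 2 Y \<in> eta2 G H ` carrier ?D" if "Y \<in> carrier (gr H 2)" for Y
      using that c z
      by (intro image_eqI[of _ _ "(\<zero>\<^bsub>gr G 2\<^esub>, \<zero>\<^bsub>tens 1 1\<^esub>, Y)"]) (auto simp: dsum_def eta2_def)
    have X: "etaM 1 1 t \<in> eta2 G H ` carrier ?D" if "t \<in> carrier (tens 1 1)" for t
      using that c z
      by (intro image_eqI[of _ _ "(\<zero>\<^bsub>gr G 2\<^esub>, t, \<zero>\<^bsub>gr H 2\<^esub>)"]) (auto simp: dsum_def eta2_def)
    have "\<B> i j \<subseteq> eta2 G H ` carrier ?D" if "i + j = 2" for i j
    proof -
      have "i = 2 \<and> j = 0 \<or> i = 0 \<and> j = 2 \<or> i = 1 \<and> j = 1" using that by arith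
      then show ?thesis using L R X by (auto simp: bideg_def)
    qed
    then show "Y \<in> eta2 G H ` carrier ?D" if "Y \<in> carrier (gr P 2)" for Y
      using eta_surj[OF _ D eta2_hom _ that] by simp
  qed
qed

lemma pairing_2_1:
  assumes "\<phi> \<in> engel_functionals G" "\<psi> \<in> functionals (gr H 1)"
  obtains l where "l \<in> functionals (gr P 3)"
    "\<And>c y. c \<in> lcs G 2 \<Longrightarrow> y \<in> carrier H \<Longrightarrow>
      l (gcls P 3 (comm P (\<iota> c) (\<kappa> y))) = \<phi> (gcls G 2 c) * \<psi> (gcls H 1 y)"
    "\<And>x d. x \<in> carrier G \<Longrightarrow> d \<in> lcs H 2 \<Longrightarrow> l (gcls P 3 (comm P (\<iota> x) (\<kappa> d))) = 0"
  using engel_pairing[OF exps inl_hom inr_hom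
      coprod3_universal[OF G.exponent3_engel_ext] assms] by blast

text \<open>\<open>engel_pairing\<close> with the factors exchanged. It evaluates [d, x] where
  [x, d] is wanted, which accounts for the minus sign on \<open>l\<close>.\<close>

lemma pairing_1_2:
  assumes "\<phi> \<in> functionals (gr G 1)" "\<psi> \<in> engel_functionals H"
  obtains l where "l \<in> functionals (gr P 3)"
    "\<And>x d. x \<in> carrier G \<Longrightarrow> d \<in> lcs H 2 \<Longrightarrow>
      l (gcls P 3 (comm P (\<iota> x) (\<kappa> d))) = \<phi> (gcls G 1 x) * \<psi> (gcls H 2 d)"
proof -
  interpret M: f3space "gr P 3" using P.f3space_gr by simp
  have univ: "\<exists>\<theta>\<in>hom P (engel_ext H). (\<forall>y\<in>carrier H. \<theta> (\<kappa> y) = u y) \<and> (\<forall>x\<in>carrier G. \<theta> (\<iota> x) = v x)"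
    if "u \<in> hom H (engel_ext H)" "v \<in> hom G (engel_ext H)" for u v
    using coprod3_universal[OF H.exponent3_engel_ext that(2,1)] by blast
  obtain l where l: "l \<in> functionals (gr P 3)"
    "\<And>d x. d \<in> lcs H 2 \<Longrightarrow> x \<in> carrier G \<Longrightarrow>
      l (gcls P 3 (comm P (\<kappa> d) (\<iota> x))) = \<psi> (gcls H 2 d) * \<phi> (gcls G 1 x)"
    by (rule engel_pairing[OF H.exponent3_axioms G.exponent3_axioms P.exponent3_axioms inr_hom inl_hom
          univ assms(2,1)])
      (assumption+, rule that, assumption, blast)
  show ?thesis
  proof (rule that)
    show "(\<lambda>X. - l X) \<in> functionals (gr P 3)"
      using l(1) by (simp add: functionals_def)
    fix x d assume xd: "x \<in> carrier G" "d \<in> lcs H 2"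
    then have d: "d \<in> carrier H" using H.lcs_carrier by blast
    have k: "comm P (\<kappa> d) (\<iota> x) \<in> lcs P 3"
      using P.comm_in_lcs_Suc(1)[of 2 "\<kappa> d" "\<iota> x"] \<kappa>.hom_lcs[OF xd(2)] xd by (simp add: numeral_3_eq_3 numeral_2_eq_2)
    have "comm P (\<iota> x) (\<kappa> d) = inv\<^bsub>P\<^esub> (comm P (\<kappa> d) (\<iota> x))"
      using xd d by (simp add: P.inv_commutator)
    then have "gcls P 3 (comm P (\<iota> x) (\<kappa> d)) = \<ominus>\<^bsub>gr P 3\<^esub> gcls P 3 (comm P (\<kappa> d) (\<iota> x))"
      using P.gcls_inv[of 3] k by simp
    then show "- l (gcls P 3 (comm P (\<iota> x) (\<kappa> d))) = \<phi> (gcls G 1 x) * \<psi> (gcls H 2 d)"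
      using M.functionals_minus[OF l(1) P.gcls_closed[OF k]] l(2) xd by (simp add: mult.commute)
  qed
qed

text \<open>After the retractions have removed the outer coordinates, the two tensor coordinates are
  treated in turn: the pairings from \<open>pairing_2_1\<close> ignore \<open>u\<close> and force
  \<open>t\<close> to vanish, after which the image of \<open>u\<close> is zero by itself.\<close>

lemma eta3_iso:
  "eta3 G H \<in> lin_iso F3 (gr G 3 \<oplus>\<^sub>m tens 2 1 \<oplus>\<^sub>m tens 1 2 \<oplus>\<^sub>m gr H 3) (gr P 3)"
proof -
  interpret M: f3space "gr P 3" using P.f3space_gr by simp
  interpret A: f3space "gr G 3" using G.f3space_gr by simp
  interpret B: f3space "gr H 3" using H.f3space_gr by simp
  interpret T: f3space "tens 2 1" using f3space_gr_tensor by simp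
  interpret U: f3space "tens 1 2" using f3space_gr_tensor by simp
  note [simp del] = One_nat_def
  let ?D = "gr G 3 \<oplus>\<^sub>m tens 2 1 \<oplus>\<^sub>m tens 1 2 \<oplus>\<^sub>m gr H 3"
  have D: "f3space ?D"
    by (intro f3space_dsum A.f3space_axioms B.f3space_axioms T.f3space_axioms U.f3space_axioms)
  have le: "(1::nat) \<le> 1" "(1::nat) \<le> 2" and le3: "(1::nat) \<le> 3" by simp_all
  have s: "(2::nat) + 1 = 3" "(1::nat) + 2 = 3" by simp_all
  note z = eta_zero[of 3] eta_mixed_zero[OF le(2,1) s(1)] eta_mixed_zero[OF le s(2)]
  note c = eta_left_closed[of _ 3] eta_right_closed[of _ 3]
    eta_mixed_closed[OF le(2,1) s(1)] eta_mixed_closed[OF le s(2)]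
  show ?thesis
  proof (rule lin_isoI[OF D M.f3space_axioms eta3_hom])
    fix x assume "x \<in> carrier ?D" and 0: "eta3 G H x = \<zero>\<^bsub>gr P 3\<^esub>"
    then obtain a t u b where x: "x = (a, t, u, b)" "a \<in> carrier (gr G 3)"
      "t \<in> carrier (tens 2 1)" "u \<in> carrier (tens 1 2)" "b \<in> carrier (gr H 3)"
      by (auto simp: dsum_def)
    obtain r where r: "r \<in> ahom (gr P 3) (gr G 3)"
      "\<And>X. X \<in> carrier (gr G 3) \<Longrightarrow> r (etaL 3 X) = X"
      "\<And>Y. Y \<in> carrier (gr H 3) \<Longrightarrow> r (etaR 3 Y) = \<zero>\<^bsub>gr G 3\<^esub>"
      "\<And>i j t. i \<ge> 1 \<Longrightarrow> j \<ge> 1 \<Longrightarrow> i + j = 3 \<Longrightarrow> t \<in> carrier (tens i j) \<Longrightarrow>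
        r (etaM i j t) = \<zero>\<^bsub>gr G 3\<^esub>"
      by (rule retraction_left[OF le3]) (rule that, assumption, simp_all)
    obtain q where q: "q \<in> ahom (gr P 3) (gr H 3)"
      "\<And>X. X \<in> carrier (gr G 3) \<Longrightarrow> q (etaL 3 X) = \<zero>\<^bsub>gr H 3\<^esub>"
      "\<And>Y. Y \<in> carrier (gr H 3) \<Longrightarrow> q (etaR 3 Y) = Y"
      "\<And>i j t. i \<ge> 1 \<Longrightarrow> j \<ge> 1 \<Longrightarrow> i + j = 3 \<Longrightarrow> t \<in> carrier (tens i j) \<Longrightarrow>
        q (etaM i j t) = \<zero>\<^bsub>gr H 3\<^esub>"
      by (rule retraction_right[OF le3]) (rule that, assumption, simp_all)
    have "r (eta3 G H x) = a" "q (eta3 G H x) = b"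
      using x r(1-3) q(1-3) c r(4)[OF le(2,1) s(1) x(3)] r(4)[OF le s(2) x(4)]
        q(4)[OF le(2,1) s(1) x(3)] q(4)[OF le s(2) x(4)]
      by (auto simp: eta3_def hom_def)
    then have ab: "a = \<zero>\<^bsub>gr G 3\<^esub>" "b = \<zero>\<^bsub>gr H 3\<^esub>"
      using 0 f3space_hom_zero[OF M.f3space_axioms A.f3space_axioms r(1)]
        f3space_hom_zero[OF M.f3space_axioms B.f3space_axioms q(1)]
      by simp_all
    then have tu: "etaM 2 1 t \<oplus>\<^bsub>gr P 3\<^esub> etaM 1 2 u = \<zero>\<^bsub>gr P 3\<^esub>"
      using 0 x c z by (simp add: eta3_def)
    have sep: "separating (gr G 1) (functionals (gr G 1))" "separating (gr H 1) (functionals (gr H 1))"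
      using f3space.separating_functionals G.f3space_gr H.f3space_gr le by blast+
    have t: "t = \<zero>\<^bsub>tens 2 1\<^esub>"
    proof (rule tensor_eq_zero[OF le(2,1) x(3) G.separating_engel_functionals sep(2)])
      fix \<phi> \<psi> assume \<phi>: "\<phi> \<in> engel_functionals G" and \<psi>: "\<psi> \<in> functionals (gr H 1)"
      obtain l where l: "l \<in> functionals (gr P 3)"
        "\<And>c y. c \<in> lcs G 2 \<Longrightarrow> y \<in> carrier H \<Longrightarrow>
          l (gcls P 3 (comm P (\<iota> c) (\<kappa> y))) = \<phi> (gcls G 2 c) * \<psi> (gcls H 1 y)"
        "\<And>x d. x \<in> carrier G \<Longrightarrow> d \<in> lcs H 2 \<Longrightarrow> l (gcls P 3 (comm P (\<iota> x) (\<kappa> d))) = 0"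
        using pairing_2_1[OF \<phi> \<psi>] by blast
      \<comment> \<open>This lets \<open>l\<close> see \<open>t\<close> alone in the relation
        \<open>tu\<close>.\<close>
      have "l (etaM 1 2 u) = 0"
        using l(3) G.lcs_carrier le
        by (intro functional_eta_mixed_zero[OF le x(4), unfolded s, OF l(1)]) blast
      then have "l (etaM 2 1 t) = 0"
        using functionals_add[OF l(1) c(3)[OF x(3)] c(4)[OF x(4)]] tu M.functionals_zero[OF l(1)] by simp
      then show "\<exists>l\<in>functionals (gr P (2 + 1)). l (etaM 2 1 t) = 0 \<and>
          (\<forall>x\<in>lcs G 2. \<forall>y\<in>lcs H 1.
            l (gcls P (2 + 1) (comm P (\<iota> x) (\<kappa> y))) = \<phi> (gcls G 2 x) * \<psi> (gcls H 1 y))"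
        unfolding s using l(1,2) H.lcs_carrier by blast
    qed
    then have u0: "etaM 1 2 u = \<zero>\<^bsub>gr P 3\<^esub>"
      using tu z c x by simp
    have u: "u = \<zero>\<^bsub>tens 1 2\<^esub>"
    proof (rule tensor_eq_zero[OF le x(4) sep(1) H.separating_engel_functionals])
      fix \<phi> \<psi> assume \<phi>: "\<phi> \<in> functionals (gr G 1)" and \<psi>: "\<psi> \<in> engel_functionals H"
      obtain l where "l \<in> functionals (gr P 3)"
        "\<And>x d. x \<in> carrier G \<Longrightarrow> d \<in> lcs H 2 \<Longrightarrow>
          l (gcls P 3 (comm P (\<iota> x) (\<kappa> d))) = \<phi> (gcls G 1 x) * \<psi> (gcls H 2 d)"
        using pairing_1_2[OF \<phi> \<psi>] by blast
      then show "\<exists>l\<in>functionals (gr P (1 + 2)). l (etaM 1 2 u) = 0 \<and>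
          (\<forall>x\<in>lcs G 1. \<forall>y\<in>lcs H 2.
            l (gcls P (1 + 2) (comm P (\<iota> x) (\<kappa> y))) = \<phi> (gcls G 1 x) * \<psi> (gcls H 2 y))"
        unfolding s u0 using M.functionals_zero G.lcs_carrier by blast
    qed
    show "x = \<zero>\<^bsub>?D\<^esub>"
      using x ab t u by (simp add: dsum_def)
  next
    have L: "etaL 3 X \<in> eta3 G H ` carrier ?D" if "X \<in> carrier (gr G 3)" for X
      using that c z
      by (intro image_eqI[of _ _ "(X, \<zero>\<^bsub>tens 2 1\<^esub>, \<zero>\<^bsub>tens 1 2\<^esub>, \<zero>\<^bsub>gr H 3\<^esub>)"])
        (auto simp: dsum_def eta3_def)
    have R: "etaR 3 Y \<in> eta3 G H ` carrier ?D" if "Y \<in> carrier (gr H 3)" for Y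
      using that c z
      by (intro image_eqI[of _ _ "(\<zero>\<^bsub>gr G 3\<^esub>, \<zero>\<^bsub>tens 2 1\<^esub>, \<zero>\<^bsub>tens 1 2\<^esub>, Y)"])
        (auto simp: dsum_def eta3_def)
    have X: "etaM 2 1 t \<in> eta3 G H ` carrier ?D" if "t \<in> carrier (tens 2 1)" for t
      using that c z
      by (intro image_eqI[of _ _ "(\<zero>\<^bsub>gr G 3\<^esub>, t, \<zero>\<^bsub>tens 1 2\<^esub>, \<zero>\<^bsub>gr H 3\<^esub>)"])
        (auto simp: dsum_def eta3_def)
    have Y: "etaM 1 2 t \<in> eta3 G H ` carrier ?D" if "t \<in> carrier (tens 1 2)" for t
      using that c z
      by (intro image_eqI[of _ _ "(\<zero>\<^bsub>gr G 3\<^esub>, \<zero>\<^bsub>tens 2 1\<^esub>, t, \<zero>\<^bsub>gr H 3\<^esub>)"])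
        (auto simp: dsum_def eta3_def)
    have "\<B> i j \<subseteq> eta3 G H ` carrier ?D" if "i + j = 3" for i j
    proof -
      have "i = 3 \<and> j = 0 \<or> i = 0 \<and> j = 3 \<or> i = 2 \<and> j = 1 \<or> i = 1 \<and> j = 2" using that by arith
      then show ?thesis using L R X Y by (auto simp: bideg_def)
    qed
    then show "Y \<in> eta3 G H ` carrier ?D" if "Y \<in> carrier (gr P 3)" for Y
      using eta_surj[OF _ D eta3_hom _ that] by simp
  qed
qed

end

theorem proposition4p4:
  fixes G\<^sub>0 :: "('a, 'c) monoid_scheme" and G\<^sub>1 :: "('b, 'd) monoid_scheme"
  assumes "exponent3_group G\<^sub>0" and "exponent3_group G\<^sub>1"
  defines "P \<equiv> coprod3 G\<^sub>0 G\<^sub>1"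
  shows "eta1 G\<^sub>0 G\<^sub>1 \<in> lin_iso F3 (gr G\<^sub>0 1 \<oplus>\<^sub>m gr G\<^sub>1 1) (gr P 1)
    \<and> eta2 G\<^sub>0 G\<^sub>1 \<in> lin_iso F3 (gr G\<^sub>0 2 \<oplus>\<^sub>m gr_tensor G\<^sub>0 G\<^sub>1 1 1 \<oplus>\<^sub>m gr G\<^sub>1 2) (gr P 2)
    \<and> eta3 G\<^sub>0 G\<^sub>1 \<in> lin_iso F3
        (gr G\<^sub>0 3 \<oplus>\<^sub>m gr_tensor G\<^sub>0 G\<^sub>1 2 1 \<oplus>\<^sub>m gr_tensor G\<^sub>0 G\<^sub>1 1 2 \<oplus>\<^sub>m gr G\<^sub>1 3) (gr P 3)
    \<and> (\<forall>i j k l. (i, j) \<noteq> (0, 0) \<and> (k, l) \<noteq> (0, 0) \<longrightarrow>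
        gr_bracket_span P (i + j) (k + l) (bideg G\<^sub>0 G\<^sub>1 i j) (bideg G\<^sub>0 G\<^sub>1 k l)
          \<subseteq> bideg G\<^sub>0 G\<^sub>1 (i + k) (j + l))"
proof -
  interpret exponent3_coproduct G\<^sub>0 G\<^sub>1
    using assms(1,2) by (simp add: exponent3_coproduct_def exponent3_group_imp)
  show ?thesis
    unfolding P_def using eta1_iso eta2_iso eta3_iso bracket_span_bideg by blast
qed

end
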